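(* Let $n\ge1$ and $k\ge2$ be integers and let $\varphi(x)=|x|^2$ on $\mathbb{R}^{4n}$. Then $$4\|f\|_\varphi^2\le\|\mathscr D_0^*f\|_\varphi^2+\|\mathscr D_1f\|_\varphi^2$$ for any $f\in\mathrm{Dom}(\mathscr D_0^* )\cap\mathrm{Dom}(\mathscr D_1)$.
   Context: Primed indices $A',B',A_1',\dots$ range over $\{0',1'\}$; unprimed indices $A,B$ range over $\{0,\dots,2n-1\}$; $i=\sqrt{-1}$. Vector fields on $\mathbb{R}^{4n}$: for $l=0,\dots,n-1$, $Z_{(2l)0'}=\partial_{x_{4l+1}}+i\partial_{x_{4l+2}}$, $Z_{(2l)1'}=-\partial_{x_{4l+3}}-i\partial_{x_{4l+4}}$, $Z_{(2l+1)0'}=\partial_{x_{4l+3}}-i\partial_{x_{4l+4}}$, $Z_{(2l+1)1'}=\partial_{x_{4l+1}}-i\partial_{x_{4l+2}}$. Put $Z_A^{0'}:=Z_{A1'}$, $Z_A^{1'}:=-Z_{A0'}$. Spaces: $\mathscr V_0=\odot^k\mathbb{C}^2$ (tuples $(f_{A_1'\ldots A_k'})$ symmetric in all indices), $\mathscr V_1=\odot^{k-1}\mathbb{C}^2\otimes\mathbb{C}^{2n}$ (tuples $(f_{A_2'\ldots A_k'A})$ symmetric in the primed indices; also written $f_{AA_2'\ldots A_k'}$), $\mathscr V_2=\odot^{k-2}\mathbb{C}^2\otimes\wedge^2\mathbb{C}^{2n}$ (tuples $(f_{ABA_3'\ldots A_k'})$ symmetric in the primed indices and antisymmetric in $A,B$).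 The inner product $\langle f,g\rangle$ on each $\mathscr V_j$ is the sum of $f_I\overline{g_I}$ over all index tuples $I$ (all values of every index). $L^2_\varphi(\mathbb{R}^{4n},\mathscr V_j)$ is the Hilbert space with inner product $\langle f,g\rangle_\varphi=\int_{\mathbb{R}^{4n}}\langle f,g\rangle e^{-2\varphi}dV$ ($dV$ Lebesgue measure) and norm $\|f\|_\varphi=\langle f,f\rangle_\varphi^{1/2}$. Operators: $(\mathscr D_0f)_{A_2'\ldots A_k'A}=\sum_{A_1'=0',1'}Z_A^{A_1'}f_{A_1'A_2'\ldots A_k'}$, and $(\mathscr D_1h)_{ABA_3'\ldots A_k'}=\sum_{A'=0',1'}\big(Z_A^{A'}h_{BA'A_3'\ldots A_k'}-Z_B^{A'}h_{AA'A_3'\ldots A_k'}\big)$. They are viewed as densely defined closed operators $L^2_\varphi(\mathbb{R}^{4n},\mathscr V_0)\to L^2_\varphi(\mathbb{R}^{4n},\mathscr V_1)\to L^2_\varphi(\mathbb{R}^{4n},\mathscr V_2)$, acting in the sense of distributions, with $\mathrm{Dom}(\mathscr D_j)=\{f\in L^2_\varphi(\mathbb{R}^{4n},\mathscr V_j):\mathscr D_jf\in L^2_\varphi(\mathbb{R}^{4n},\mathscr V_{j+1})\}$. $\mathscr D_0^*$ is the Hilbert space adjoint of $\mathscr D_0$ with respect to $\langle\cdot,\cdot\rangle_\varphi$. *)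

theory Defs
  imports "HOL-Analysis.Analysis"
begin

text \<open>
  The space R^{4n} is \<open>real^4^'n\<close> with n = \<open>CARD('n)\<close>: the coordinate x_{4l+j} of the
  mathematical text (j = 1,...,4) is \<open>x $ l $ j\<close>. (In the type \<open>4\<close> the numeral 4 is the
  same element as 0.)
  A primed index 0', 1' is an element 0, 1 of the type \<open>2\<close>. An unprimed index
  2l + r (r = 0, 1) is the pair \<open>(l, r)\<close> of type \<open>'n \<times> 2\<close>.
\<close>

type_synonym 'n space = "real^4^'n"
type_synonym 'n unprimed = "'n \<times> 2"

primrec C_upto :: "nat \<Rightarrow> ('a::euclidean_space \<Rightarrow> complex) \<Rightarrow> bool" where
  "C_upto 0 f \<longleftrightarrow> continuous_on UNIV f"
| "C_upto (Suc m) f \<longleftrightarrow> (\<forall>x. f differentiable (at x)) \<and>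
     (\<forall>v. C_upto m (\<lambda>x. frechet_derivative f (at x) v))"

definition test_functions :: "('a::euclidean_space \<Rightarrow> complex) set" where
  "test_functions = {\<psi>. (\<forall>m. C_upto m \<psi>) \<and> compact (closure {x. \<psi> x \<noteq> 0})}"

text \<open>Distributions are represented by functionals, of which only the values on
  \<^const>\<open>test_functions\<close> are ever used.\<close>

type_synonym 'a distr = "('a \<Rightarrow> complex) \<Rightarrow> complex"

definition distr_of :: "('a::euclidean_space \<Rightarrow> complex) \<Rightarrow> 'a distr" where
  "distr_of u = (\<lambda>\<psi>. \<integral>x. u x * \<psi> x \<partial>lebesgue)"

definition pd :: "'n::finite \<Rightarrow> 4 \<Rightarrow> 'n space distr \<Rightarrow> 'n space distr" where
  "pd l j T = (\<lambda>\<psi>. - T (\<lambda>x. frechet_derivative \<psi> (at x) (axis l (axis j 1))))"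

text \<open>\<open>Z_low (l, r) A'\<close> is Z_{(2l+r)A'} and \<open>Z_up A A'\<close> is Z_A^{A'}, acting on distributions.\<close>

definition Z_low :: "'n::finite unprimed \<Rightarrow> 2 \<Rightarrow> 'n space distr \<Rightarrow> 'n space distr" where
  "Z_low A A' T = (case A of (l, r) \<Rightarrow>
     if r = 0
     then (if A' = 0 then (\<lambda>\<psi>. pd l 1 T \<psi> + \<i> * pd l 2 T \<psi>)
                     else (\<lambda>\<psi>. - pd l 3 T \<psi> - \<i> * pd l 4 T \<psi>))
     else (if A' = 0 then (\<lambda>\<psi>. pd l 3 T \<psi> - \<i> * pd l 4 T \<psi>)
                     else (\<lambda>\<psi>. pd l 1 T \<psi> - \<i> * pd l 2 T \<psi>)))"

definition Z_up :: "'n::finite unprimed \<Rightarrow> 2 \<Rightarrow> 'n space distr \<Rightarrow> 'n space distr" where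
  "Z_up A A' T = (if A' = 0 then Z_low A 1 T else (\<lambda>\<psi>. - Z_low A 0 T \<psi>))"

text \<open>A tuple of primed indices is a list; tuples of complex numbers are extended by 0 outside
  their index set. The component f_{A_2'...A_k'A} of an element of V1 is \<open>f (A, [A_2',...,A_k'])\<close>,
  and f_{ABA_3'...A_k'} is \<open>f (A, B, [A_3',...,A_k'])\<close>.
  Symmetry is invariance under rearrangement of the list.\<close>

type_synonym ix0 = "2 list"
type_synonym 'n ix1 = "'n unprimed \<times> 2 list"
type_synonym 'n ix2 = "'n unprimed \<times> 'n unprimed \<times> 2 list"

definition Ix0 :: "nat \<Rightarrow> ix0 set" where
  "Ix0 k = {I. length I = k}"

definition Ix1 :: "nat \<Rightarrow> 'n ix1 set" where
  "Ix1 k = {(A, I). length I = k - 1}"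

definition Ix2 :: "nat \<Rightarrow> 'n ix2 set" where
  "Ix2 k = {(A, B, I). length I = k - 2}"

definition V0 :: "nat \<Rightarrow> (ix0 \<Rightarrow> complex) set" where
  "V0 k = {f. (\<forall>I. I \<notin> Ix0 k \<longrightarrow> f I = 0) \<and> (\<forall>I J. mset I = mset J \<longrightarrow> f I = f J)}"

definition V1 :: "nat \<Rightarrow> ('n ix1 \<Rightarrow> complex) set" where
  "V1 k = {f. (\<forall>K. K \<notin> Ix1 k \<longrightarrow> f K = 0) \<and>
              (\<forall>A I J. mset I = mset J \<longrightarrow> f (A, I) = f (A, J))}"

definition V2 :: "nat \<Rightarrow> ('n ix2 \<Rightarrow> complex) set" where
  "V2 k = {f. (\<forall>K. K \<notin> Ix2 k \<longrightarrow> f K = 0) \<and>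
              (\<forall>A B I J. mset I = mset J \<longrightarrow> f (A, B, I) = f (A, B, J)) \<and>
              (\<forall>A B I. f (A, B, I) = - f (B, A, I))}"

definition tip :: "'i set \<Rightarrow> ('i \<Rightarrow> complex) \<Rightarrow> ('i \<Rightarrow> complex) \<Rightarrow> complex" where
  "tip S u v = (\<Sum>I\<in>S. u I * cnj (v I))"

definition ip_w :: "('a::euclidean_space \<Rightarrow> real) \<Rightarrow> 'i set \<Rightarrow>
    ('a \<Rightarrow> 'i \<Rightarrow> complex) \<Rightarrow> ('a \<Rightarrow> 'i \<Rightarrow> complex) \<Rightarrow> complex" where
  "ip_w \<phi> S f g = (\<integral>x. tip S (f x) (g x) * of_real (exp (- 2 * \<phi> x)) \<partial>lebesgue)"

definition norm_w :: "('a::euclidean_space \<Rightarrow> real) \<Rightarrow> 'i set \<Rightarrow> ('a \<Rightarrow> 'i \<Rightarrow> complex) \<Rightarrow> real" where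
  "norm_w \<phi> S f = sqrt (Re (ip_w \<phi> S f f))"

text \<open>Elements of $L^2$ are represented by functions; nothing below depends on the
  representative modulo null sets.\<close>

definition L2_w :: "('a::euclidean_space \<Rightarrow> real) \<Rightarrow> 'i set \<Rightarrow> ('i \<Rightarrow> complex) set \<Rightarrow>
    ('a \<Rightarrow> 'i \<Rightarrow> complex) set" where
  "L2_w \<phi> S V = {f. (\<forall>x. f x \<in> V) \<and> (\<forall>I\<in>S. (\<lambda>x. f x I) \<in> borel_measurable lebesgue) \<and>
     integrable lebesgue (\<lambda>x. tip S (f x) (f x) * of_real (exp (- 2 * \<phi> x)))}"

definition D0_distr :: "(ix0 \<Rightarrow> 'n::finite space distr) \<Rightarrow> 'n ix1 \<Rightarrow> 'n space distr" where
  "D0_distr F = (\<lambda>(A, I) \<psi>. \<Sum>A'\<in>UNIV. Z_up A A' (F (A' # I)) \<psi>)"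

definition D1_distr :: "('n::finite ix1 \<Rightarrow> 'n space distr) \<Rightarrow> 'n ix2 \<Rightarrow> 'n space distr" where
  "D1_distr H = (\<lambda>(A, B, I) \<psi>. \<Sum>A'\<in>UNIV.
     Z_up A A' (H (B, A' # I)) \<psi> - Z_up B A' (H (A, A' # I)) \<psi>)"

text \<open>The unbounded operators are given by their graphs. Each graph is single-valued modulo null
  sets, the second component being the (representative of the) image of the first.\<close>

definition D0_graph :: "('n::finite space \<Rightarrow> real) \<Rightarrow> nat \<Rightarrow>
    (('n space \<Rightarrow> ix0 \<Rightarrow> complex) \<times> ('n space \<Rightarrow> 'n ix1 \<Rightarrow> complex)) set" where
  "D0_graph \<phi> k = {(f, g). f \<in> L2_w \<phi> (Ix0 k) (V0 k) \<and> g \<in> L2_w \<phi> (Ix1 k) (V1 k) \<and>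
     (\<forall>K\<in>Ix1 k. \<forall>\<psi>\<in>test_functions.
        D0_distr (\<lambda>J. distr_of (\<lambda>x. f x J)) K \<psi> = distr_of (\<lambda>x. g x K) \<psi>)}"

definition D1_graph :: "('n::finite space \<Rightarrow> real) \<Rightarrow> nat \<Rightarrow>
    (('n space \<Rightarrow> 'n ix1 \<Rightarrow> complex) \<times> ('n space \<Rightarrow> 'n ix2 \<Rightarrow> complex)) set" where
  "D1_graph \<phi> k = {(f, g). f \<in> L2_w \<phi> (Ix1 k) (V1 k) \<and> g \<in> L2_w \<phi> (Ix2 k) (V2 k) \<and>
     (\<forall>K\<in>Ix2 k. \<forall>\<psi>\<in>test_functions.
        D1_distr (\<lambda>J. distr_of (\<lambda>x. f x J)) K \<psi> = distr_of (\<lambda>x. g x K) \<psi>)}"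

definition D0_adj_graph :: "('n::finite space \<Rightarrow> real) \<Rightarrow> nat \<Rightarrow>
    (('n space \<Rightarrow> 'n ix1 \<Rightarrow> complex) \<times> ('n space \<Rightarrow> ix0 \<Rightarrow> complex)) set" where
  "D0_adj_graph \<phi> k = {(f, g). f \<in> L2_w \<phi> (Ix1 k) (V1 k) \<and> g \<in> L2_w \<phi> (Ix0 k) (V0 k) \<and>
     (\<forall>(u, w)\<in>D0_graph \<phi> k. ip_w \<phi> (Ix1 k) w f = ip_w \<phi> (Ix0 k) u g)}"

definition image_under :: "('a \<times> 'b) set \<Rightarrow> 'a \<Rightarrow> 'b" where
  "image_under G f = (SOME g. (f, g) \<in> G)"

abbreviation "Dom_D1 \<phi> k \<equiv> Domain (D1_graph \<phi> k)"
abbreviation "Dom_D0_adj \<phi> k \<equiv> Domain (D0_adj_graph \<phi> k)"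
abbreviation "D1 \<phi> k \<equiv> image_under (D1_graph \<phi> k)"
abbreviation "D0_adj \<phi> k \<equiv> image_under (D0_adj_graph \<phi> k)"

end

theory Submission
  imports Defs "HOL-Probability.Distributions"
begin

text \<open>
  For a smooth compactly supported \<open>f\<close> the estimate is a commutator computation. Up to
  symmetrization over the primed indices, the adjoint of \<open>D0\<close> maps \<open>f\<close> to the tensor \<open>T\<close> with
  components \<open>T_{A' I} = \<Sum>A. (Z_A^{A'})\<^sup>* f_{A I}\<close>, which is symmetric in \<open>I\<close>. Symmetrizing such a
  tensor yields squared norm \<open>1/k\<close> times that of \<open>T\<close> plus \<open>(k-1)/k\<close> times the sum of
  \<open>\<langle>T_{A' B' J}, T_{B' A' J}\<rangle>\<close>. In the latter inner products both adjoints are moved to the other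
  side. The commutator of \<open>Z_A^{A'}\<close> and the adjoint of \<open>Z_B^{B'}\<close> is the constant 8 if
  \<open>A = B\<close> and \<open>A' = B'\<close>, and 0 otherwise: the weight is Gaussian and the coefficient vectors of the
  fields are orthogonal (\<open>zup_orthogonal\<close>). With \<open>X_{A B J} = \<Sum>A'. Z_A^{A'} f_{B A' J}\<close> this gives
  \<open>8 \<parallel>f\<parallel>\<^sup>2\<close> plus the sum of \<open>\<langle>X_{B A J}, X_{A B J}\<rangle>\<close>. The components of \<open>D1 f\<close> are
  \<open>X_{A B J} - X_{B A J}\<close>, so four times the real part of the last sum is at least \<open>- \<parallel>D1 f\<parallel>\<^sup>2\<close>.
  Altogether \<open>\<parallel>D0\<^sup>* f\<parallel>\<^sup>2 \<ge> (k-1)/k (8 \<parallel>f\<parallel>\<^sup>2 - \<parallel>D1 f\<parallel>\<^sup>2 / 4)\<close>, and \<open>1/2 \<le> (k-1)/k \<le> 1\<close> for \<open>k \<ge> 2\<close>.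

  For general \<open>f\<close> in the two domains the computation is carried out on Hermite coefficients instead
  of functions. In the space with weight \<open>exp (-2 \<bar>x\<bar>^2)\<close> a partial derivative lowers the degree of
  a Hermite polynomial by one and its adjoint raises it by one, so both operators decouple into finite
  dimensional pieces and every sum that occurs is finite (\<open>coefficient_estimate\<close>). Bessel's inequality
  bounds the truncated sums for \<open>D0\<^sup>* f\<close> and \<open>D1 f\<close> by the full norms, and Parseval's identity
  (\<open>Hermite_Parseval\<close>) recovers the norm of \<open>f\<close> in the limit.

  Two things link coefficients to the operators. The distributional identity that defines \<open>D1 f\<close> is
  tested with Hermite polynomials times weight times a smooth cutoff, and the cutoff is removed by
  dominated convergence (\<open>D1_coefficients\<close>); the adjoint of \<open>D0\<close> is paired with polynomials, which
  belong to the domain of \<open>D0\<close> (\<open>D0_adj_coefficients\<close>). Parseval's identity rests on the density of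
  polynomials (\<open>L2_wt_approximable\<close>): a bounded function \<open>b\<close> for which all \<open>b p\<close> with a polynomial \<open>p\<close>
  are limits of polynomials keeps this property when multiplied by a wide Gaussian in one
  coordinate, by Taylor expansion; hence, by Weierstrass approximation, when multiplied by the
  indicator of a strip, and then of any Borel set.
\<close>

section \<open>Smooth functions of compact support\<close>

text \<open>The classical flat functions. The polynomial factor is carried along because it makes the family
  closed under differentiation.\<close>

definition flat :: "real poly \<Rightarrow> real \<Rightarrow> real" where
  "flat q t = (if t > 0 then poly q (1 / t) * exp (- (1 / t)) else 0)"

lemma poly_times_exp_tendsto_0:
  "((\<lambda>s. poly q s * exp (- s)) \<longlongrightarrow> (0::real)) at_top"
proof -
  have "((\<lambda>s. \<Sum>i\<le>degree q. coeff q i * (s ^ i / exp s)) \<longlongrightarrow> (\<Sum>i\<le>degree q. coeff q i * 0)) at_top"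
    by (intro tendsto_sum tendsto_mult tendsto_const tendsto_power_div_exp_0)
  moreover have "poly q s * exp (- s) = (\<Sum>i\<le>degree q. coeff q i * (s ^ i / exp s))" for s
    by (simp add: poly_altdef sum_distrib_right exp_minus divide_inverse mult.assoc)
  ultimately show ?thesis by simp
qed

text \<open>At 0 the difference quotient is again a polynomial in \<open>1/t\<close> times \<open>exp (-1/t)\<close>, which tends
  to 0 because the exponential beats every polynomial.\<close>

lemma flat_has_derivative:
  "(flat q has_real_derivative flat (monom 1 2 * (q - pderiv q)) t) (at t)"
proof -
  consider "t < 0" | "t = 0" | "t > 0" by linarith
  then show ?thesis
  proof cases
    case 1
    have "((\<lambda>_. 0) has_real_derivative 0) (at t)" by simp
    moreover have "eventually (\<lambda>s. flat q s = 0) (nhds t)"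
      using eventually_nhds_in_open[of "{..<0}" t] 1
      by (auto simp: flat_def elim!: eventually_mono)
    ultimately show ?thesis
      using 1 by (subst DERIV_cong_ev[OF refl _ refl]) (auto simp: flat_def)
  next
    case 3
    have "((\<lambda>s. poly q (1 / s) * exp (- (1 / s))) has_real_derivative
        flat (monom 1 2 * (q - pderiv q)) t) (at t)"
      using 3
      by (auto intro!: derivative_eq_intros DERIV_chain'[of "\<lambda>s. 1/s" _ _ _ "poly q"] poly_DERIV
          simp: flat_def poly_monom field_simps power2_eq_square)
    moreover have "eventually (\<lambda>s. flat q s = poly q (1 / s) * exp (- (1 / s))) (nhds t)"
      using eventually_nhds_in_open[of "{0<..}" t] 3
      by (auto simp: flat_def elim!: eventually_mono)
    ultimately show ?thesis
      by (subst DERIV_cong_ev[OF refl _ refl]) auto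
  next
    case 2
    have "((\<lambda>h. flat q h / h) \<longlongrightarrow> 0) (at 0)"
    proof (rule filterlim_split_at)
      have "((\<lambda>h::real. 0) \<longlongrightarrow> 0) (at_left 0)" by simp
      moreover have "eventually (\<lambda>h. flat q h / h = 0) (at_left 0)"
        by (auto simp: flat_def eventually_at_filter)
      ultimately show "((\<lambda>h. flat q h / h) \<longlongrightarrow> 0) (at_left 0)"
        by (subst tendsto_cong) auto
      have "((\<lambda>h. poly (pCons 0 q) (inverse h) * exp (- inverse h)) \<longlongrightarrow> 0) (at_right 0)"
        by (rule filterlim_compose[OF poly_times_exp_tendsto_0 filterlim_inverse_at_top_right])
      moreover have "eventually (\<lambda>h. flat q h / h = poly (pCons 0 q) (inverse h) * exp (- inverse h)) (at_right 0)"
        by (auto simp: flat_def eventually_at_filter field_simps)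
      ultimately show "((\<lambda>h. flat q h / h) \<longlongrightarrow> 0) (at_right 0)"
        by (subst tendsto_cong) auto
    qed
    then show ?thesis using 2 by (simp add: DERIV_def flat_def)
  qed
qed

text \<open>A syntactic class that is closed under directional derivatives. For such a class differentiability
  of its members already gives derivatives of all orders, and it is large enough to contain cutoff
  functions times polynomials times Gaussians.\<close>

inductive smooth :: "('a::euclidean_space \<Rightarrow> real) \<Rightarrow> bool" where
  smooth_linear: "bounded_linear f \<Longrightarrow> smooth f"
| smooth_const: "smooth (\<lambda>x. c)"
| smooth_add: "smooth f \<Longrightarrow> smooth g \<Longrightarrow> smooth (\<lambda>x. f x + g x)"
| smooth_mult: "smooth f \<Longrightarrow> smooth g \<Longrightarrow> smooth (\<lambda>x. f x * g x)"
| smooth_exp: "smooth f \<Longrightarrow> smooth (\<lambda>x. exp (f x))"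
| smooth_flat: "smooth f \<Longrightarrow> smooth (\<lambda>x. flat q (f x))"

lemma smooth_derivative:
  assumes "smooth f"
  shows "\<exists>f'. (\<forall>x. (f has_derivative f' x) (at x)) \<and> (\<forall>v. smooth (\<lambda>x. f' x v))"
  using assms
proof induction
  case (smooth_linear f)
  then show ?case
    by (intro exI[of _ "\<lambda>x. f"]) (auto intro: bounded_linear_imp_has_derivative smooth.intros)
next
  case (smooth_const c)
  then show ?case by (intro exI[of _ "\<lambda>x v. 0"]) (auto intro: smooth.intros)
next
  case (smooth_add f g)
  then obtain f' g' where "\<forall>x. (f has_derivative f' x) (at x)" "\<forall>v. smooth (\<lambda>x. f' x v)"
    "\<forall>x. (g has_derivative g' x) (at x)" "\<forall>v. smooth (\<lambda>x. g' x v)" by blast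
  then show ?case
    by (intro exI[of _ "\<lambda>x v. f' x v + g' x v"]) (auto intro!: smooth.smooth_add has_derivative_add)
next
  case (smooth_mult f g)
  then obtain f' g' where "\<forall>x. (f has_derivative f' x) (at x)" "\<forall>v. smooth (\<lambda>x. f' x v)"
    "\<forall>x. (g has_derivative g' x) (at x)" "\<forall>v. smooth (\<lambda>x. g' x v)" by blast
  with smooth_mult.hyps show ?case
    by (intro exI[of _ "\<lambda>x v. f x * g' x v + f' x v * g x"])
      (auto intro!: smooth.intros(2-) has_derivative_mult)
next
  case (smooth_exp f)
  then obtain f' where f': "\<forall>x. (f has_derivative f' x) (at x)" "\<forall>v. smooth (\<lambda>x. f' x v)" by blast
  have "((\<lambda>x. exp (f x)) has_derivative (\<lambda>v. exp (f x) * f' x v)) (at x)" for x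
    using f'(1) by (auto intro!: derivative_eq_intros)
  with smooth_exp.hyps f' show ?case
    by (intro exI[of _ "\<lambda>x v. exp (f x) * f' x v"]) (auto intro!: smooth.intros(2-))
next
  case (smooth_flat f q)
  then obtain f' where f': "\<forall>x. (f has_derivative f' x) (at x)" "\<forall>v. smooth (\<lambda>x. f' x v)" by blast
  have "((\<lambda>x. flat q (f x)) has_derivative
      (\<lambda>v. flat (monom 1 2 * (q - pderiv q)) (f x) * f' x v)) (at x)" for x
    using has_derivative_compose[OF f'(1)[rule_format]
        flat_has_derivative[of q "f x", unfolded has_field_derivative_def]] by simp
  with smooth_flat.hyps f' show ?case
    by (intro exI[of _ "\<lambda>x v. flat (monom 1 2 * (q - pderiv q)) (f x) * f' x v"])
      (auto intro!: smooth.intros(2-))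
qed

lemma smooth_C_upto: "smooth f \<Longrightarrow> C_upto m (\<lambda>x. complex_of_real (f x))"
proof (induction m arbitrary: f)
  case 0
  obtain f' where "\<forall>x. (f has_derivative f' x) (at x)" using smooth_derivative[OF 0] by blast
  then have "continuous_on UNIV f"
    by (meson continuous_at_imp_continuous_on has_derivative_continuous)
  then show ?case by (auto intro!: continuous_intros)
next
  case (Suc m)
  obtain f' where f': "\<forall>x. (f has_derivative f' x) (at x)" "\<forall>v. smooth (\<lambda>x. f' x v)"
    using smooth_derivative[OF Suc.prems] by blast
  have d: "((\<lambda>x. complex_of_real (f x)) has_derivative (\<lambda>v. complex_of_real (f' x v))) (at x)" for x
    using f'(1) by (auto intro!: derivative_intros)
  have "frechet_derivative (\<lambda>x. complex_of_real (f x)) (at x) = (\<lambda>v. complex_of_real (f' x v))" for x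
    using frechet_derivative_at[OF d] by simp
  with d f'(2) Suc.IH show ?case by (auto simp: differentiable_def)
qed

lemma real_polynomial_smooth: "real_polynomial_function p \<Longrightarrow> smooth p"
  by (induction rule: real_polynomial_function.induct) (auto intro: smooth.intros)

lemma norm_square_smooth: "smooth (\<lambda>x::'a::euclidean_space. (norm x)\<^sup>2)"
proof -
  have "real_polynomial_function (\<lambda>x::'a. \<Sum>b\<in>Basis. (x \<bullet> b) * (x \<bullet> b))"
    by (intro real_polynomial_function_sum real_polynomial_function.intros(1,4)
        bounded_linear_inner_left) auto
  then show ?thesis
    by (simp add: power2_norm_eq_inner euclidean_inner[symmetric] real_polynomial_smooth)
qed

section \<open>Polynomials against Gaussian weights\<close>

text \<open>The exponent \<open>e\<close> has to be arbitrary: a product is estimated by giving half of it to each factor.\<close>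

lemma real_polynomial_growth:
  fixes p :: "'a::euclidean_space \<Rightarrow> real"
  assumes "real_polynomial_function p" "e > 0"
  shows "\<exists>C\<ge>0. \<forall>x. \<bar>p x\<bar> \<le> C * exp (e * (norm x)\<^sup>2)"
  using assms
proof (induction arbitrary: e)
  case (linear f)
  obtain K where K: "\<And>x. norm (f x) \<le> norm x * K" "K > 0"
    using bounded_linear.pos_bounded[OF linear(1)] by blast
  have "\<bar>f x\<bar> \<le> (K / e + K) * exp (e * (norm x)\<^sup>2)" for x
  proof -
    have "norm x \<le> 1 + (norm x)\<^sup>2"
      using sum_power2_ge_zero[of "norm x - 1" 0] zero_le_power2[of "norm x"]
      unfolding power2_eq_square by (simp add: algebra_simps) (smt (verit) mult_nonneg_nonneg norm_ge_zero)
    also have "\<dots> \<le> (1 / e + 1) * (1 + e * (norm x)\<^sup>2)"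
      using \<open>e > 0\<close> by (simp add: field_simps)
    also have "\<dots> \<le> (1 / e + 1) * exp (e * (norm x)\<^sup>2)"
      using \<open>e > 0\<close> by (intro mult_left_mono exp_ge_add_one_self) auto
    finally have "norm x * K \<le> (1 / e + 1) * exp (e * (norm x)\<^sup>2) * K"
      using K(2) by (intro mult_right_mono) auto
    then show ?thesis using K(1)[of x] by (simp add: algebra_simps)
  qed
  then show ?case using K(2) \<open>e > 0\<close> by (intro exI[of _ "K / e + K"]) auto
next
  case (const c)
  have "\<bar>c\<bar> * 1 \<le> \<bar>c\<bar> * exp (e * (norm x)\<^sup>2)" for x :: 'a
    using const by (intro mult_left_mono) auto
  then show ?case by (intro exI[of _ "\<bar>c\<bar>"]) auto
next
  case (add f g)
  from add.IH[OF add.prems] obtain C D where "C \<ge> 0" "\<forall>x. \<bar>f x\<bar> \<le> C * exp (e * (norm x)\<^sup>2)"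
     "D \<ge> 0" "\<forall>x. \<bar>g x\<bar> \<le> D * exp (e * (norm x)\<^sup>2)" by blast
  then show ?case
    by (intro exI[of _ "C + D"]) (auto simp: algebra_simps intro: order_trans[OF abs_triangle_ineq add_mono])
next
  case (mult f g)
  have "e / 2 > 0" using mult.prems by simp
  from mult.IH[OF this] obtain C D where CD: "C \<ge> 0" "\<forall>x. \<bar>f x\<bar> \<le> C * exp (e/2 * (norm x)\<^sup>2)"
     "D \<ge> 0" "\<forall>x. \<bar>g x\<bar> \<le> D * exp (e/2 * (norm x)\<^sup>2)" by blast
  have "\<bar>f x * g x\<bar> \<le> C * D * exp (e * (norm x)\<^sup>2)" for x
  proof -
    have "\<bar>f x * g x\<bar> \<le> (C * exp (e/2 * (norm x)\<^sup>2)) * (D * exp (e/2 * (norm x)\<^sup>2))"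
      unfolding abs_mult using CD by (intro mult_mono) auto
    also have "\<dots> = C * D * (exp (e/2 * (norm x)\<^sup>2) * exp (e/2 * (norm x)\<^sup>2))" by simp
    also have "exp (e/2 * (norm x)\<^sup>2) * exp (e/2 * (norm x)\<^sup>2) = exp (e * (norm x)\<^sup>2)"
      by (simp flip: exp_add)
    finally show ?thesis .
  qed
  then show ?case using CD by (intro exI[of _ "C * D"]) auto
qed

lemma gaussian_integrable:
  fixes c :: real
  assumes "c > 0"
  shows "integrable lborel (\<lambda>x::'a::euclidean_space. exp (- c * (norm x)\<^sup>2))"
proof -
  have 1: "(\<integral>\<^sup>+t. ennreal (exp (- c * t\<^sup>2)) \<partial>lborel) < \<infinity>"
  proof -
    define s where "s = sqrt (1 / (2 * c))"
    have s: "s > 0" "s\<^sup>2 = 1 / (2 * c)" using assms by (auto simp: s_def)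
    have "integrable lborel (\<lambda>t. sqrt (2 * pi * s\<^sup>2) * normal_density 0 s t)"
      using s by (intro integrable_mult_right integrable_normal_density) auto
    moreover have "sqrt (2 * pi * s\<^sup>2) * normal_density 0 s t = exp (- c * t\<^sup>2)" for t
      using s assms by (simp add: normal_density_def field_simps)
    ultimately have "integrable lborel (\<lambda>t. exp (- c * t\<^sup>2))" by simp
    then show ?thesis
      by (subst nn_integral_eq_integral) (auto)
  qed
  have *: "exp (- c * (norm x)\<^sup>2) = (\<Prod>b\<in>Basis. exp (- c * (x \<bullet> b)\<^sup>2))" for x :: 'a
    unfolding power2_norm_eq_inner euclidean_inner[of x x]
    by (simp add: sum_distrib_left power2_eq_square sum_negf flip: exp_sum)
  have "(\<integral>\<^sup>+(x::'a). ennreal (exp (- c * (norm x)\<^sup>2)) \<partial>lborel)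
      = (\<integral>\<^sup>+(x::'a). (\<Prod>b\<in>Basis. ennreal (exp (- c * (x \<bullet> b)\<^sup>2))) \<partial>lborel)"
    by (intro nn_integral_cong) (subst *, simp add: prod_ennreal)
  also have "\<dots> = (\<Prod>b\<in>(Basis::'a set). (\<integral>\<^sup>+t. ennreal (exp (- c * t\<^sup>2)) \<partial>lborel))"
    by (rule nn_integral_lborel_prod) auto
  also have "\<dots> < \<infinity>" using 1 by (simp add: ennreal_prod_eq_top less_top power_less_top_ennreal)
  finally show ?thesis by (intro integrableI_bounded) auto
qed

lemma real_polynomial_continuous: "real_polynomial_function p \<Longrightarrow> continuous_on UNIV p"
  by (simp add: continuous_on_polymonial_function real_polynomial_function_eq)

lemma real_polynomial_measurable [measurable_dest]:
  "real_polynomial_function (p :: 'a::euclidean_space \<Rightarrow> real) \<Longrightarrow> p \<in> borel_measurable borel"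
  by (simp add: borel_measurable_continuous_onI real_polynomial_continuous)

lemma polynomial_gaussian_integrable:
  fixes p :: "'a::euclidean_space \<Rightarrow> real"
  assumes p: "real_polynomial_function p" and c: "c > 0"
  shows "integrable lebesgue (\<lambda>x. p x * exp (- c * (norm x)\<^sup>2))"
proof -
  have c2: "c / 2 > 0" using c by simp
  obtain C where C: "C \<ge> 0" "\<forall>x. \<bar>p x\<bar> \<le> C * exp (c/2 * (norm x)\<^sup>2)"
    using real_polynomial_growth[OF p c2] by blast
  note [measurable] = real_polynomial_measurable[OF p]
  have "integrable lborel (\<lambda>x. p x * exp (- c * (norm x)\<^sup>2))"
  proof (rule Bochner_Integration.integrable_bound)
    show "integrable lborel (\<lambda>x::'a. C * exp (- (c/2) * (norm x)\<^sup>2))"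
      by (intro integrable_mult_right gaussian_integrable c2)
    have "\<bar>p x\<bar> * exp (- c * (norm x)\<^sup>2) \<le> C * exp (- (c/2) * (norm x)\<^sup>2)" for x
    proof -
      have "\<bar>p x\<bar> * exp (- c * (norm x)\<^sup>2) \<le> C * exp (c/2 * (norm x)\<^sup>2) * exp (- c * (norm x)\<^sup>2)"
        using C by (intro mult_right_mono) auto
      also have "\<dots> = C * exp (- (c/2) * (norm x)\<^sup>2)"
        by (simp add: mult.assoc flip: exp_add)
      finally show ?thesis .
    qed
    then show "AE x in lborel. norm (p x * exp (- c * (norm x)\<^sup>2)) \<le> norm (C * exp (- (c/2) * (norm x)\<^sup>2))"
      using C by (auto simp: abs_mult)
  qed measurable
  then show ?thesis by (subst integrable_completion) measurable
qed

section \<open>Hermite polynomials\<close>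

type_synonym 'a multi_index = "'a \<Rightarrow> nat"

definition up :: "'a \<Rightarrow> 'a multi_index \<Rightarrow> 'a multi_index" where
  "up b \<alpha> = \<alpha>(b := Suc (\<alpha> b))"

definition dn :: "'a \<Rightarrow> 'a multi_index \<Rightarrow> 'a multi_index" where
  "dn b \<alpha> = \<alpha>(b := \<alpha> b - 1)"

text \<open>The Hermite polynomials of the weight \<open>exp (-2 t^2)\<close>, in the normalization in which the derivative
  of \<open>He n * exp (-2 t^2)\<close> is \<open>- He (n + 1) * exp (-2 t^2)\<close>.\<close>

primrec He :: "nat \<Rightarrow> real poly" where
  "He 0 = 1"
| "He (Suc n) = [:0, 4:] * He n - pderiv (He n)"

lemma pderiv_He_Suc: "pderiv (He (Suc n)) = smult (4 * real (Suc n)) (He n)"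
proof (induction n)
  case 0
  then show ?case by (simp add: pderiv_pCons pderiv_1)
next
  case (Suc n)
  have "pderiv (He (Suc (Suc n))) = smult 4 (He (Suc n)) + [:0, 4:] * pderiv (He (Suc n))
      - pderiv (pderiv (He (Suc n)))"
    unfolding He.simps(2)[of "Suc n"]
    by (simp add: pderiv_diff pderiv_mult pderiv_pCons pderiv_smult del: He.simps(2))
  also have "\<dots> = smult 4 (He (Suc n)) + smult (4 * real (Suc n)) ([:0, 4:] * He n - pderiv (He n))"
    by (simp add: Suc pderiv_smult smult_diff_right del: He.simps(2))
  also have "\<dots> = smult (4 * real (Suc (Suc n))) (He (Suc n))"
    by (simp flip: smult_add_left add: algebra_simps)
  finally show ?case .
qed

lemma pderiv_He: "pderiv (He n) = smult (4 * real n) (He (n - 1))"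
  by (cases n) (simp_all add: pderiv_He_Suc pderiv_1 del: He.simps(2))

definition Herm :: "'a::euclidean_space multi_index \<Rightarrow> 'a \<Rightarrow> real" where
  "Herm \<alpha> x = (\<Prod>b\<in>Basis. poly (He (\<alpha> b)) (x \<bullet> b))"

lemma Herm_split:
  "b \<in> Basis \<Longrightarrow> Herm \<alpha> x = poly (He (\<alpha> b)) (x \<bullet> b) * (\<Prod>i\<in>Basis - {b}. poly (He (\<alpha> i)) (x \<bullet> i))"
  unfolding Herm_def by (rule prod.remove) auto

lemma Herm_split_upd:
  "b \<in> Basis \<Longrightarrow> Herm (\<alpha>(b := m)) x = poly (He m) (x \<bullet> b) * (\<Prod>i\<in>Basis - {b}. poly (He (\<alpha> i)) (x \<bullet> i))"
  by (subst Herm_split[of b]) auto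

lemma Herm_has_derivative:
  "(Herm \<alpha> has_derivative (\<lambda>v. \<Sum>b\<in>Basis. (v \<bullet> b) * (4 * real (\<alpha> b) * Herm (dn b \<alpha>) x))) (at x)"
proof -
  have "((\<lambda>x. poly (He (\<alpha> b)) (x \<bullet> b)) has_derivative
      (\<lambda>v. (v \<bullet> b) * poly (pderiv (He (\<alpha> b))) (x \<bullet> b))) (at x)" for b
    using has_derivative_compose[of "\<lambda>x. x \<bullet> b" "\<lambda>v. v \<bullet> b" x UNIV
        "poly (He (\<alpha> b))", OF _ poly_DERIV[unfolded has_field_derivative_def]]
    by (simp add: mult.commute has_derivative_inner_left)
  then have "(Herm \<alpha> has_derivative (\<lambda>v. \<Sum>b\<in>Basis. (v \<bullet> b) * poly (pderiv (He (\<alpha> b))) (x \<bullet> b)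
      * (\<Prod>i\<in>Basis - {b}. poly (He (\<alpha> i)) (x \<bullet> i)))) (at x)"
    unfolding Herm_def[abs_def] by (rule has_derivative_prod)
  also have "(\<lambda>v. \<Sum>b\<in>Basis. (v \<bullet> b) * poly (pderiv (He (\<alpha> b))) (x \<bullet> b)
      * (\<Prod>i\<in>Basis - {b}. poly (He (\<alpha> i)) (x \<bullet> i)))
    = (\<lambda>v. \<Sum>b\<in>Basis. (v \<bullet> b) * (4 * real (\<alpha> b) * Herm (dn b \<alpha>) x))"
    by (intro ext sum.cong refl) (simp add: dn_def Herm_split_upd pderiv_He)
  finally show ?thesis .
qed

text \<open>The adjoint of the derivative along \<open>b\<close>, in the space with weight \<open>exp (-2 \<bar>x\<bar>^2)\<close>, is multiplication by
  \<open>4 (x \<bullet> b)\<close> minus the derivative; it raises the index of a Hermite polynomial.\<close>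

lemma Herm_recurrence:
  assumes "b \<in> Basis"
  shows "Herm (up b \<alpha>) x = 4 * (x \<bullet> b) * Herm \<alpha> x - 4 * real (\<alpha> b) * Herm (dn b \<alpha>) x"
  using assms by (simp add: up_def dn_def Herm_split_upd Herm_split[of b \<alpha>] pderiv_He algebra_simps)

lemma real_polynomial_inner: "real_polynomial_function (\<lambda>x::'a::euclidean_space. x \<bullet> b)"
  by (intro real_polynomial_function.intros(1) bounded_linear_inner_left)

lemma Herm_polynomial: "real_polynomial_function (Herm \<alpha>)"
proof -
  have "real_polynomial_function (\<lambda>x. \<Prod>b\<in>Basis. \<Sum>i\<le>degree (He (\<alpha> b)). coeff (He (\<alpha> b)) i * (x \<bullet> b) ^ i)"
    by (intro real_polynomial_function_prod real_polynomial_function_sum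
        real_polynomial_function.intros(2,4) real_polynomial_function_power real_polynomial_inner) auto
  then show ?thesis by (simp add: Herm_def[abs_def] poly_altdef)
qed

lemma Herm_0: "Herm (\<lambda>_. 0) x = 1"
  by (simp add: Herm_def)

definition wt :: "'a::euclidean_space \<Rightarrow> real" where
  "wt x = exp (- 2 * (norm x)\<^sup>2)"

lemma wt_pos: "wt x > 0" by (simp add: wt_def)

lemma wt_has_derivative: "(wt has_derivative (\<lambda>v. - 4 * (x \<bullet> v) * wt x)) (at x)"
  unfolding wt_def[abs_def] power2_norm_eq_inner
  by (auto intro!: derivative_eq_intros simp: inner_commute)

lemma Herm_wt_has_derivative:
  "((\<lambda>x. Herm \<alpha> x * wt x) has_derivative
    (\<lambda>v. Herm \<alpha> x * (- 4 * (x \<bullet> v) * wt x)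
      + (\<Sum>b\<in>Basis. (v \<bullet> b) * (4 * real (\<alpha> b) * Herm (dn b \<alpha>) x)) * wt x)) (at x)"
  by (rule has_derivative_mult[OF Herm_has_derivative wt_has_derivative])

text \<open>Thus a derivative that falls on a weighted Hermite polynomial only shifts its index.\<close>

lemma Herm_wt_partial_derivative:
  assumes "b \<in> Basis"
  shows "Herm \<alpha> x * (- 4 * (x \<bullet> b) * wt x)
      + (\<Sum>c\<in>Basis. (b \<bullet> c) * (4 * real (\<alpha> c) * Herm (dn c \<alpha>) x)) * wt x
    = - Herm (up b \<alpha>) x * wt x"
proof -
  have "(\<Sum>c\<in>Basis. (b \<bullet> c) * (4 * real (\<alpha> c) * Herm (dn c \<alpha>) x)) = 4 * real (\<alpha> b) * Herm (dn b \<alpha>) x"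
    using assms by (simp add: inner_Basis if_distrib[of "\<lambda>t. t * _"] cong: if_cong)
  then show ?thesis using assms by (simp add: Herm_recurrence algebra_simps)
qed

section \<open>Cutting off weighted Hermite polynomials\<close>

text \<open>The factor \<open>exp 1\<close> normalizes the value at the origin, which is also the pointwise limit, to 1. The support has radius
  about the square root of \<open>n\<close>.\<close>

definition cutoff :: "nat \<Rightarrow> 'a::euclidean_space \<Rightarrow> real" where
  "cutoff n x = exp 1 * flat 1 (1 - (norm x)\<^sup>2 / real (Suc n))"

text \<open>The gradient of \<open>cutoff n\<close> at \<open>x\<close> is \<open>cutoff' n x\<close> times \<open>x\<close>. This factor is bounded
  uniformly in \<open>n\<close> and tends to 0, so the gradient is dominated by a multiple of \<open>norm x\<close>, which is
  harmless against a Gaussian.\<close>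

definition cutoff' :: "nat \<Rightarrow> 'a::euclidean_space \<Rightarrow> real" where
  "cutoff' n x = exp 1 * flat (monom 1 2) (1 - (norm x)\<^sup>2 / real (Suc n)) * (- 2 / real (Suc n))"

lemma cutoff_has_derivative:
  "(cutoff n has_derivative (\<lambda>v. cutoff' n x * (x \<bullet> v))) (at x)"
proof -
  have 1: "((\<lambda>x. 1 - (norm x)\<^sup>2 / real (Suc n)) has_derivative (\<lambda>v. - 2 / real (Suc n) * (x \<bullet> v))) (at x)"
  proof -
    have "((\<lambda>x. 1 - (x \<bullet> x) * c) has_derivative (\<lambda>v. - 2 * c * (x \<bullet> v))) (at x)" for c
      by (auto intro!: derivative_eq_intros simp: inner_commute)
    from this[of "1 / real (Suc n)"] show ?thesis by (simp add: power2_norm_eq_inner)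
  qed
  have "(flat 1 has_derivative (*) (flat (monom 1 2) t)) (at t)" for t
    using flat_has_derivative[of 1 t] by (simp add: has_field_derivative_def pderiv_1)
  from has_derivative_mult_right[OF has_derivative_compose[OF 1 this], of "exp 1"]
  show ?thesis unfolding cutoff_def[abs_def] cutoff'_def by (simp add: mult.assoc mult.left_commute)
qed

lemma smooth_cutoff: "smooth (cutoff n :: 'a::euclidean_space \<Rightarrow> real)"
proof -
  have "smooth (\<lambda>x::'a. 1 + (- 1 / real (Suc n)) * (norm x)\<^sup>2)"
    by (intro smooth.intros(2-4) norm_square_smooth)
  then have "smooth (\<lambda>x::'a. 1 - (norm x)\<^sup>2 / real (Suc n))" by simp
  then show ?thesis unfolding cutoff_def[abs_def] by (intro smooth.intros(2-))
qed

lemma flat_continuous: "continuous_on UNIV (flat q)"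
  using flat_has_derivative by (meson DERIV_isCont continuous_at_imp_continuous_on)

lemma flat_bounds: "0 \<le> flat 1 t" "t \<le> 1 \<Longrightarrow> flat 1 t \<le> exp (- 1)" 
   "0 \<le> flat (monom 1 2) t" "flat (monom 1 2) t \<le> 2"
proof -
  show "0 \<le> flat 1 t" by (simp add: flat_def)
  show "flat 1 t \<le> exp (- 1)" if "t \<le> 1" using that by (auto simp: flat_def)
  show "0 \<le> flat (monom 1 2) t" by (simp add: flat_def poly_monom)
  have "s\<^sup>2 * exp (- s) \<le> 2" if "s \<ge> 0" for s :: real
  proof -
    have "s\<^sup>2 / 2 \<le> exp s" using exp_lower_Taylor_quadratic[OF that] that by simp
    then show ?thesis by (simp add: exp_minus field_simps)
  qed
  from this[of "1 / t"] show "flat (monom 1 2) t \<le> 2" by (auto simp: flat_def poly_monom)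
qed

lemma cutoff_bounds: "0 \<le> cutoff n x" "cutoff n x \<le> 1"
proof -
  show "0 \<le> cutoff n x" by (simp add: cutoff_def flat_bounds)
  have "cutoff n x \<le> exp 1 * exp (- 1)"
    unfolding cutoff_def by (intro mult_left_mono flat_bounds) auto
  then show "cutoff n x \<le> 1" by (simp flip: exp_add)
qed

lemma cutoff'_bounds: "\<bar>cutoff' n x\<bar> \<le> 4 * exp 1"
proof -
  have "\<bar>cutoff' n x\<bar> = exp 1 * flat (monom 1 2) (1 - (norm x)\<^sup>2 / real (Suc n)) * (2 / real (Suc n))"
    by (simp add: cutoff'_def abs_mult flat_bounds)
  also have "\<dots> \<le> exp 1 * 2 * (2 / 1)"
    by (intro mult_mono divide_left_mono mult_nonneg_nonneg flat_bounds) auto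
  finally show ?thesis by simp
qed

lemma radius_tendsto: "(\<lambda>n. 1 - (norm x)\<^sup>2 / real (Suc n)) \<longlonglongrightarrow> 1"
  using tendsto_diff[OF tendsto_const LIMSEQ_Suc[OF lim_const_over_n]] by simp

lemma cutoff_tendsto: "(\<lambda>n. cutoff n x) \<longlonglongrightarrow> 1"
proof -
  have "(\<lambda>n. flat 1 (1 - (norm x)\<^sup>2 / real (Suc n))) \<longlonglongrightarrow> flat 1 1"
    using flat_continuous[of 1] radius_tendsto[of x]
    by (intro continuous_on_tendsto_compose[of UNIV "flat 1"]) auto
  from tendsto_mult[OF tendsto_const[of "exp 1"] this] show ?thesis
    unfolding cutoff_def by (simp add: flat_def flip: exp_add)
qed

lemma cutoff'_tendsto: "(\<lambda>n. cutoff' n x) \<longlonglongrightarrow> 0"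
proof -
  have 1: "(\<lambda>n. flat (monom 1 2) (1 - (norm x)\<^sup>2 / real (Suc n))) \<longlonglongrightarrow> flat (monom 1 2) 1"
    using flat_continuous[of "monom 1 2"] radius_tendsto[of x]
    by (intro continuous_on_tendsto_compose[of UNIV "flat (monom 1 2)"]) auto
  have 2: "(\<lambda>n. - 2 / real (Suc n)) \<longlonglongrightarrow> 0"
    using tendsto_minus[OF LIMSEQ_Suc[OF lim_const_over_n[of 2]]] by simp
  show ?thesis
    using tendsto_mult[OF tendsto_mult[OF tendsto_const[of "exp 1"] 1] 2] unfolding cutoff'_def by simp
qed

lemma cutoff_support: "cutoff n x \<noteq> 0 \<Longrightarrow> x \<in> cball 0 (real (Suc n))"
proof -
  assume "cutoff n x \<noteq> 0"
  then have "(norm x)\<^sup>2 / real (Suc n) < 1" by (auto simp: cutoff_def flat_def split: if_splits)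
  then have "(norm x)\<^sup>2 < real (Suc n)" by (simp add: field_simps)
  also have "\<dots> \<le> (real (Suc n))\<^sup>2" by (simp add: power2_eq_square)
  finally have "norm x < real (Suc n)" by (rule power_less_imp_less_base) simp
  then show ?thesis by simp
qed

definition Hermite_test :: "nat \<Rightarrow> 'a::euclidean_space multi_index \<Rightarrow> 'a \<Rightarrow> complex" where
  "Hermite_test n \<alpha> x = complex_of_real (cutoff n x * (Herm \<alpha> x * wt x))"

lemma Hermite_test_in_test_functions: "Hermite_test n \<alpha> \<in> test_functions"
proof -
  have "smooth (\<lambda>x. - 2 * (norm x)\<^sup>2)"
    by (intro smooth.intros(2,4) norm_square_smooth)
  then have "smooth wt" unfolding wt_def[abs_def] by (rule smooth_exp)
  then have "smooth (\<lambda>x. cutoff n x * (Herm \<alpha> x * wt x))"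
    by (rule smooth_mult[OF smooth_cutoff smooth_mult[OF real_polynomial_smooth[OF Herm_polynomial]]])
  from smooth_C_upto[OF this] have "\<forall>m. C_upto m (Hermite_test n \<alpha>)"
    unfolding Hermite_test_def[abs_def] by blast
  moreover have "compact (closure {x. Hermite_test n \<alpha> x \<noteq> 0})"
  proof (rule compact_closure[THEN iffD2], rule bounded_subset[OF bounded_cball])
    show "{x. Hermite_test n \<alpha> x \<noteq> 0} \<subseteq> cball 0 (real (Suc n))"
      using cutoff_support[of n] by (auto simp: Hermite_test_def)
  qed
  ultimately show ?thesis by (simp add: test_functions_def)
qed

lemma Hermite_test_derivative:
  assumes "b \<in> Basis"
  shows "frechet_derivative (Hermite_test n \<alpha>) (at x) b
    = of_real (cutoff' n x * (x \<bullet> b) * (Herm \<alpha> x * wt x) - cutoff n x * Herm (up b \<alpha>) x * wt x)"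
proof -
  note d = has_derivative_mult[OF cutoff_has_derivative[of n x] Herm_wt_has_derivative[of \<alpha> x]]
  note d' = has_derivative_of_real[OF d, where ?'a=complex]
  show ?thesis
    unfolding Hermite_test_def[abs_def] frechet_derivative_at[OF d', symmetric]
    by (subst Herm_wt_partial_derivative[OF assms]) (simp add: algebra_simps)
qed

section \<open>Hermite coefficients as limits of distributional pairings\<close>

definition L2_wt :: "('a::euclidean_space \<Rightarrow> complex) set" where
  "L2_wt = {u. u \<in> borel_measurable lebesgue \<and> integrable lebesgue (\<lambda>x. (norm (u x))\<^sup>2 * wt x)}"

lemma wt_measurable [measurable]: "wt \<in> borel_measurable borel"
  unfolding wt_def[abs_def] by measurable

lemma polynomial_wt_integrable:
  "real_polynomial_function p \<Longrightarrow> integrable lebesgue (\<lambda>x. p x * wt x)"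
  unfolding wt_def by (rule polynomial_gaussian_integrable) auto

lemma polynomial_L2_wt:
  assumes "real_polynomial_function p"
  shows "(\<lambda>x. c * complex_of_real (p x)) \<in> L2_wt"
proof -
  have "integrable lebesgue (\<lambda>x. (norm c)\<^sup>2 * (p x * p x * wt x))"
    by (intro integrable_mult_right polynomial_wt_integrable real_polynomial_function.intros(4) assms)
  moreover have "(\<lambda>x. (norm c)\<^sup>2 * (p x * p x * wt x)) = (\<lambda>x. (norm (c * complex_of_real (p x)))\<^sup>2 * wt x)"
    by (simp add: norm_mult power_mult_distrib power2_eq_square mult_ac)
  ultimately show ?thesis using real_polynomial_measurable[OF assms] unfolding L2_wt_def by (auto intro!: measurable_completion)
qed

lemma L2_wt_mult_integrable:
  assumes "u \<in> L2_wt" "v \<in> L2_wt"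
  shows "integrable lebesgue (\<lambda>x. u x * v x * of_real (wt x))"
proof (rule Bochner_Integration.integrable_bound)
  show "integrable lebesgue (\<lambda>x. (norm (u x))\<^sup>2 * wt x + (norm (v x))\<^sup>2 * wt x)"
    using assms by (intro Bochner_Integration.integrable_add) (auto simp: L2_wt_def)
  have [measurable]: "u \<in> borel_measurable lebesgue" "v \<in> borel_measurable lebesgue" 
     "wt \<in> borel_measurable (lebesgue :: 'a measure)"
    using assms by (auto simp: L2_wt_def intro!: measurable_completion)
  show "(\<lambda>x. u x * v x * of_real (wt x)) \<in> borel_measurable lebesgue" by measurable
  have "norm (u x * v x * of_real (wt x)) \<le> (norm (u x))\<^sup>2 * wt x + (norm (v x))\<^sup>2 * wt x" for x
  proof -
    have "norm (u x) * norm (v x) \<le> (norm (u x))\<^sup>2 + (norm (v x))\<^sup>2"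
      using sum_squares_bound[of "norm (u x)" "norm (v x)"] mult_nonneg_nonneg[OF norm_ge_zero[of "u x"] norm_ge_zero[of "v x"]] by linarith
    then have "norm (u x) * norm (v x) * wt x \<le> ((norm (u x))\<^sup>2 + (norm (v x))\<^sup>2) * wt x"
      using wt_pos[of x] by (intro mult_right_mono) auto
    then show ?thesis using wt_pos[of x] by (simp add: norm_mult algebra_simps)
  qed
  then show "AE x in lebesgue. norm (u x * v x * of_real (wt x)) \<le> norm ((norm (u x))\<^sup>2 * wt x + (norm (v x))\<^sup>2 * wt x)"
    by (auto intro!: AE_I2 order_trans[OF _ abs_ge_self])
qed

definition herm_coeff :: "('a::euclidean_space \<Rightarrow> complex) \<Rightarrow> 'a multi_index \<Rightarrow> complex" where
  "herm_coeff u \<alpha> = (\<integral>x. u x * of_real (Herm \<alpha> x * wt x) \<partial>lebesgue)"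

lemma polynomial_times_L2_wt_integrable:
  assumes "u \<in> L2_wt" "real_polynomial_function p"
  shows "integrable lebesgue (\<lambda>x. u x * of_real (p x * wt x))"
  using L2_wt_mult_integrable[OF assms(1) polynomial_L2_wt[OF assms(2), of 1]] by (simp add: mult.assoc)

lemma cutoff_measurable [measurable]: "cutoff n \<in> borel_measurable borel" 
  by (rule borel_measurable_continuous_onI)
    (meson cutoff_has_derivative continuous_at_imp_continuous_on has_derivative_continuous)

lemma cutoff'_measurable [measurable]: "cutoff' n \<in> borel_measurable borel"
proof -
  have [measurable]: "flat q \<in> borel_measurable borel" for q
    by (rule borel_measurable_continuous_onI[OF flat_continuous])
  show ?thesis unfolding cutoff'_def[abs_def] by measurable
qed

text \<open>Dominated convergence removes the cutoff. An identity between distributions given by weighted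
  square integrable functions may therefore be tested with weighted Hermite polynomials, although
  these do not have compact support.\<close>

lemma distr_of_Hermite_test_tendsto:
  assumes u: "u \<in> L2_wt"
  shows "(\<lambda>n. distr_of u (Hermite_test n \<alpha>)) \<longlonglongrightarrow> herm_coeff u \<alpha>"
  unfolding distr_of_def herm_coeff_def
proof (rule integral_dominated_convergence)
  let ?F = "\<lambda>x. u x * of_real (Herm \<alpha> x * wt x)"
  have i: "integrable lebesgue ?F" by (rule polynomial_times_L2_wt_integrable[OF u Herm_polynomial])
  then show "?F \<in> borel_measurable lebesgue" by simp
  show "integrable lebesgue (\<lambda>x. norm (?F x))" using i by simp
  have e: "u x * Hermite_test n \<alpha> x = ?F x * of_real (cutoff n x)" for n x
    by (simp add: Hermite_test_def)
  have [measurable]: "cutoff n \<in> borel_measurable (lebesgue :: 'a measure)" for n by (intro measurable_completion) simp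
  show "(\<lambda>x. u x * Hermite_test n \<alpha> x) \<in> borel_measurable lebesgue" for n
    unfolding e using i by measurable
  show "AE x in lebesgue. (\<lambda>n. u x * Hermite_test n \<alpha> x) \<longlonglongrightarrow> ?F x"
    unfolding e using tendsto_mult[OF tendsto_const tendsto_of_real[OF cutoff_tendsto]]
    by (intro AE_I2) fastforce
  show "AE x in lebesgue. norm (u x * Hermite_test n \<alpha> x) \<le> norm (?F x)" for n
    unfolding e
    by (intro AE_I2) (simp only: norm_mult[of "?F _"] norm_of_real, intro mult_left_le, auto simp: cutoff_bounds abs_le_iff intro: order_trans[OF _ cutoff_bounds(1)])
qed

text \<open>The term with the gradient of the cutoff vanishes in the limit, and the other one is a Hermite
  coefficient with shifted index: a distributional derivative acts on coefficients by a shift.\<close>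

lemma distr_of_Hermite_test_derivative_tendsto:
  assumes u: "u \<in> L2_wt" and b: "b \<in> Basis"
  shows "(\<lambda>n. distr_of u (\<lambda>x. frechet_derivative (Hermite_test n \<alpha>) (at x) b))
    \<longlonglongrightarrow> - herm_coeff u (up b \<alpha>)"
proof -
  let ?F = "\<lambda>x. u x * of_real (Herm (up b \<alpha>) x * wt x)"
  let ?G = "\<lambda>x. u x * of_real ((x \<bullet> b) * Herm \<alpha> x * wt x)"
  have F: "integrable lebesgue ?F" by (rule polynomial_times_L2_wt_integrable[OF u Herm_polynomial])
  have G: "integrable lebesgue ?G"
    by (rule polynomial_times_L2_wt_integrable[OF u])
      (intro real_polynomial_function.intros(4) real_polynomial_inner Herm_polynomial)
  have e: "u x * frechet_derivative (Hermite_test n \<alpha>) (at x) b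
      = ?G x * of_real (cutoff' n x) - ?F x * of_real (cutoff n x)" for n x
    by (simp add: Hermite_test_derivative[OF b] algebra_simps)
  have [measurable]: "cutoff n \<in> borel_measurable (lebesgue :: 'a measure)" 
     "cutoff' n \<in> borel_measurable (lebesgue :: 'a measure)" for n 
    by (intro measurable_completion; simp)+
  have "(\<lambda>n. distr_of u (\<lambda>x. frechet_derivative (Hermite_test n \<alpha>) (at x) b))
    \<longlonglongrightarrow> (\<integral>x. - ?F x \<partial>lebesgue)"
    unfolding distr_of_def
  proof (rule integral_dominated_convergence)
    show "(\<lambda>x. - ?F x) \<in> borel_measurable lebesgue" using F by measurable
    show "(\<lambda>x. u x * frechet_derivative (Hermite_test n \<alpha>) (at x) b) \<in> borel_measurable lebesgue" for n
      unfolding e using F G by measurable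
    show "integrable lebesgue (\<lambda>x. norm (?G x) * (4 * exp 1) + norm (?F x))"
      using F G by (intro Bochner_Integration.integrable_add integrable_mult_left integrable_norm)
    show "AE x in lebesgue. (\<lambda>n. u x * frechet_derivative (Hermite_test n \<alpha>) (at x) b) \<longlonglongrightarrow> - ?F x"
    proof (rule AE_I2)
      fix x
      show "(\<lambda>n. u x * frechet_derivative (Hermite_test n \<alpha>) (at x) b) \<longlonglongrightarrow> - ?F x"
        unfolding e
        using tendsto_diff[OF tendsto_mult[OF tendsto_const[of "?G x"] tendsto_of_real[OF cutoff'_tendsto[of x]]]
            tendsto_mult[OF tendsto_const[of "?F x"] tendsto_of_real[OF cutoff_tendsto[of x]]]]
        by simp
    qed
    have "norm (u x * frechet_derivative (Hermite_test n \<alpha>) (at x) b)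
        \<le> norm (?G x) * (4 * exp 1) + norm (?F x)" for n x
    proof -
      have "norm (?G x * of_real (cutoff' n x)) \<le> norm (?G x) * (4 * exp 1)"
        unfolding norm_mult[of "?G x"] norm_of_real by (intro mult_left_mono cutoff'_bounds) auto
      moreover have "norm (?F x * of_real (cutoff n x)) \<le> norm (?F x) * 1"
        unfolding norm_mult[of "?F x"] norm_of_real
        by (intro mult_left_mono) (auto simp: cutoff_bounds)
      ultimately show ?thesis unfolding e using norm_triangle_ineq4 by (smt (verit))
    qed
    then show "AE x in lebesgue. norm (u x * frechet_derivative (Hermite_test n \<alpha>) (at x) b)
        \<le> norm (?G x) * (4 * exp 1) + norm (?F x)" for n by simp
  qed
  then show ?thesis by (simp add: herm_coeff_def)
qed

section \<open>Integration by parts against test functions\<close>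

lemma derivative_outside_support:
  fixes F :: "'a::euclidean_space \<Rightarrow> complex"
  assumes "(F has_derivative F') (at x)" "closed K" "\<And>x. x \<notin> K \<Longrightarrow> F x = 0" "x \<notin> K"
  shows "F' v = 0"
proof -
  have "(F has_derivative (\<lambda>_. 0)) (at x)"
  proof (rule has_derivative_transform_within_open)
    show "((\<lambda>_. 0 :: complex) has_derivative (\<lambda>_. 0)) (at x)" by simp
    show "open (- K)" "x \<in> - K" using assms by auto
    show "0 = F y" if "y \<in> - K" for y using assms(3)[of y] that by simp
  qed
  from has_derivative_unique[OF assms(1) this] show ?thesis by simp
qed

lemma compact_support_integrable:
  fixes F :: "'a::euclidean_space \<Rightarrow> complex"
  assumes "continuous_on UNIV F" "compact K" "\<And>x. x \<notin> K \<Longrightarrow> F x = 0"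
  shows "integrable lborel F"
proof -
  have "integrable lborel (\<lambda>x. indicator K x *\<^sub>R F x)"
    by (intro borel_integrable_compact continuous_on_subset[OF assms(1)] assms(2)) auto
  also have "(\<lambda>x. indicator K x *\<^sub>R F x) = F"
    using assms(3) by (auto simp: indicator_def fun_eq_iff)
  finally show ?thesis .
qed

text \<open>By translation invariance every difference quotient of \<open>F\<close> has integral 0. The quotients are
  bounded, by the mean value inequality, and live in a fixed ball, so they converge to the derivative
  under the integral.\<close>

lemma integral_directional_derivative_eq_0:
  fixes F :: "'a::euclidean_space \<Rightarrow> complex"
  assumes d: "\<And>x. (F has_derivative F' x) (at x)" and c: "continuous_on UNIV (\<lambda>x. F' x v)"
    and K: "compact K" "\<And>x. x \<notin> K \<Longrightarrow> F x = 0"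
  shows "(\<integral>x. F' x v \<partial>lborel) = 0"
proof -
  have contF: "continuous_on UNIV F"
    using d by (meson continuous_at_imp_continuous_on has_derivative_continuous)
  have F'0: "F' x v = 0" if "x \<notin> K" for x
    using derivative_outside_support[OF d compact_imp_closed[OF K(1)] K(2) that] .
  obtain B where B: "B > 0" "\<And>x. norm (F' x v) \<le> B"
  proof -
    have "bounded ((\<lambda>x. F' x v) ` K)"
      using K(1) c by (meson compact_continuous_image compact_imp_bounded continuous_on_subset subset_UNIV)
    then obtain B where "B > 0" "\<And>x. x \<in> K \<Longrightarrow> norm (F' x v) \<le> B"
      unfolding bounded_pos by auto
    moreover have "norm (F' x v) \<le> B" if "x \<notin> K" for x using F'0[OF that] \<open>B > 0\<close> by simp
    ultimately show ?thesis using that[of B] by blast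
  qed
  obtain R where R: "R > 0" "\<And>x. x \<in> K \<Longrightarrow> norm x \<le> R"
    using compact_imp_bounded[OF K(1)] unfolding bounded_pos by auto
  \<comment> \<open>The step sizes of the difference quotients \<open>q\<close>; steps of at most 1 keep the supports in one ball.\<close>
  define h where "h n = 1 / real (Suc n)" for n
  have h: "0 < h n" "h n \<le> 1" for n by (auto simp: h_def)
  have h0: "h \<longlonglongrightarrow> 0" using LIMSEQ_Suc[OF lim_const_over_n[of 1]] by (simp add: h_def[abs_def])
  define q where "q n x = (F (h n *\<^sub>R v + x) - F x) /\<^sub>R h n" for n x
  have line: "((\<lambda>t. F (t *\<^sub>R v + x)) has_vector_derivative F' (t *\<^sub>R v + x) v) (at t)" for x t
  proof -
    have "((\<lambda>t. t *\<^sub>R v + x) has_derivative (\<lambda>s. s *\<^sub>R v)) (at t)"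
      by (auto intro!: derivative_eq_intros)
    from has_derivative_compose[OF this d]
    show ?thesis
      by (simp add: has_vector_derivative_def linear_cmul[OF has_derivative_linear[OF d]])
  qed
  have int: "integrable lborel F" by (rule compact_support_integrable[OF contF K])
  have intq: "(\<integral>x. q n x \<partial>lborel) = 0" for n
  proof -
    have F: "F \<in> borel_measurable borel" using contF by (rule borel_measurable_continuous_onI)
    have "integrable (distr lborel borel ((+) (h n *\<^sub>R v))) F" using int by (simp add: lborel_distr_plus)
    then have i: "integrable lborel (\<lambda>x. F (h n *\<^sub>R v + x))"
      using F by (subst (asm) integrable_distr_eq) auto
    have "(\<integral>x. F (h n *\<^sub>R v + x) \<partial>lborel) = (\<integral>x. F x \<partial>distr lborel borel ((+) (h n *\<^sub>R v)))"
      using F by (subst integral_distr) auto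
    then have "(\<integral>x. F (h n *\<^sub>R v + x) \<partial>lborel) = (\<integral>x. F x \<partial>lborel)"
      by (simp add: lborel_distr_plus)
    then show ?thesis unfolding q_def using int i by simp
  qed
  have "(\<lambda>n. \<integral>x. q n x \<partial>lborel) \<longlonglongrightarrow> (\<integral>x. F' x v \<partial>lborel)"
  proof (rule integral_dominated_convergence)
    show "(\<lambda>x. F' x v) \<in> borel_measurable lborel" using c by (simp add: borel_measurable_continuous_onI)
    have [measurable]: "F \<in> borel_measurable borel" using contF by (rule borel_measurable_continuous_onI)
    show "q n \<in> borel_measurable lborel" for n unfolding q_def[abs_def] by measurable
    show "integrable lborel (\<lambda>x. B * indicator (cball (0::'a) (R + norm v)) x)"
      using emeasure_bounded_finite[OF bounded_cball[of 0 "R + norm v"]]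
      by (intro integrable_mult_right integrable_real_indicator) auto
    show "AE x in lborel. (\<lambda>n. q n x) \<longlonglongrightarrow> F' x v"
    proof (rule AE_I2)
      fix x
      have "((\<lambda>t. (F (t *\<^sub>R v + x) - F x) /\<^sub>R t) \<longlongrightarrow> F' x v) (at 0)"
      proof -
        have "((\<lambda>t. inverse t *\<^sub>R (F (t *\<^sub>R v + x) - (F x + t *\<^sub>R F' x v))) \<longlongrightarrow> 0) (at 0)"
        proof (rule tendsto_norm_zero_cancel)
          have "((\<lambda>t. (1 / norm (t - 0)) *\<^sub>R (F (t *\<^sub>R v + x) - (F (0 *\<^sub>R v + x)
              + (t - 0) *\<^sub>R F' (0 *\<^sub>R v + x) v))) \<longlongrightarrow> 0) (at 0)"
            using line[of x 0] unfolding has_vector_derivative_def has_derivative_within by (rule conjunct2)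
          from tendsto_norm_zero[OF this]
          show "((\<lambda>t. norm (inverse t *\<^sub>R (F (t *\<^sub>R v + x) - (F x + t *\<^sub>R F' x v)))) \<longlongrightarrow> 0) (at 0)"
            by (simp only: norm_scaleR real_norm_def abs_divide abs_abs abs_one abs_inverse inverse_eq_divide
               diff_0_right scale_zero_left add_0_left)
        qed
        from tendsto_add[OF this tendsto_const[of "F' x v"]]
        have "((\<lambda>t. inverse t *\<^sub>R (F (t *\<^sub>R v + x) - (F x + t *\<^sub>R F' x v)) + F' x v) \<longlongrightarrow> F' x v) (at 0)" by simp
        moreover have "eventually (\<lambda>t. inverse t *\<^sub>R (F (t *\<^sub>R v + x) - (F x + t *\<^sub>R F' x v)) + F' x v
            = (F (t *\<^sub>R v + x) - F x) /\<^sub>R t) (at 0)"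
          unfolding eventually_at_filter
          by (intro always_eventually allI impI) (simp add: scaleR_diff_right scaleR_add_right)
        ultimately show ?thesis by (rule Lim_transform_eventually)
      qed
      moreover have "filterlim h (at 0) sequentially"
      proof -
        have "h n \<noteq> 0" for n using h(1)[of n] by simp
        then show ?thesis using h0 by (simp add: filterlim_at)
      qed
      ultimately show "(\<lambda>n. q n x) \<longlonglongrightarrow> F' x v"
        unfolding q_def by (rule filterlim_compose)
    qed
    show "AE x in lborel. norm (q n x) \<le> B * indicator (cball 0 (R + norm v)) x" for n
    proof (rule AE_I2)
      fix x
      show "norm (q n x) \<le> B * indicator (cball 0 (R + norm v)) x"
      proof (cases "x \<in> cball 0 (R + norm v)")
        case True
        have "\<exists>t\<in>{0<..<h n}. norm (F (h n *\<^sub>R v + x) - F (0 *\<^sub>R v + x)) \<le> norm ((h n - 0) *\<^sub>R F' (t *\<^sub>R v + x) v)"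
        proof -
          have l: "((\<lambda>t. F (t *\<^sub>R v + x)) has_derivative (\<lambda>s. s *\<^sub>R F' (t *\<^sub>R v + x) v)) (at t)" for t
            using line unfolding has_vector_derivative_def .
          have "continuous_on {0..h n} (\<lambda>t. F (t *\<^sub>R v + x))"
            by (intro continuous_at_imp_continuous_on ballI has_derivative_continuous[OF l])
          from mvt_general[OF h(1) this l] show ?thesis by simp
        qed
        then obtain t where "norm (F (h n *\<^sub>R v + x) - F x) \<le> h n * norm (F' (t *\<^sub>R v + x) v)"
          using h(1)[of n] by auto
        also have "\<dots> \<le> h n * B" using B h(1)[of n] by (intro mult_left_mono) auto
        finally have "norm (F (h n *\<^sub>R v + x) - F x) / h n \<le> B"
          using h(1)[of n] by (simp add: pos_divide_le_eq mult.commute)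
        moreover have "norm (q n x) = norm (F (h n *\<^sub>R v + x) - F x) / h n"
          using h(1)[of n] by (simp add: q_def divide_inverse mult.commute)
        ultimately show ?thesis using True by simp
      next
        case False
        then have x: "norm x > R + norm v" by simp
        have "norm (h n *\<^sub>R v) \<le> norm v" using h[of n] by (simp add: mult_left_le_one_le)
        then have "norm (h n *\<^sub>R v + x) > R"
          using x norm_triangle_ineq4[of "h n *\<^sub>R v + x" "h n *\<^sub>R v"] by simp
        moreover have "norm x > R" using x norm_ge_zero[of v] by linarith
        ultimately have "h n *\<^sub>R v + x \<notin> K" "x \<notin> K" using R(2) by fastforce+
        then have "F (h n *\<^sub>R v + x) = 0" "F x = 0" using K(2) by simp_all
        then show ?thesis using False by (simp add: q_def)
      qed
    qed
  qed
  then show ?thesis using intq by (simp add: LIMSEQ_const_iff)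
qed

lemma test_functionD:
  assumes "\<psi> \<in> test_functions"
  shows "(\<psi> has_derivative frechet_derivative \<psi> (at x)) (at x)"
    "continuous_on UNIV \<psi>" "continuous_on UNIV (\<lambda>x. frechet_derivative \<psi> (at x) v)"
    "compact (closure {x. \<psi> x \<noteq> 0})"
proof -
  have "\<forall>m. C_upto m \<psi>" "compact (closure {x. \<psi> x \<noteq> 0})"
    using assms by (auto simp: test_functions_def)
  then have "C_upto 0 \<psi>" "C_upto (Suc 0) \<psi>" by blast+
  then show "(\<psi> has_derivative frechet_derivative \<psi> (at x)) (at x)"
    "continuous_on UNIV \<psi>" "continuous_on UNIV (\<lambda>x. frechet_derivative \<psi> (at x) v)"
    by (auto simp: frechet_derivative_works)
  show "compact (closure {x. \<psi> x \<noteq> 0})" by fact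
qed

lemma Herm_test_integrable:
  assumes psi: "\<psi> \<in> test_functions"
  shows "integrable lborel (\<lambda>x. of_real (Herm \<beta> x) * \<psi> x)"
proof -
  note t = test_functionD[OF psi]
  have "continuous_on UNIV (\<lambda>x. complex_of_real (Herm \<beta> x))"
    by (intro continuous_on_of_real real_polynomial_continuous Herm_polynomial)
  then show ?thesis
  proof (rule compact_support_integrable[OF continuous_on_mult[OF _ t(2)] t(4)])
    show "of_real (Herm \<beta> x) * \<psi> x = 0" if "x \<notin> closure {x. \<psi> x \<noteq> 0}" for x
      using that closure_subset[of "{x. \<psi> x \<noteq> 0}"] by auto
  qed
qed

text \<open>Integration by parts: on polynomials the distributional derivative is the classical one.\<close>

lemma distr_of_Herm_derivative:
  assumes psi: "\<psi> \<in> test_functions" and b: "b \<in> Basis"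
  shows "distr_of (\<lambda>x. of_real (Herm \<alpha> x)) (\<lambda>x. frechet_derivative \<psi> (at x) b)
    = - (4 * of_nat (\<alpha> b) * distr_of (\<lambda>x. of_real (Herm (dn b \<alpha>) x)) \<psi>)"
proof -
  note t = test_functionD[OF psi]
  let ?K = "closure {x. \<psi> x \<noteq> 0}"
  have K: "\<psi> x = 0" if "x \<notin> ?K" for x using that closure_subset[of "{x. \<psi> x \<noteq> 0}"] by auto
  let ?A = "\<lambda>x. of_real (Herm \<alpha> x) * frechet_derivative \<psi> (at x) b"
  let ?B = "\<lambda>x. of_real (Herm (dn b \<alpha>) x) * \<psi> x"
  have cont: "continuous_on UNIV (\<lambda>x. complex_of_real (Herm \<beta> x))" for \<beta> :: "'a multi_index"
    by (intro continuous_on_of_real real_polynomial_continuous Herm_polynomial)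
  have dd: "((\<lambda>x. of_real (Herm \<alpha> x) * \<psi> x) has_derivative
      (\<lambda>v. of_real (Herm \<alpha> x) * frechet_derivative \<psi> (at x) v +
        of_real (\<Sum>b\<in>Basis. (v \<bullet> b) * (4 * real (\<alpha> b) * Herm (dn b \<alpha>) x)) * \<psi> x)) (at x)" for x
    by (intro has_derivative_mult has_derivative_of_real Herm_has_derivative t(1))
  have e: "of_real (\<Sum>c\<in>Basis. (b \<bullet> c) * (4 * real (\<alpha> c) * Herm (dn c \<alpha>) x)) * \<psi> x
      = 4 * of_nat (\<alpha> b) * ?B x" for x
    using b by (simp add: inner_Basis if_distrib[of "\<lambda>t. t * _"] if_distrib[of "of_real"] cong: if_cong)
  have iA: "integrable lborel ?A"
  proof (rule compact_support_integrable[OF continuous_on_mult[OF cont t(3)] t(4)])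
    show "?A x = 0" if "x \<notin> ?K" for x
      using derivative_outside_support[OF t(1) closed_closure K that] by simp
  qed
  have iB: "integrable lborel ?B" by (rule Herm_test_integrable[OF psi])
  have "(\<integral>x. ?A x + 4 * of_nat (\<alpha> b) * ?B x \<partial>lborel) = 0"
  proof (rule integral_directional_derivative_eq_0[OF dd _ t(4), of b, unfolded e])
    show "continuous_on UNIV (\<lambda>x. ?A x + 4 * of_nat (\<alpha> b) * ?B x)"
      by (intro continuous_on_add continuous_on_mult cont t(2,3) continuous_on_const)
    show "of_real (Herm \<alpha> x) * \<psi> x = 0" if "x \<notin> ?K" for x using K[OF that] by simp
  qed
  then have "(\<integral>x. ?A x \<partial>lborel) = - (4 * of_nat (\<alpha> b) * (\<integral>x. ?B x \<partial>lborel))"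
    using iA iB by (simp add: add_eq_0_iff2)
  moreover have "(\<integral>x. ?A x \<partial>lebesgue) = (\<integral>x. ?A x \<partial>lborel)" "(\<integral>x. ?B x \<partial>lebesgue) = (\<integral>x. ?B x \<partial>lborel)"
    using iA iB by (auto intro!: integral_completion)
  ultimately show ?thesis by (simp add: distr_of_def)
qed

section \<open>Orthogonality and Bessel's inequality\<close>

definition multi_indices :: "'a::euclidean_space multi_index set" where
  "multi_indices = {\<alpha>. \<forall>b. b \<notin> Basis \<longrightarrow> \<alpha> b = 0}"

text \<open>The squared norm of \<^term>\<open>Herm \<alpha>\<close> in the weighted space, as \<open>Herm_orthogonal\<close> shows.\<close>

definition Herm_norm2 :: "'a::euclidean_space multi_index \<Rightarrow> real" where
  "Herm_norm2 \<alpha> = (\<integral>(x::'a). wt x \<partial>lebesgue) * (\<Prod>b\<in>Basis. 4 ^ \<alpha> b * fact (\<alpha> b))"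

text \<open>Raising the index on one side of the inner product is lowering it on the other. Both
  sides are limits of pairings with the same test functions, between which one integrates by parts.\<close>

lemma herm_coeff_Herm_up:
  assumes b: "b \<in> Basis"
  shows "herm_coeff (\<lambda>x. of_real (Herm \<beta> x)) (up b \<alpha>)
    = 4 * of_nat (\<beta> b) * herm_coeff (\<lambda>x. of_real (Herm (dn b \<beta>) x)) \<alpha>"
proof -
  have L2: "(\<lambda>x. of_real (Herm \<gamma> x)) \<in> L2_wt" for \<gamma> :: "'a multi_index"
    using polynomial_L2_wt[OF Herm_polynomial, of 1 \<gamma>] by simp
  have "(\<lambda>n. - (4 * of_nat (\<beta> b) * distr_of (\<lambda>x. of_real (Herm (dn b \<beta>) x)) (Hermite_test n \<alpha>)))
    \<longlonglongrightarrow> - (4 * of_nat (\<beta> b) * herm_coeff (\<lambda>x. of_real (Herm (dn b \<beta>) x)) \<alpha>)"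
    by (intro tendsto_minus tendsto_mult tendsto_const distr_of_Hermite_test_tendsto L2)
  moreover have "(\<lambda>n. - (4 * of_nat (\<beta> b) * distr_of (\<lambda>x. of_real (Herm (dn b \<beta>) x)) (Hermite_test n \<alpha>)))
    \<longlonglongrightarrow> - herm_coeff (\<lambda>x. of_real (Herm \<beta> x)) (up b \<alpha>)"
    using distr_of_Hermite_test_derivative_tendsto[OF L2 b, of \<beta> \<alpha>]
    by (simp add: distr_of_Herm_derivative[OF Hermite_test_in_test_functions b])
  ultimately show ?thesis using LIMSEQ_unique by fastforce
qed

lemma up_dn: "\<alpha> b > 0 \<Longrightarrow> up b (dn b \<alpha>) = \<alpha>" by (auto simp: up_def dn_def)
lemma dn_up: "dn b (up b \<alpha>) = \<alpha>" by (auto simp: up_def dn_def)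

lemma Herm_norm2_up:
  assumes "b \<in> Basis"
  shows "Herm_norm2 (up b \<alpha>) = 4 * real (Suc (\<alpha> b)) * Herm_norm2 \<alpha>"
proof -
  have "(\<Prod>i\<in>Basis - {b}. 4 ^ up b \<alpha> i * fact (up b \<alpha> i)) = (\<Prod>i\<in>Basis - {b}. 4 ^ \<alpha> i * fact (\<alpha> i) :: real)"
    by (intro prod.cong) (auto simp: up_def)
  then show ?thesis using assms
    by (simp add: Herm_norm2_def prod.remove[of Basis b] up_def mult_ac)
qed

lemma Herm_norm2_dn: "b \<in> Basis \<Longrightarrow> \<alpha> b > 0 \<Longrightarrow> Herm_norm2 \<alpha> = 4 * real (\<alpha> b) * Herm_norm2 (dn b \<alpha>)"
  using Herm_norm2_up[of b "dn b \<alpha>"] up_dn[of \<alpha> b] by (simp add: dn_def)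

lemma wt_integral_pos: "(\<integral>x. wt x \<partial>(lebesgue :: 'a::euclidean_space measure)) > 0"
proof -
  have i: "integrable (lebesgue :: 'a measure) wt"
    using polynomial_wt_integrable[OF real_polynomial_function.intros(2)[of 1]] by simp
  have nn: "AE x in (lebesgue :: 'a measure). 0 \<le> wt x" by (simp add: less_imp_le[OF wt_pos])
  have "(\<integral>x. wt x \<partial>(lebesgue :: 'a measure)) \<noteq> 0"
  proof
    assume "(\<integral>x. wt x \<partial>(lebesgue :: 'a measure)) = 0"
    then have "AE x in (lebesgue :: 'a measure). wt x = 0"
      using integral_nonneg_eq_0_iff_AE[OF i nn] by simp
    then have "AE x in (lebesgue :: 'a measure). False"
      by (rule eventually_mono) (use wt_pos in \<open>metis less_irrefl\<close>)
    then show False by (simp add: eventually_False ae_filter_eq_bot_iff)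
  qed
  moreover have "(\<integral>x. wt x \<partial>(lebesgue :: 'a measure)) \<ge> 0" using nn by (rule integral_nonneg_AE)
  ultimately show ?thesis by simp
qed

lemma Herm_norm2_pos: "Herm_norm2 \<alpha> > 0"
  unfolding Herm_norm2_def by (intro mult_pos_pos wt_integral_pos prod_pos) auto

lemma multi_indices_dn: "\<alpha> \<in> multi_indices \<Longrightarrow> dn b \<alpha> \<in> multi_indices" by (auto simp: multi_indices_def dn_def)
lemma multi_indices_up: "\<alpha> \<in> multi_indices \<Longrightarrow> b \<in> Basis \<Longrightarrow> up b \<alpha> \<in> multi_indices" by (auto simp: multi_indices_def up_def)

text \<open>Induction on the degree of \<open>\<alpha>\<close>: one raising step is taken off \<open>\<alpha>\<close> and lowers \<open>\<beta>\<close> instead. If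
  \<open>\<beta>\<close> cannot be lowered, the factor \<open>\<beta> b = 0\<close> annihilates the inner product.\<close>

lemma Herm_orthogonal:
  assumes "\<alpha> \<in> multi_indices" "\<beta> \<in> multi_indices"
  shows "herm_coeff (\<lambda>x. of_real (Herm \<beta> x)) \<alpha> = (if \<alpha> = \<beta> then of_real (Herm_norm2 \<alpha>) else 0)"
  using assms
proof (induction "sum \<alpha> Basis" arbitrary: \<alpha> \<beta>)
  case 0
  then have \<alpha>: "\<alpha> = (\<lambda>_. 0)" by (auto simp: multi_indices_def fun_eq_iff)
  show ?case
  proof (cases "\<beta> = \<alpha>")
    case True
    then show ?thesis by (simp add: \<alpha> herm_coeff_def Herm_0 Herm_norm2_def)
  next
    case False
    then obtain b where "\<beta> b \<noteq> 0" by (auto simp: \<alpha> fun_eq_iff)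
    with \<open>\<beta> \<in> multi_indices\<close> have b: "b \<in> Basis" "\<beta> b > 0" by (auto simp: multi_indices_def)
    have "herm_coeff (\<lambda>x. of_real (Herm \<beta> x)) \<alpha> = herm_coeff (\<lambda>x. of_real (Herm \<alpha> x)) \<beta>"
      by (simp add: herm_coeff_def mult_ac)
    also have "\<dots> = 0"
      using herm_coeff_Herm_up[OF b(1), of \<alpha> "dn b \<beta>"] b(2) by (simp add: up_dn \<alpha>)
    finally show ?thesis using False by simp
  qed
next
  case (Suc n)
  then obtain b where b: "b \<in> Basis" "\<alpha> b > 0"
    by (metis Zero_not_Suc gr0I sum.neutral)
  define \<gamma> where "\<gamma> = dn b \<alpha>"
  have \<alpha>: "\<alpha> = up b \<gamma>" using b by (simp add: \<gamma>_def up_dn)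
  have "sum \<alpha> Basis = Suc (sum \<gamma> Basis)"
    using b unfolding \<gamma>_def by (simp add: sum.remove[of Basis b] dn_def)
  then have n: "n = sum \<gamma> Basis" using Suc.hyps by simp
  have "herm_coeff (\<lambda>x. of_real (Herm \<beta> x)) \<alpha> = 4 * of_nat (\<beta> b) * herm_coeff (\<lambda>x. of_real (Herm (dn b \<beta>) x)) \<gamma>"
    unfolding \<alpha> by (rule herm_coeff_Herm_up[OF b(1)])
  also have "\<dots> = 4 * of_nat (\<beta> b) * (if \<gamma> = dn b \<beta> then of_real (Herm_norm2 \<gamma>) else 0)"
    using Suc.hyps(1)[OF n, of "dn b \<beta>"] Suc.prems by (simp add: multi_indices_dn \<gamma>_def)
  also have "\<dots> = (if \<alpha> = \<beta> then of_real (Herm_norm2 \<alpha>) else 0)"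
  proof (cases "\<beta> b = 0")
    case True
    then show ?thesis using b by auto
  next
    case False
    then have "\<gamma> = dn b \<beta> \<longleftrightarrow> \<alpha> = \<beta>" unfolding \<gamma>_def using b by (metis neq0_conv up_dn)
    then show ?thesis using b by (auto simp: Herm_norm2_dn[of b \<beta>] \<gamma>_def)
  qed
  finally show ?case .
qed

lemma norm_add_square_wt_le:
  "(norm (a + b :: complex))\<^sup>2 * wt x \<le> 2 * ((norm a)\<^sup>2 * wt x) + 2 * ((norm b)\<^sup>2 * wt x)"
proof -
  have "(norm (a + b))\<^sup>2 \<le> (norm a + norm b)\<^sup>2"
    by (intro power_mono norm_triangle_ineq) auto
  also have "\<dots> \<le> 2 * (norm a)\<^sup>2 + 2 * (norm b)\<^sup>2"
    using sum_squares_bound[of "norm a" "norm b"] by (simp add: power2_sum)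
  finally have "(norm (a + b))\<^sup>2 * wt x \<le> (2 * (norm a)\<^sup>2 + 2 * (norm b)\<^sup>2) * wt x"
    using wt_pos[of x] by (intro mult_right_mono) auto
  then show ?thesis by (simp add: algebra_simps)
qed

lemma L2_wt_add:
  assumes "u \<in> L2_wt" "v \<in> L2_wt" shows "(\<lambda>x. u x + v x) \<in> L2_wt"
proof -
  have [measurable]: "u \<in> borel_measurable lebesgue" "v \<in> borel_measurable lebesgue"
     "wt \<in> borel_measurable (lebesgue :: 'a measure)"
    using assms by (auto simp: L2_wt_def intro!: measurable_completion)
  have "integrable lebesgue (\<lambda>x. (norm (u x + v x))\<^sup>2 * wt x)"
  proof (rule Bochner_Integration.integrable_bound)
    show "integrable lebesgue (\<lambda>x. 2 * ((norm (u x))\<^sup>2 * wt x) + 2 * ((norm (v x))\<^sup>2 * wt x))"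
      using assms by (intro Bochner_Integration.integrable_add integrable_mult_right) (auto simp: L2_wt_def)
    show "AE x in lebesgue. norm ((norm (u x + v x))\<^sup>2 * wt x) \<le>
        norm (2 * ((norm (u x))\<^sup>2 * wt x) + 2 * ((norm (v x))\<^sup>2 * wt x))"
      using norm_add_square_wt_le
      by (auto intro!: AE_I2 order_trans[OF _ abs_ge_self] simp: abs_mult less_imp_le[OF wt_pos])
  qed measurable
  then show ?thesis by (simp add: L2_wt_def)
qed

lemma L2_wt_cmult:
  assumes "u \<in> L2_wt" shows "(\<lambda>x. c * u x) \<in> L2_wt"
proof -
  have "integrable lebesgue (\<lambda>x. (norm c)\<^sup>2 * ((norm (u x))\<^sup>2 * wt x))"
    using assms by (intro integrable_mult_right) (simp add: L2_wt_def)
  moreover have "(\<lambda>x. c * u x) \<in> borel_measurable lebesgue"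
    using assms by (intro borel_measurable_times) (auto simp: L2_wt_def)
  ultimately show ?thesis by (simp add: L2_wt_def norm_mult power_mult_distrib mult.assoc)
qed

lemma L2_wt_sum: "(\<And>i. i \<in> F \<Longrightarrow> u i \<in> L2_wt) \<Longrightarrow> (\<lambda>x. \<Sum>i\<in>F. u i x) \<in> L2_wt"
proof (induction F rule: infinite_finite_induct)
  case (insert i F)
  then show ?case using L2_wt_add[of "u i" "\<lambda>x. \<Sum>i\<in>F. u i x"] by simp
qed (use polynomial_L2_wt[OF real_polynomial_function.intros(2)[of 0], of 0] in simp_all)

lemma L2_wt_diff: "u \<in> L2_wt \<Longrightarrow> v \<in> L2_wt \<Longrightarrow> (\<lambda>x. u x - v x) \<in> L2_wt"
  using L2_wt_add[OF _ L2_wt_cmult[of v "- 1"], of u] by simp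

lemma Hermite_distance:
  fixes u :: "'a::euclidean_space \<Rightarrow> complex"
  assumes u: "u \<in> L2_wt" and F: "finite F" "F \<subseteq> multi_indices"
  shows "(\<integral>x. (norm (u x - (\<Sum>\<alpha>\<in>F. d \<alpha> * of_real (Herm \<alpha> x))))\<^sup>2 * wt x \<partial>lebesgue)
    = (\<integral>x. (norm (u x))\<^sup>2 * wt x \<partial>lebesgue)
      + (\<Sum>\<alpha>\<in>F. (norm (d \<alpha>))\<^sup>2 * Herm_norm2 \<alpha> - 2 * Re (cnj (d \<alpha>) * herm_coeff u \<alpha>))"
    (is "?l = ?r")
proof -
  let ?p = "\<lambda>x. \<Sum>\<alpha>\<in>F. d \<alpha> * of_real (Herm \<alpha> x)"
  let ?X = "\<lambda>x. \<Sum>\<alpha>\<in>F. cnj (d \<alpha>) * (u x * of_real (Herm \<alpha> x * wt x))"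
  let ?Y = "\<lambda>x. \<Sum>\<alpha>\<in>F. \<Sum>\<beta>\<in>F. d \<alpha> * cnj (d \<beta>) * (of_real (Herm \<alpha> x) * of_real (Herm \<beta> x * wt x))"
  have HL2: "(\<lambda>x. of_real (Herm \<gamma> x)) \<in> L2_wt" for \<gamma> :: "'a multi_index"
    using polynomial_L2_wt[OF Herm_polynomial, of 1 \<gamma>] by simp
  have iX1: "integrable lebesgue (\<lambda>x. u x * of_real (Herm \<alpha> x * wt x))" for \<alpha>
    by (rule polynomial_times_L2_wt_integrable[OF u Herm_polynomial])
  have iY1: "integrable lebesgue (\<lambda>x. complex_of_real (Herm \<alpha> x) * of_real (Herm \<beta> x * wt x))" for \<alpha> \<beta> :: "'a multi_index"
    by (rule polynomial_times_L2_wt_integrable[OF HL2 Herm_polynomial])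
  have iX: "integrable lebesgue ?X" by (intro Bochner_Integration.integrable_sum integrable_mult_right iX1)
  have iY: "integrable lebesgue ?Y" by (intro Bochner_Integration.integrable_sum integrable_mult_right iY1)
  have iu: "integrable lebesgue (\<lambda>x. complex_of_real ((norm (u x))\<^sup>2 * wt x))"
    using u by (intro integrable_of_real) (simp add: L2_wt_def)
  have pt: "complex_of_real ((norm (u x - ?p x))\<^sup>2 * wt x)
      = of_real ((norm (u x))\<^sup>2 * wt x) - ?X x - cnj (?X x) + ?Y x" for x
  proof -
    define P where "P = ?p x"
    have X: "?X x = u x * cnj P * of_real (wt x)"
      unfolding P_def by (simp add: sum_distrib_left sum_distrib_right mult_ac)
    have Y: "?Y x = P * cnj P * of_real (wt x)"
      unfolding P_def by (simp add: sum_product) (simp add: sum_distrib_left sum_distrib_right mult_ac)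
    show ?thesis unfolding X Y P_def[symmetric] unfolding of_real_mult complex_norm_square
      by (simp add: algebra_simps)
  qed
  have "complex_of_real ?l = (\<integral>x. complex_of_real ((norm (u x - ?p x))\<^sup>2 * wt x) \<partial>lebesgue)"
    by (rule integral_complex_of_real[symmetric])
  also have "\<dots> = (\<integral>x. of_real ((norm (u x))\<^sup>2 * wt x) - ?X x - cnj (?X x) + ?Y x \<partial>lebesgue)"
    unfolding pt ..
  also have "\<dots> = (\<integral>x. of_real ((norm (u x))\<^sup>2 * wt x) \<partial>lebesgue) - (\<integral>x. ?X x \<partial>lebesgue)
      - cnj (\<integral>x. ?X x \<partial>lebesgue) + (\<integral>x. ?Y x \<partial>lebesgue)"
    using iX iY iu by (simp only: Bochner_Integration.integral_add Bochner_Integration.integral_diff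
        Bochner_Integration.integrable_diff Bochner_Integration.integral_cnj integrable_cnj)
  also have "(\<integral>x. ?X x \<partial>lebesgue) = (\<Sum>\<alpha>\<in>F. cnj (d \<alpha>) * herm_coeff u \<alpha>)"
    using iX1 by (subst Bochner_Integration.integral_sum) (auto simp: herm_coeff_def simp del: of_real_mult)
  also have "(\<integral>x. ?Y x \<partial>lebesgue) = (\<Sum>\<alpha>\<in>F. \<Sum>\<beta>\<in>F. d \<alpha> * cnj (d \<beta>) * herm_coeff (\<lambda>x. of_real (Herm \<alpha> x)) \<beta>)"
    using iY1 by (subst Bochner_Integration.integral_sum;
        (subst Bochner_Integration.integral_sum)?) (auto simp: herm_coeff_def Bochner_Integration.integral_sum simp del: of_real_mult)
  also have "\<dots> = (\<Sum>\<alpha>\<in>F. \<Sum>\<beta>\<in>F. d \<alpha> * cnj (d \<beta>) * (if \<beta> = \<alpha> then of_real (Herm_norm2 \<beta>) else 0))"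
    using F by (intro sum.cong refl) (auto simp: Herm_orthogonal subset_eq)
  also have "\<dots> = (\<Sum>\<alpha>\<in>F. of_real ((norm (d \<alpha>))\<^sup>2 * Herm_norm2 \<alpha>))"
    using F by (simp add: if_distrib[of "\<lambda>t. _ * t"] complex_norm_square cong: if_cong del: of_real_power)
  finally have "Re (complex_of_real ?l) = Re (of_real (\<integral>x. (norm (u x))\<^sup>2 * wt x \<partial>lebesgue)
      - (\<Sum>\<alpha>\<in>F. cnj (d \<alpha>) * herm_coeff u \<alpha>) - cnj (\<Sum>\<alpha>\<in>F. cnj (d \<alpha>) * herm_coeff u \<alpha>)
      + (\<Sum>\<alpha>\<in>F. of_real ((norm (d \<alpha>))\<^sup>2 * Herm_norm2 \<alpha>)))"
    by (simp only: integral_complex_of_real)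
  then show ?thesis
    by (simp only: Re_complex_of_real minus_complex.sel plus_complex.sel complex_cnj Re_sum complex_cnj_cnj
        sum_subtractf sum_distrib_left[symmetric] cnj.sel)
qed

text \<open>With \<open>c\<close> the coefficient of \<open>u\<close> and \<open>h\<close> the squared norm of the Hermite polynomial, the two sides
  differ by the sum of the squares \<open>\<bar>d h - c\<bar>^2 / h\<close>.\<close>

lemma Hermite_best_approximation:
  assumes u: "u \<in> L2_wt" and F: "finite F" "F \<subseteq> multi_indices"
  shows "(\<integral>x. (norm (u x))\<^sup>2 * wt x \<partial>lebesgue) - (\<Sum>\<alpha>\<in>F. (norm (herm_coeff u \<alpha>))\<^sup>2 / Herm_norm2 \<alpha>)
    \<le> (\<integral>x. (norm (u x - (\<Sum>\<alpha>\<in>F. d \<alpha> * of_real (Herm \<alpha> x))))\<^sup>2 * wt x \<partial>lebesgue)"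
proof -
  have "- ((norm (herm_coeff u \<alpha>))\<^sup>2 / Herm_norm2 \<alpha>) \<le> (norm (d \<alpha>))\<^sup>2 * Herm_norm2 \<alpha> - 2 * Re (cnj (d \<alpha>) * herm_coeff u \<alpha>)" for \<alpha>
  proof -
    let ?h = "Herm_norm2 \<alpha>" and ?c = "herm_coeff u \<alpha>" and ?d = "d \<alpha>"
    have "0 \<le> (norm (?d * of_real ?h - ?c))\<^sup>2 / ?h" using Herm_norm2_pos[of \<alpha>] by simp
    also have "\<dots> = (norm ?d)\<^sup>2 * ?h - 2 * Re (cnj ?d * ?c) + (norm ?c)\<^sup>2 / ?h"
      using Herm_norm2_pos[of \<alpha>] unfolding cmod_power2 by (simp add: field_simps power2_eq_square)
    finally show ?thesis by simp
  qed
  then have "- (\<Sum>\<alpha>\<in>F. (norm (herm_coeff u \<alpha>))\<^sup>2 / Herm_norm2 \<alpha>) \<le>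
      (\<Sum>\<alpha>\<in>F. (norm (d \<alpha>))\<^sup>2 * Herm_norm2 \<alpha> - 2 * Re (cnj (d \<alpha>) * herm_coeff u \<alpha>))"
    unfolding sum_negf[symmetric] by (rule sum_mono)
  then show ?thesis unfolding Hermite_distance[OF assms] by simp
qed

text \<open>The choice \<open>d = c / h\<close> makes the squares in the preceding comparison vanish.\<close>

lemma Hermite_Bessel:
  assumes u: "u \<in> L2_wt" and F: "finite F" "F \<subseteq> multi_indices"
  shows "(\<Sum>\<alpha>\<in>F. (norm (herm_coeff u \<alpha>))\<^sup>2 / Herm_norm2 \<alpha>) \<le> (\<integral>x. (norm (u x))\<^sup>2 * wt x \<partial>lebesgue)"
proof -
  let ?d = "\<lambda>\<alpha>. herm_coeff u \<alpha> / of_real (Herm_norm2 \<alpha>)"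
  have e: "(norm (?d \<alpha>))\<^sup>2 * Herm_norm2 \<alpha> - 2 * Re (cnj (?d \<alpha>) * herm_coeff u \<alpha>)
      = - ((norm (herm_coeff u \<alpha>))\<^sup>2 / Herm_norm2 \<alpha>)" for \<alpha>
    using Herm_norm2_pos[of \<alpha>] unfolding cmod_power2 by (simp add: field_simps power2_eq_square)
  have "0 \<le> (\<integral>x. (norm (u x - (\<Sum>\<alpha>\<in>F. ?d \<alpha> * of_real (Herm \<alpha> x))))\<^sup>2 * wt x \<partial>lebesgue)"
    by (intro integral_nonneg_AE AE_I2 mult_nonneg_nonneg) (auto simp: less_imp_le[OF wt_pos])
  then show ?thesis unfolding Hermite_distance[OF assms] e by (simp add: sum_negf)
qed

section \<open>Completeness of the Hermite polynomials\<close>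

text \<open>Membership in the closure of the polynomials.\<close>

definition approximable :: "('a::euclidean_space \<Rightarrow> complex) \<Rightarrow> bool" where
  "approximable u \<longleftrightarrow> u \<in> L2_wt \<and> (\<forall>e>0. \<exists>p q. real_polynomial_function p \<and> real_polynomial_function q \<and>
     (\<integral>x. (norm (u x - Complex (p x) (q x)))\<^sup>2 * wt x \<partial>lebesgue) < e)"

lemma wt_lebesgue_measurable [measurable]: "wt \<in> borel_measurable lebesgue"
  by (intro measurable_completion) simp

lemma Complex_polynomial_L2_wt:
  assumes "real_polynomial_function p" "real_polynomial_function q"
  shows "(\<lambda>x. Complex (p x) (q x)) \<in> L2_wt"
  using L2_wt_add[OF polynomial_L2_wt[OF assms(1), of 1] polynomial_L2_wt[OF assms(2), of \<i>]]
  by (simp add: Complex_eq)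

lemma L2_wt_norm_integrable: "u \<in> L2_wt \<Longrightarrow> integrable lebesgue (\<lambda>x. (norm (u x))\<^sup>2 * wt x)"
  by (simp add: L2_wt_def)

lemma L2_wt_triangle:
  assumes "u \<in> L2_wt" "v \<in> L2_wt"
  shows "(\<integral>x. (norm (u x + v x))\<^sup>2 * wt x \<partial>lebesgue)
    \<le> 2 * (\<integral>x. (norm (u x))\<^sup>2 * wt x \<partial>lebesgue) + 2 * (\<integral>x. (norm (v x))\<^sup>2 * wt x \<partial>lebesgue)"
proof -
  have "(\<integral>x. (norm (u x + v x))\<^sup>2 * wt x \<partial>lebesgue)
      \<le> (\<integral>x. 2 * ((norm (u x))\<^sup>2 * wt x) + 2 * ((norm (v x))\<^sup>2 * wt x) \<partial>lebesgue)"
    using assms by (intro integral_mono norm_add_square_wt_le Bochner_Integration.integrable_add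
        integrable_mult_right L2_wt_norm_integrable L2_wt_add)
  also have "\<dots> = 2 * (\<integral>x. (norm (u x))\<^sup>2 * wt x \<partial>lebesgue) + 2 * (\<integral>x. (norm (v x))\<^sup>2 * wt x \<partial>lebesgue)"
    using assms by (simp add: L2_wt_norm_integrable)
  finally show ?thesis .
qed

lemma approximableI:
  assumes u: "u \<in> L2_wt"
    and v: "\<And>e. e > 0 \<Longrightarrow> \<exists>v. approximable v \<and> (\<integral>x. (norm (u x - v x))\<^sup>2 * wt x \<partial>lebesgue) < e"
  shows "approximable u"
  unfolding approximable_def
proof (intro conjI u allI impI)
  fix e :: real assume "e > 0"
  then have e4: "e / 4 > 0" by simp
  from v[OF e4] obtain v where v: "approximable v" "(\<integral>x. (norm (u x - v x))\<^sup>2 * wt x \<partial>lebesgue) < e / 4" by blast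
  from v(1) e4 obtain p q where pq: "real_polynomial_function p" "real_polynomial_function q"
    "(\<integral>x. (norm (v x - Complex (p x) (q x)))\<^sup>2 * wt x \<partial>lebesgue) < e / 4"
    unfolding approximable_def by blast
  have vL2: "v \<in> L2_wt" using v(1) by (simp add: approximable_def)
  have "(\<integral>x. (norm ((u x - v x) + (v x - Complex (p x) (q x))))\<^sup>2 * wt x \<partial>lebesgue) < e"
    using L2_wt_triangle[OF L2_wt_diff[OF u vL2] L2_wt_diff[OF vL2 Complex_polynomial_L2_wt[OF pq(1,2)]]] v(2) pq(3)
    by linarith
  then show "\<exists>p q. real_polynomial_function p \<and> real_polynomial_function q \<and>
     (\<integral>x. (norm (u x - Complex (p x) (q x)))\<^sup>2 * wt x \<partial>lebesgue) < e"
    using pq(1,2) by (intro exI[of _ p] exI[of _ q]) simp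
qed

text \<open>The closure of the polynomials is stable under dominated convergence.\<close>

lemma approximable_limit:
  assumes s: "\<And>n. approximable (s n)"
    and lim: "AE x in lebesgue. (\<lambda>n. s n x) \<longlonglongrightarrow> u x"
    and u: "u \<in> borel_measurable lebesgue"
    and G: "integrable lebesgue (\<lambda>x. (G x)\<^sup>2 * wt x)"
    and bound: "\<And>n x. norm (s n x) \<le> G x"
  shows "approximable u"
proof -
  have sL2: "s n \<in> L2_wt" for n using s by (simp add: approximable_def)
  then have [measurable]: "s n \<in> borel_measurable lebesgue" for n by (simp add: L2_wt_def)
  note [measurable] = u
  have G0: "0 \<le> G x" for x using bound[of 0 x] norm_ge_zero order_trans by blast
  have ub: "AE x in lebesgue. norm (u x) \<le> G x"
    using lim
  proof (rule eventually_mono)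
    fix x assume "(\<lambda>n. s n x) \<longlonglongrightarrow> u x"
    from tendsto_norm[OF this] show "norm (u x) \<le> G x"
      by (rule tendsto_upperbound) (auto simp: bound)
  qed
  have uL2: "u \<in> L2_wt"
  proof -
    have "integrable lebesgue (\<lambda>x. (norm (u x))\<^sup>2 * wt x)"
    proof (rule Bochner_Integration.integrable_bound[OF G])
      show "AE x in lebesgue. norm ((norm (u x))\<^sup>2 * wt x) \<le> norm ((G x)\<^sup>2 * wt x)"
        using ub
        by (rule eventually_mono) (auto simp: abs_mult less_imp_le[OF wt_pos] intro!: mult_right_mono power_mono)
    qed measurable
    then show ?thesis using u by (simp add: L2_wt_def)
  qed
  have "(\<lambda>n. \<integral>x. (norm (u x - s n x))\<^sup>2 * wt x \<partial>lebesgue) \<longlonglongrightarrow> (\<integral>x. 0 \<partial>(lebesgue :: 'a measure))"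
  proof (rule integral_dominated_convergence)
    show "integrable lebesgue (\<lambda>x. 4 * ((G x)\<^sup>2 * wt x))" using G by (rule integrable_mult_right)
    show "AE x in lebesgue. (\<lambda>n. (norm (u x - s n x))\<^sup>2 * wt x) \<longlonglongrightarrow> 0"
      using lim
    proof (rule eventually_mono)
      fix x assume l: "(\<lambda>n. s n x) \<longlonglongrightarrow> u x"
      have "(\<lambda>n. (norm (u x - s n x))\<^sup>2 * wt x) \<longlonglongrightarrow> (norm (u x - u x))\<^sup>2 * wt x"
        by (intro tendsto_mult tendsto_power tendsto_norm tendsto_diff tendsto_const l)
      then show "(\<lambda>n. (norm (u x - s n x))\<^sup>2 * wt x) \<longlonglongrightarrow> 0" by simp
    qed
    show "AE x in lebesgue. norm ((norm (u x - s n x))\<^sup>2 * wt x) \<le> 4 * ((G x)\<^sup>2 * wt x)" for n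
      using ub
    proof (rule eventually_mono)
      fix x assume "norm (u x) \<le> G x"
      then have "norm (u x - s n x) \<le> 2 * G x"
        using bound[of n x] norm_triangle_ineq4[of "u x" "s n x"] by linarith
      then have "(norm (u x - s n x))\<^sup>2 \<le> (2 * G x)\<^sup>2" by (intro power_mono) auto
      then have "(norm (u x - s n x))\<^sup>2 * wt x \<le> (2 * G x)\<^sup>2 * wt x"
        using wt_pos[of x] by (intro mult_right_mono) auto
      then show "norm ((norm (u x - s n x))\<^sup>2 * wt x) \<le> 4 * ((G x)\<^sup>2 * wt x)"
        using wt_pos[of x] by (simp add: abs_mult power_mult_distrib)
    qed
  qed measurable
  then have l0: "(\<lambda>n. \<integral>x. (norm (u x - s n x))\<^sup>2 * wt x \<partial>lebesgue) \<longlonglongrightarrow> 0" by simp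
  show ?thesis
  proof (rule approximableI[OF uL2])
    fix e :: real assume "e > 0"
    from order_tendstoD(2)[OF l0 this]
    obtain n where "(\<integral>x. (norm (u x - s n x))\<^sup>2 * wt x \<partial>lebesgue) < e"
      by (auto simp: eventually_sequentially)
    then show "\<exists>v. approximable v \<and> (\<integral>x. (norm (u x - v x))\<^sup>2 * wt x \<partial>lebesgue) < e" using s by blast
  qed
qed

lemma approximable_polynomial:
  assumes "real_polynomial_function p" "real_polynomial_function q"
  shows "approximable (\<lambda>x. Complex (p x) (q x))"
  unfolding approximable_def
proof (intro conjI allI impI)
  show "\<exists>p' q'. real_polynomial_function p' \<and> real_polynomial_function q' \<and>
     (\<integral>x. (norm (Complex (p x) (q x) - Complex (p' x) (q' x)))\<^sup>2 * wt x \<partial>lebesgue) < e" if "e > 0" for e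
    using assms that by (intro exI[of _ p] exI[of _ q]) simp
qed (rule Complex_polynomial_L2_wt[OF assms])

lemma approximable_add:
  assumes "approximable u" "approximable v"
  shows "approximable (\<lambda>x. u x + v x)"
  unfolding approximable_def
proof (intro conjI allI impI)
  have uv: "u \<in> L2_wt" "v \<in> L2_wt" using assms by (auto simp: approximable_def)
  then show "(\<lambda>x. u x + v x) \<in> L2_wt" by (rule L2_wt_add)
  fix e :: real assume "e > 0"
  then have e: "e / 4 > 0" by simp
  from assms e obtain p q p' q' where pq: "real_polynomial_function p" "real_polynomial_function q"
    "(\<integral>x. (norm (u x - Complex (p x) (q x)))\<^sup>2 * wt x \<partial>lebesgue) < e / 4"
    "real_polynomial_function p'" "real_polynomial_function q'"
    "(\<integral>x. (norm (v x - Complex (p' x) (q' x)))\<^sup>2 * wt x \<partial>lebesgue) < e / 4"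
    unfolding approximable_def by meson
  have "(\<integral>x. (norm ((u x - Complex (p x) (q x)) + (v x - Complex (p' x) (q' x))))\<^sup>2 * wt x \<partial>lebesgue) < e"
    using L2_wt_triangle[OF L2_wt_diff[OF uv(1) Complex_polynomial_L2_wt[OF pq(1,2)]]
        L2_wt_diff[OF uv(2) Complex_polynomial_L2_wt[OF pq(4,5)]]] pq(3,6) by linarith
  moreover have "(u x - Complex (p x) (q x)) + (v x - Complex (p' x) (q' x)) =
      u x + v x - Complex (p x + p' x) (q x + q' x)" for x by (simp add: complex_eq_iff)
  ultimately show "\<exists>p q. real_polynomial_function p \<and> real_polynomial_function q \<and>
     (\<integral>x. (norm (u x + v x - Complex (p x) (q x)))\<^sup>2 * wt x \<partial>lebesgue) < e"
    using pq(1,2,4,5)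
    by (intro exI[of _ "\<lambda>x. p x + p' x"] exI[of _ "\<lambda>x. q x + q' x"]) (auto intro: real_polynomial_function.intros(3))
qed

lemma approximable_cmult:
  assumes "approximable u"
  shows "approximable (\<lambda>x. c * u x)"
  unfolding approximable_def
proof (intro conjI allI impI)
  have u: "u \<in> L2_wt" using assms by (auto simp: approximable_def)
  then show "(\<lambda>x. c * u x) \<in> L2_wt" by (rule L2_wt_cmult)
  fix e :: real assume "e > 0"
  then have e: "e / ((norm c)\<^sup>2 + 1) > 0" by (simp add: add_nonneg_pos)
  from assms e obtain p q where pq: "real_polynomial_function p" "real_polynomial_function q"
    "(\<integral>x. (norm (u x - Complex (p x) (q x)))\<^sup>2 * wt x \<partial>lebesgue) < e / ((norm c)\<^sup>2 + 1)" (is "?I < _")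
    unfolding approximable_def by meson
  have I0: "?I \<ge> 0" by (intro integral_nonneg_AE AE_I2) (simp add: less_imp_le[OF wt_pos])
  have "norm (c * u x - c * Complex (p x) (q x)) = norm c * norm (u x - Complex (p x) (q x))" for x
    by (simp flip: norm_mult add: right_diff_distrib)
  then have "(\<integral>x. (norm (c * u x - c * Complex (p x) (q x)))\<^sup>2 * wt x \<partial>lebesgue) = (norm c)\<^sup>2 * ?I"
    by (simp add: power_mult_distrib mult.assoc)
  also have "\<dots> \<le> ((norm c)\<^sup>2 + 1) * ?I" using I0 by (intro mult_right_mono) auto
  also have "\<dots> < e" using pq(3) by (simp add: pos_less_divide_eq add_nonneg_pos mult.commute)
  finally have *: "(\<integral>x. (norm (c * u x - c * Complex (p x) (q x)))\<^sup>2 * wt x \<partial>lebesgue) < e" .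
  have c: "c * Complex (p x) (q x) = Complex (Re c * p x + (- Im c) * q x) (Im c * p x + Re c * q x)" for x
    by (simp add: complex_eq_iff)
  show "\<exists>p q. real_polynomial_function p \<and> real_polynomial_function q \<and>
     (\<integral>x. (norm (c * u x - Complex (p x) (q x)))\<^sup>2 * wt x \<partial>lebesgue) < e"
    using * unfolding c
    by (intro exI[of _ "\<lambda>x. Re c * p x + (- Im c) * q x"] exI[of _ "\<lambda>x. Im c * p x + Re c * q x"] conjI
        real_polynomial_function.intros(2-4) pq)
qed

lemma approximable_sum:
  "(\<And>i. i \<in> F \<Longrightarrow> approximable (u i)) \<Longrightarrow> approximable (\<lambda>x. \<Sum>i\<in>F. u i x)"
proof (induction F rule: infinite_finite_induct)
  case (insert i F)
  then show ?case using approximable_add[of "u i" "\<lambda>x. \<Sum>i\<in>F. u i x"] by simp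
qed (use approximable_polynomial[OF real_polynomial_function.intros(2)[of 0] real_polynomial_function.intros(2)[of 0]]
   in \<open>simp_all add: Complex_eq\<close>)

text \<open>Bounded functions that carry every polynomial into the closure of the polynomials. Quantifying over
  all polynomials is what allows one to multiply repeatedly, by Taylor polynomials of a Gaussian.\<close>

definition multipliers :: "('a::euclidean_space \<Rightarrow> real) set" where
  "multipliers = {b. b \<in> borel_measurable borel \<and> (\<exists>B. \<forall>x. \<bar>b x\<bar> \<le> B) \<and>
     (\<forall>p. real_polynomial_function p \<longrightarrow> approximable (\<lambda>x. of_real (b x * p x)))}"

lemma multipliers_const: "(\<lambda>_. c) \<in> multipliers"
proof -
  have "approximable (\<lambda>x. of_real (c * p x))" if "real_polynomial_function p" for p :: "'a \<Rightarrow> real"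
    using approximable_cmult[OF approximable_polynomial[OF that real_polynomial_function.intros(2)[of 0]], of "of_real c"]
    by (simp add: complex_of_real_def[symmetric])
  then show ?thesis by (auto simp: multipliers_def)
qed

lemma multipliers_add:
  assumes "b \<in> multipliers" "c \<in> multipliers"
  shows "(\<lambda>x. b x + c x) \<in> multipliers"
proof -
  from assms obtain B C where "\<forall>x. \<bar>b x\<bar> \<le> B" "\<forall>x. \<bar>c x\<bar> \<le> C" by (auto simp: multipliers_def)
  then have "\<forall>x. \<bar>b x + c x\<bar> \<le> B + C" by (meson abs_triangle_ineq add_mono order_trans)
  moreover have "approximable (\<lambda>x. of_real ((b x + c x) * p x))" if "real_polynomial_function p" for p :: "'a \<Rightarrow> real"
    using assms that approximable_add[of "\<lambda>x. of_real (b x * p x)" "\<lambda>x. of_real (c x * p x)"]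
    by (simp add: multipliers_def distrib_right)
  ultimately show ?thesis using assms by (auto simp: multipliers_def)
qed

lemma multipliers_cmult:
  assumes "b \<in> multipliers"
  shows "(\<lambda>x. c * b x) \<in> multipliers"
proof -
  from assms obtain B where "\<forall>x. \<bar>b x\<bar> \<le> B" by (auto simp: multipliers_def)
  then have "\<forall>x. \<bar>c * b x\<bar> \<le> \<bar>c\<bar> * B" by (simp add: abs_mult mult_left_mono)
  moreover have "approximable (\<lambda>x. of_real ((c * b x) * p x))" if "real_polynomial_function p" for p :: "'a \<Rightarrow> real"
    using assms that approximable_cmult[of "\<lambda>x. of_real (b x * p x)" "of_real c"]
    by (simp add: multipliers_def mult.assoc)
  ultimately show ?thesis using assms by (auto simp: multipliers_def)
qed

lemma multipliers_sum:
  "(\<And>i. i \<in> F \<Longrightarrow> b i \<in> multipliers) \<Longrightarrow> (\<lambda>x. \<Sum>i\<in>F. b i x) \<in> multipliers"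
proof (induction F rule: infinite_finite_induct)
  case (insert i F)
  then show ?case using multipliers_add[of "b i" "\<lambda>x. \<Sum>i\<in>F. b i x"] by simp
qed (use multipliers_const[of 0] in simp_all)

lemma polynomial_square_wt_integrable:
  "real_polynomial_function p \<Longrightarrow> integrable lebesgue (\<lambda>x. (c * \<bar>p x\<bar>)\<^sup>2 * wt x)"
  using integrable_mult_right[OF polynomial_wt_integrable[OF real_polynomial_function.intros(4)[of p p]], of "c\<^sup>2"]
  by (simp add: power_mult_distrib power2_abs power2_eq_square[of "p _"] mult.assoc)

lemma multipliers_limit:
  assumes b: "\<And>n. b n \<in> multipliers" and B: "\<And>n x. \<bar>b n x\<bar> \<le> B" and lim: "\<And>x. (\<lambda>n. b n x) \<longlonglongrightarrow> c x"
  shows "c \<in> multipliers"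
proof -
  have [measurable]: "b n \<in> borel_measurable borel" for n using b by (auto simp: multipliers_def)
  have meas: "c \<in> borel_measurable borel" using lim by (rule borel_measurable_LIMSEQ_real) simp
  have "\<bar>c x\<bar> \<le> B" for x
    using tendsto_rabs[OF lim[of x]] by (rule tendsto_upperbound) (auto simp: B)
  moreover have "approximable (\<lambda>x. of_real (c x * p x))" if p: "real_polynomial_function p" for p :: "'a \<Rightarrow> real"
  proof (rule approximable_limit)
    show "approximable (\<lambda>x. of_real (b n x * p x))" for n using b p by (auto simp: multipliers_def)
    show "AE x in lebesgue. (\<lambda>n. complex_of_real (b n x * p x)) \<longlonglongrightarrow> of_real (c x * p x)"
      by (intro AE_I2 tendsto_of_real tendsto_mult lim tendsto_const)
    show "(\<lambda>x. complex_of_real (c x * p x)) \<in> borel_measurable lebesgue"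
      using meas real_polynomial_measurable[OF p]
      by (intro measurable_completion borel_measurable_of_real borel_measurable_times) simp_all
    show "integrable lebesgue (\<lambda>x. (B * \<bar>p x\<bar>)\<^sup>2 * wt x)" by (rule polynomial_square_wt_integrable[OF p])
    show "norm (complex_of_real (b n x * p x)) \<le> B * \<bar>p x\<bar>" for n x
      using B[of n x] by (simp only: norm_of_real abs_mult mult_right_mono abs_ge_zero)
  qed
  ultimately show ?thesis using meas by (auto simp: multipliers_def)
qed

text \<open>The width is chosen such that the Taylor polynomials of the profile, which are bounded only by
  \<open>exp ((x \<bullet> e - y)^2 / 4)\<close>, are square integrable against \<^const>\<open>wt\<close>. Narrower Gaussians
  are obtained as powers.\<close>

definition gauss_profile :: "'a::euclidean_space \<Rightarrow> real \<Rightarrow> 'a \<Rightarrow> real" where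
  "gauss_profile e y x = exp (- ((x \<bullet> e - y)\<^sup>2 / 4))"

lemma gauss_profile_bounds: "0 < gauss_profile e y x" "gauss_profile e y x \<le> 1" by (auto simp: gauss_profile_def)

lemma gauss_profile_measurable [measurable]: "gauss_profile e y \<in> borel_measurable borel"
  unfolding gauss_profile_def[abs_def] by measurable

lemma exp_real_sums: "(\<lambda>n. x ^ n / fact n) sums exp (x :: real)"
  using exp_converges[of x] by (simp add: divide_inverse mult.commute)

text \<open>The product is the dominated limit of products with the Taylor polynomials of the profile, and the
  latter only change the polynomial factor.\<close>

lemma multipliers_gauss_profile:
  assumes b: "b \<in> multipliers" and e: "e \<in> Basis"
  shows "(\<lambda>x. b x * gauss_profile e y x) \<in> multipliers"
proof -
  obtain B where B: "\<And>x. \<bar>b x\<bar> \<le> B" using b by (auto simp: multipliers_def)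
  have B0: "B \<ge> 0" using B[of 0] by simp
  have [measurable]: "b \<in> borel_measurable borel" using b by (auto simp: multipliers_def)
  have "\<bar>b x * gauss_profile e y x\<bar> \<le> B" for x
    using mult_mono[OF B[of x] gauss_profile_bounds(2)[of e y x]] gauss_profile_bounds[of e y x] B0
    by (simp add: abs_mult)
  moreover have "approximable (\<lambda>x. of_real ((b x * gauss_profile e y x) * p x))" if p: "real_polynomial_function p" for p :: "'a \<Rightarrow> real"
  proof (rule approximable_limit)
    let ?z = "\<lambda>x. - ((x \<bullet> e - y)\<^sup>2 / 4)"
    let ?t = "\<lambda>n x. (\<Sum>j<n. ?z x ^ j / fact j)"
    have zp: "real_polynomial_function ?z"
      by (intro real_polynomial_function_minus real_polynomial_function_divide real_polynomial_function_power
          real_polynomial_function_diff real_polynomial_inner real_polynomial_function.intros(2))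
    have tp: "real_polynomial_function (?t n)" for n
      by (intro real_polynomial_function_sum real_polynomial_function_divide real_polynomial_function_power zp) auto
    show "approximable (\<lambda>x. of_real (b x * (p x * ?t n x)))" for n
      using b real_polynomial_function.intros(4)[OF p tp[of n]] unfolding multipliers_def by blast
    have conv: "(\<lambda>n. ?t n x) \<longlonglongrightarrow> gauss_profile e y x" for x
      using exp_real_sums[of "?z x"] unfolding sums_def gauss_profile_def .
    show "AE x in lebesgue. (\<lambda>n. complex_of_real (b x * (p x * ?t n x))) \<longlonglongrightarrow> of_real ((b x * gauss_profile e y x) * p x)"
    proof (rule AE_I2)
      fix x
      have "(\<lambda>n. b x * (p x * ?t n x)) \<longlonglongrightarrow> b x * (p x * gauss_profile e y x)"
        by (intro tendsto_mult tendsto_const conv)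
      then have "(\<lambda>n. b x * (p x * ?t n x)) \<longlonglongrightarrow> (b x * gauss_profile e y x) * p x" by (simp only: mult_ac)
      then show "(\<lambda>n. complex_of_real (b x * (p x * ?t n x))) \<longlonglongrightarrow> of_real ((b x * gauss_profile e y x) * p x)"
        by (rule tendsto_of_real)
    qed
    show "(\<lambda>x. complex_of_real ((b x * gauss_profile e y x) * p x)) \<in> borel_measurable lebesgue"
      using real_polynomial_measurable[OF p]
      by (intro measurable_completion borel_measurable_of_real borel_measurable_times) simp_all
    \<comment> \<open>Majorant of the partial sums, from \<open>(x \<bullet> e - y)^2 \<le> 2 (x \<bullet> e)^2 + 2 y^2\<close>. Apart from \<open>p\<close>,
      its square grows like \<open>exp (\<bar>x\<bar>^2)\<close>, half of what the weight compensates.\<close>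
    let ?G = "\<lambda>x. B * exp (y\<^sup>2 / 2) * \<bar>p x\<bar> * exp ((norm x)\<^sup>2 / 2)"
    have "(?G x)\<^sup>2 * wt x = (B * exp (y\<^sup>2 / 2))\<^sup>2 * (p x * p x * exp (- 1 * (norm x)\<^sup>2))" for x
    proof -
      have "(exp ((norm x)\<^sup>2 / 2))\<^sup>2 * wt x = exp (- 1 * (norm x)\<^sup>2)"
        by (simp add: wt_def flip: exp_add exp_double)
      moreover have "(?G x)\<^sup>2 * wt x = (B * exp (y\<^sup>2 / 2))\<^sup>2 * (\<bar>p x\<bar>\<^sup>2 * ((exp ((norm x)\<^sup>2 / 2))\<^sup>2 * wt x))"
        by (simp only: power_mult_distrib mult_ac)
      ultimately show ?thesis by (simp only: power2_abs power2_eq_square[of "p x"])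
    qed
    then show "integrable lebesgue (\<lambda>x. (?G x)\<^sup>2 * wt x)"
      using polynomial_gaussian_integrable[OF real_polynomial_function.intros(4)[OF p p], of 1] by simp
    show "norm (complex_of_real (b x * (p x * ?t n x))) \<le> ?G x" for n x
    proof -
      have "\<bar>?t n x\<bar> \<le> (\<Sum>j<n. \<bar>?z x\<bar> ^ j / fact j)"
        by (rule order_trans[OF sum_abs]) (simp add: power_abs)
      also have "\<dots> \<le> (\<Sum>j. \<bar>?z x\<bar> ^ j / fact j)"
        using exp_real_sums[of "\<bar>?z x\<bar>"] by (intro sum_le_suminf) (auto dest: sums_summable)
      also have "\<dots> = exp \<bar>?z x\<bar>"
        using exp_real_sums[of "\<bar>?z x\<bar>"] by (rule sums_unique[symmetric])
      also have "\<dots> \<le> exp (y\<^sup>2 / 2 + (norm x)\<^sup>2 / 2)"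
      proof -
        have "(x \<bullet> e)\<^sup>2 \<le> (norm x)\<^sup>2"
          using Basis_le_norm[OF e, of x] abs_le_square_iff[of "x \<bullet> e" "norm x"] by (simp only: abs_norm_cancel)
        moreover have "(x \<bullet> e - y)\<^sup>2 \<le> 2 * (x \<bullet> e)\<^sup>2 + 2 * y\<^sup>2"
          using sum_squares_bound[of "x \<bullet> e" "- y"] by (simp add: power2_diff)
        ultimately show ?thesis by simp
      qed
      finally have t: "\<bar>?t n x\<bar> \<le> exp (y\<^sup>2 / 2) * exp ((norm x)\<^sup>2 / 2)" by (simp add: exp_add)
      have "\<bar>b x\<bar> * (\<bar>p x\<bar> * \<bar>?t n x\<bar>) \<le> B * (\<bar>p x\<bar> * (exp (y\<^sup>2 / 2) * exp ((norm x)\<^sup>2 / 2)))"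
        by (intro mult_mono B t mult_left_mono mult_nonneg_nonneg B0) auto
      then show ?thesis by (simp only: norm_of_real abs_mult mult_ac)
    qed
  qed
  ultimately show ?thesis by (auto simp: multipliers_def)
qed

lemma multipliers_gauss_profile_power:
  assumes b: "b \<in> multipliers" and e: "e \<in> Basis"
  shows "(\<lambda>x. b x * gauss_profile e y x ^ n) \<in> multipliers"
proof (induction n)
  case (Suc n)
  from multipliers_gauss_profile[OF this e, of y] show ?case by (simp add: mult_ac)
qed (use b in simp)

text \<open>Weierstrass approximation of \<open>g\<close> on the interval in which the profile takes its values.\<close>

lemma multipliers_continuous_gauss_profile:
  assumes b: "b \<in> multipliers" and e: "e \<in> Basis" and g: "continuous_on {0..1} g"
  shows "(\<lambda>x. b x * g (gauss_profile e y x)) \<in> multipliers"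
proof -
  obtain B where B: "\<And>x. \<bar>b x\<bar> \<le> B" using b by (auto simp: multipliers_def)
  have B0: "B \<ge> 0" using B[of 0] by simp
  from compact_imp_bounded[OF compact_continuous_image[OF g compact_Icc]]
  obtain C where C': "\<forall>z\<in>g ` {0..1}. norm z \<le> C" unfolding bounded_iff ..
  have C: "\<bar>g t\<bar> \<le> C" if "t \<in> {0..1}" for t using bspec[OF C' imageI[OF that]] by simp
  have "\<exists>P. real_polynomial_function P \<and> (\<forall>t\<in>{0..1}. \<bar>g t - P t\<bar> < 1 / real (Suc n))" for n
  proof -
    have "1 / real (Suc n) > 0" by simp
    from Stone_Weierstrass_real_polynomial_function[OF compact_Icc g this]
    obtain P where "real_polynomial_function P" "\<And>t. t \<in> {0..1} \<Longrightarrow> \<bar>g t - P t\<bar> < 1 / real (Suc n)"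
      by metis
    then show ?thesis by (intro exI[of _ P]) simp
  qed
  then obtain P where P: "\<And>n. real_polynomial_function (P n)" "\<And>n t. t \<in> {0..1} \<Longrightarrow> \<bar>g t - P n t\<bar> < 1 / real (Suc n)"
    by metis
  have t: "gauss_profile e y x \<in> {0..1}" for x using gauss_profile_bounds[of e y x] by simp
  have "(\<lambda>x. b x * P n (gauss_profile e y x)) \<in> multipliers" for n
  proof -
    obtain a m where "P n = (\<lambda>x. \<Sum>i\<le>m. a i * x ^ i)"
      using real_polynomial_function_imp_sum[OF P(1)] by blast
    then have "(\<lambda>x. b x * P n (gauss_profile e y x)) = (\<lambda>x. \<Sum>i\<le>m. a i * (b x * gauss_profile e y x ^ i))"
      by (simp add: sum_distrib_left mult_ac)
    moreover have "(\<lambda>x. \<Sum>i\<le>m. a i * (b x * gauss_profile e y x ^ i)) \<in> multipliers"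
      by (intro multipliers_sum multipliers_cmult multipliers_gauss_profile_power[OF b e])
    ultimately show ?thesis by simp
  qed
  then show ?thesis
  proof (rule multipliers_limit)
    show "\<bar>b x * P n (gauss_profile e y x)\<bar> \<le> B * (C + 1)" for n x
    proof -
      have "1 / real (Suc n) \<le> 1" by simp
      then have "\<bar>P n (gauss_profile e y x)\<bar> \<le> C + 1" using C[OF t[of x]] P(2)[OF t[of x], of n] by linarith
      then show ?thesis using B[of x] B0 by (simp add: abs_mult mult_mono)
    qed
    show "(\<lambda>n. b x * P n (gauss_profile e y x)) \<longlonglongrightarrow> b x * g (gauss_profile e y x)" for x
    proof (intro tendsto_mult tendsto_const)
      have "(\<lambda>n. g (gauss_profile e y x) - P n (gauss_profile e y x)) \<longlonglongrightarrow> 0"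
      proof (rule Lim_null_comparison)
        show "(\<lambda>n. 1 / real (Suc n)) \<longlonglongrightarrow> 0" using LIMSEQ_Suc[OF lim_const_over_n[of 1]] by simp
        show "\<forall>\<^sub>F n in sequentially. norm (g (gauss_profile e y x) - P n (gauss_profile e y x)) \<le> 1 / real (Suc n)"
          using P(2)[OF t[of x]] by (auto intro!: always_eventually less_imp_le)
      qed
      from tendsto_diff[OF tendsto_const[of "g (gauss_profile e y x)"] this] show "(\<lambda>n. P n (gauss_profile e y x)) \<longlonglongrightarrow> g (gauss_profile e y x)" by simp
    qed
  qed
qed

text \<open>Multiplying by two indicators one after the other is multiplying by the indicator of the
  intersection. The multiplier sets therefore form a sigma-algebra at once.\<close>

definition multiplier_sets :: "'a::euclidean_space set set" where
  "multiplier_sets = {S \<in> sets borel. \<forall>b\<in>multipliers. (\<lambda>x. b x * indicator S x) \<in> multipliers}"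

text \<open>A strip is a superlevel set of a profile, so its indicator is a limit of continuous functions of
  the profile.\<close>

lemma multiplier_sets_strip:
  assumes e: "e \<in> Basis"
  shows "{x. \<bar>x \<bullet> e - y\<bar> < r} \<in> multiplier_sets"
proof (cases "r > 0")
  case False
  then have "{x. \<bar>x \<bullet> e - y\<bar> < r} = {}" by auto
  moreover have "{} \<in> multiplier_sets" using multipliers_const[of 0] by (auto simp: multiplier_sets_def)
  ultimately show ?thesis by simp
next
  case True
  let ?S = "{x. \<bar>x \<bullet> e - y\<bar> < r}"
  \<comment> \<open>The value of the profile on the boundary of the strip.\<close>
  define \<theta> where "\<theta> = exp (- (r\<^sup>2 / 4))"
  have S: "x \<in> ?S \<longleftrightarrow> gauss_profile e y x > \<theta>" for x
  proof -
    have "x \<in> ?S \<longleftrightarrow> (x \<bullet> e - y)\<^sup>2 < r\<^sup>2"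
      using True abs_le_square_iff[of r "x \<bullet> e - y"] by auto
    then show ?thesis by (simp add: gauss_profile_def \<theta>_def)
  qed
  have "(\<lambda>x. b x * indicator ?S x) \<in> multipliers" if b: "b \<in> multipliers" for b
  proof -
    obtain B where B: "\<And>x. \<bar>b x\<bar> \<le> B" using b by (auto simp: multipliers_def)
    show ?thesis
    proof (rule multipliers_limit)
      define g where "g n t = min 1 (real n * max 0 (t - \<theta>))" for n t
      show "(\<lambda>x. b x * g n (gauss_profile e y x)) \<in> multipliers" for n
        by (rule multipliers_continuous_gauss_profile[OF b e]) (auto simp: g_def intro!: continuous_intros)
      show "\<bar>b x * g n (gauss_profile e y x)\<bar> \<le> B" for n x
      proof -
        have "\<bar>g n (gauss_profile e y x)\<bar> \<le> 1" by (simp add: g_def)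
        from mult_mono[OF B[of x] this] B[of x] show ?thesis by (simp add: abs_mult)
      qed
      show "(\<lambda>n. b x * g n (gauss_profile e y x)) \<longlonglongrightarrow> b x * indicator ?S x" for x
      proof (intro tendsto_mult tendsto_const)
        show "(\<lambda>n. g n (gauss_profile e y x)) \<longlonglongrightarrow> indicator ?S x"
        proof (cases "x \<in> ?S")
          case False
          then have "g n (gauss_profile e y x) = 0" for n using S[of x] by (simp add: g_def)
          then show ?thesis using False by simp
        next
          case True
          then have d: "gauss_profile e y x - \<theta> > 0" using S by simp
          obtain N :: nat where N: "1 / (gauss_profile e y x - \<theta>) \<le> real N" using real_arch_simple by blast
          have "g n (gauss_profile e y x) = 1" if "n \<ge> N" for n
          proof -
            have "1 \<le> real N * (gauss_profile e y x - \<theta>)" using N d by (simp add: field_simps)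
            also have "\<dots> \<le> real n * (gauss_profile e y x - \<theta>)" using that d by (intro mult_right_mono) auto
            finally show ?thesis using d by (simp add: g_def)
          qed
          then have "\<forall>\<^sub>F n in sequentially. g n (gauss_profile e y x) = 1" by (auto simp: eventually_sequentially)
          then show ?thesis using True by (simp add: tendsto_eventually)
        qed
      qed
    qed
  qed
  moreover have "?S \<in> sets borel" by measurable
  ultimately show ?thesis by (simp add: multiplier_sets_def)
qed

lemma multiplier_sets_Compl: "S \<in> multiplier_sets \<Longrightarrow> - S \<in> multiplier_sets"
proof -
  assume S: "S \<in> multiplier_sets"
  have "(\<lambda>x. b x * indicator (- S) x) \<in> multipliers" if "b \<in> multipliers" for b
  proof -
    have "(\<lambda>x. b x + (- 1) * (b x * indicator S x)) \<in> multipliers"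
      using S that by (intro multipliers_add multipliers_cmult) (auto simp: multiplier_sets_def)
    also have "(\<lambda>x. b x + (- 1) * (b x * indicator S x)) = (\<lambda>x. b x * indicator (- S) x)"
      by (auto simp: indicator_def)
    finally show ?thesis .
  qed
  then show ?thesis using S by (auto simp: multiplier_sets_def borel_comp)
qed

lemma multiplier_sets_INT:
  assumes "\<And>n::nat. S n \<in> multiplier_sets"
  shows "(\<Inter>n. S n) \<in> multiplier_sets"
proof -
  have "(\<lambda>x. b x * indicator (\<Inter>n. S n) x) \<in> multipliers" if b: "b \<in> multipliers" for b
  proof -
    obtain B where B: "\<And>x. \<bar>b x\<bar> \<le> B" using b by (auto simp: multipliers_def)
    show ?thesis
    proof (rule multipliers_limit)
      show "(\<lambda>x. b x * indicator (\<Inter>i<n. S i) x) \<in> multipliers" for n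
      proof (induction n)
        case (Suc n)
        then have "(\<lambda>x. (b x * indicator (\<Inter>i<n. S i) x) * indicator (S n) x) \<in> multipliers"
          using assms[of n] by (simp add: multiplier_sets_def)
        also have "(\<lambda>x. (b x * indicator (\<Inter>i<n. S i) x) * indicator (S n) x) = (\<lambda>x. b x * indicator (\<Inter>i<Suc n. S i) x)"
          by (rule ext) (auto simp: indicator_def lessThan_Suc)
        finally show ?case .
      qed (use b in simp)
      show "\<bar>b x * indicator (\<Inter>i<n. S i) x\<bar> \<le> B" for n x
        using B[of x] by (auto simp: indicator_def)
      show "(\<lambda>n. b x * indicator (\<Inter>i<n. S i) x) \<longlonglongrightarrow> b x * indicator (\<Inter>n. S n) x" for x
      proof (intro tendsto_mult tendsto_const)
        show "(\<lambda>n. indicator (\<Inter>i<n. S i) x :: real) \<longlonglongrightarrow> indicator (\<Inter>n. S n) x"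
        proof (cases "\<forall>n. x \<in> S n")
          case False
          then obtain N where "x \<notin> S N" by blast
          then have "\<forall>\<^sub>F n in sequentially. indicator (\<Inter>i<n. S i) x = (0::real)"
            by (auto simp: eventually_sequentially indicator_def intro!: exI[of _ "Suc N"])
          then show ?thesis using False by (simp add: tendsto_eventually)
        qed simp
      qed
    qed
  qed
  then show ?thesis using assms by (auto simp: multiplier_sets_def)
qed

lemma multiplier_sets_UN:
  assumes "\<And>n::nat. S n \<in> multiplier_sets"
  shows "(\<Union>n. S n) \<in> multiplier_sets"
proof -
  have "- (\<Inter>n. - S n) \<in> multiplier_sets"
    by (intro multiplier_sets_Compl multiplier_sets_INT assms)
  then show ?thesis by simp
qed

lemma multiplier_sets_halfspace:
  assumes e: "e \<in> Basis"
  shows "{x. x \<bullet> e < a} \<in> multiplier_sets"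
proof -
  have "{x. x \<bullet> e < a} = (\<Union>n::nat. {x. \<bar>x \<bullet> e - (a - real n)\<bar> < real n})"
  proof (intro subset_antisym subsetI)
    fix x assume x: "x \<in> {x. x \<bullet> e < a}"
    obtain n :: nat where "real n > a - x \<bullet> e" using reals_Archimedean2 by blast
    then show "x \<in> (\<Union>n::nat. {x. \<bar>x \<bullet> e - (a - real n)\<bar> < real n})"
      using x by (intro UN_I[of n]) auto
  qed auto
  then show ?thesis using multiplier_sets_UN[OF multiplier_sets_strip[OF e]] by simp
qed

lemma borel_subset_multiplier_sets:
  assumes "S \<in> sets (borel :: 'a::euclidean_space measure)"
  shows "S \<in> multiplier_sets"
proof -
  let ?H = "(\<lambda>(a, i). {x::'a. x \<bullet> i < a}) ` (UNIV \<times> Basis)"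
  have "S \<in> sigma_sets UNIV ?H"
    using assms by (subst (asm) borel_eq_halfspace_less) simp
  then show ?thesis
  proof induction
    case (Basic a)
    then show ?case by (auto intro: multiplier_sets_halfspace)
  next
    case Empty
    then show ?case using multiplier_sets_strip[of "SOME b. b \<in> Basis" 0 0] by (simp add: SOME_Basis)
  next
    case (Compl a)
    then show ?case using multiplier_sets_Compl by (simp add: Compl_eq_Diff_UNIV[symmetric])
  next
    case (Union a)
    then show ?case by (intro multiplier_sets_UN)
  qed
qed

lemma approximable_indicator:
  assumes "S \<in> sets (lebesgue :: 'a::euclidean_space measure)"
  shows "approximable (\<lambda>x. of_real (indicator S x))"
proof -
  have "(indicator S :: 'a \<Rightarrow> real) \<in> borel_measurable (completion lborel)" using assms by simp
  from completion_ex_borel_measurable_real[OF this] obtain g :: "'a \<Rightarrow> real" where g: "g \<in> borel_measurable lborel"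
    "AE x in lborel. indicator S x = g x" by blast
  define T where "T = {x. g x = 1}"
  have T: "T \<in> sets borel" unfolding T_def using g(1) by measurable
  have "AE x in lebesgue. indicator S x = g x" using g(2) by (rule AE_completion)
  then have ae: "AE x in lebesgue. (indicator T x :: real) = indicator S x"
  proof (rule eventually_mono)
    fix x :: 'a assume "indicator S x = g x"
    then show "(indicator T x :: real) = indicator S x" by (cases "x \<in> S") (simp_all add: T_def)
  qed
  have "(\<lambda>x. 1 * indicator T x) \<in> multipliers"
  proof -
    have "\<forall>b\<in>multipliers. (\<lambda>x. b x * indicator T x) \<in> multipliers"
      using borel_subset_multiplier_sets[OF T] by (simp add: multiplier_sets_def)
    from bspec[OF this multipliers_const[of 1]] show ?thesis .
  qed
  then have "approximable (\<lambda>x. of_real (1 * indicator T x * 1))"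
    using real_polynomial_function.intros(2)[of 1] unfolding multipliers_def by blast
  then have aT: "approximable (\<lambda>x. of_real (indicator T x))" by simp
  show ?thesis
  proof (rule approximable_limit)
    show "approximable (\<lambda>x. of_real (indicator T x))" by (rule aT)
    show "AE x in lebesgue. (\<lambda>n::nat. complex_of_real (indicator T x)) \<longlonglongrightarrow> of_real (indicator S x)"
      using ae by (rule eventually_mono) simp
    show "(\<lambda>x. complex_of_real (indicator S x)) \<in> borel_measurable lebesgue" using assms by measurable
    show "integrable lebesgue (\<lambda>x. 1\<^sup>2 * wt x)"
      using polynomial_wt_integrable[OF real_polynomial_function.intros(2)[of 1]] by simp
    show "norm (complex_of_real (indicator T x)) \<le> 1" for x by (simp add: indicator_def)
  qed
qed

text \<open>All indicators are approximable, hence all simple functions, and these converge dominatedly.\<close>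

theorem L2_wt_approximable:
  assumes u: "u \<in> L2_wt"
  shows "approximable u"
proof -
  have meas: "u \<in> borel_measurable lebesgue" using u by (simp add: L2_wt_def)
  obtain s where s: "\<And>i. simple_function lebesgue (s i)" "\<And>x. (\<lambda>i. s i x) \<longlonglongrightarrow> u x"
    "\<And>i x. dist (s i x) 0 \<le> 2 * dist (u x) 0"
    using borel_measurable_implies_sequence_metric[OF meas, of 0] by auto
  show ?thesis
  proof (rule approximable_limit[OF _ _ meas])
    show "approximable (s i)" for i
    proof -
      have "s i = (\<lambda>x. \<Sum>y\<in>range (s i). y * of_real (indicator (s i -` {y}) x))"
      proof
        fix x
        have "s i x = (\<Sum>y\<in>range (s i). if y = s i x then y else 0)"
          using simple_functionD(1)[OF s(1), of i] by simp
        also have "\<dots> = (\<Sum>y\<in>range (s i). y * of_real (indicator (s i -` {y}) x))"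
          by (intro sum.cong) (auto simp: indicator_def)
        finally show "s i x = (\<Sum>y\<in>range (s i). y * of_real (indicator (s i -` {y}) x))" .
      qed
      moreover have "approximable (\<lambda>x. \<Sum>y\<in>range (s i). y * of_real (indicator (s i -` {y}) x))"
        using simple_functionD(2)[OF s(1), of i]
        by (intro approximable_sum approximable_cmult approximable_indicator) simp
      ultimately show ?thesis by simp
    qed
    show "AE x in lebesgue. (\<lambda>i. s i x) \<longlonglongrightarrow> u x" by (simp add: s)
    show "integrable lebesgue (\<lambda>x. (2 * norm (u x))\<^sup>2 * wt x)"
      using integrable_mult_right[OF L2_wt_norm_integrable[OF u], of 4] by (simp add: power_mult_distrib mult.assoc)
    show "norm (s i x) \<le> 2 * norm (u x)" for i x using s(3)[of i x] by simp
  qed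
qed

definition multi_indices_below :: "nat \<Rightarrow> 'a::euclidean_space multi_index set" where
  "multi_indices_below L = {\<alpha>\<in>multi_indices. sum \<alpha> Basis < L}"

lemma finite_multi_indices_below: "finite (multi_indices_below L :: 'a::euclidean_space multi_index set)"
proof (rule finite_subset)
  show "finite {\<alpha>::'a \<Rightarrow> nat. \<forall>b. (b \<in> Basis \<longrightarrow> \<alpha> b \<in> {..<L}) \<and> (b \<notin> Basis \<longrightarrow> \<alpha> b = 0)}"
    by (rule finite_set_of_finite_funs) auto
  show "multi_indices_below L \<subseteq> {\<alpha>::'a \<Rightarrow> nat. \<forall>b. (b \<in> Basis \<longrightarrow> \<alpha> b \<in> {..<L}) \<and> (b \<notin> Basis \<longrightarrow> \<alpha> b = 0)}"
  proof
    fix \<alpha> :: "'a \<Rightarrow> nat" assume \<alpha>: "\<alpha> \<in> multi_indices_below L"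
    have "\<alpha> b < L" if "b \<in> Basis" for b
      using \<alpha> member_le_sum[OF that, of \<alpha>] by (simp add: multi_indices_below_def)
    then show "\<alpha> \<in> {\<alpha>. \<forall>b. (b \<in> Basis \<longrightarrow> \<alpha> b \<in> {..<L}) \<and> (b \<notin> Basis \<longrightarrow> \<alpha> b = 0)}"
      using \<alpha> by (simp add: multi_indices_below_def multi_indices_def)
  qed
qed

text \<open>Demanding an expansion for every large bound \<open>L\<close>, rather than for one finite index set, gives any
  finite number of polynomials expansions over a common index set.\<close>

definition Hermite_span :: "('a::euclidean_space \<Rightarrow> real) \<Rightarrow> bool" where
  "Hermite_span p \<longleftrightarrow> (\<exists>L0. \<forall>L\<ge>L0. \<exists>d. p = (\<lambda>x. \<Sum>\<alpha>\<in>multi_indices_below L. d \<alpha> * Herm \<alpha> x))"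

lemma Hermite_span_add:
  assumes "Hermite_span p" "Hermite_span q"
  shows "Hermite_span (\<lambda>x. p x + q x)"
proof -
  obtain L1 L2 where L: "\<forall>L\<ge>L1. \<exists>d. p = (\<lambda>x. \<Sum>\<alpha>\<in>multi_indices_below L. d \<alpha> * Herm \<alpha> x)"
    "\<forall>L\<ge>L2. \<exists>d. q = (\<lambda>x. \<Sum>\<alpha>\<in>multi_indices_below L. d \<alpha> * Herm \<alpha> x)"
    using assms unfolding Hermite_span_def by blast
  have "\<exists>d. (\<lambda>x. p x + q x) = (\<lambda>x. \<Sum>\<alpha>\<in>multi_indices_below L. d \<alpha> * Herm \<alpha> x)" if "L \<ge> max L1 L2" for L
  proof -
    from that have L': "L \<ge> L1" "L \<ge> L2" by simp_all
    from L(1)[rule_format, OF L'(1)] L(2)[rule_format, OF L'(2)] obtain d d' where "p = (\<lambda>x. \<Sum>\<alpha>\<in>multi_indices_below L. d \<alpha> * Herm \<alpha> x)"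
      "q = (\<lambda>x. \<Sum>\<alpha>\<in>multi_indices_below L. d' \<alpha> * Herm \<alpha> x)" by (elim exE)
    then show ?thesis
      by (intro exI[of _ "\<lambda>\<alpha>. d \<alpha> + d' \<alpha>"]) (simp add: distrib_right sum.distrib)
  qed
  then show ?thesis unfolding Hermite_span_def by blast
qed

lemma Hermite_span_cmult:
  assumes "Hermite_span p"
  shows "Hermite_span (\<lambda>x. c * p x)"
proof -
  obtain L1 where L: "\<forall>L\<ge>L1. \<exists>d. p = (\<lambda>x. \<Sum>\<alpha>\<in>multi_indices_below L. d \<alpha> * Herm \<alpha> x)"
    using assms unfolding Hermite_span_def by blast
  have "\<exists>d. (\<lambda>x. c * p x) = (\<lambda>x. \<Sum>\<alpha>\<in>multi_indices_below L. d \<alpha> * Herm \<alpha> x)" if "L \<ge> L1" for L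
  proof -
    from L[rule_format, OF that] obtain d where "p = (\<lambda>x. \<Sum>\<alpha>\<in>multi_indices_below L. d \<alpha> * Herm \<alpha> x)" ..
    then show ?thesis
      by (intro exI[of _ "\<lambda>\<alpha>. c * d \<alpha>"]) (simp add: sum_distrib_left mult.assoc)
  qed
  then show ?thesis unfolding Hermite_span_def by blast
qed

lemma Hermite_span_zero: "Hermite_span (\<lambda>x. 0)"
  unfolding Hermite_span_def by (auto intro!: exI[of _ "\<lambda>_. 0"])

lemma Hermite_span_sum:
  "(\<And>i. i \<in> F \<Longrightarrow> Hermite_span (p i)) \<Longrightarrow> Hermite_span (\<lambda>x. \<Sum>i\<in>F. p i x)"
proof (induction F rule: infinite_finite_induct)
  case (insert i F)
  then show ?case using Hermite_span_add[of "p i" "\<lambda>x. \<Sum>i\<in>F. p i x"] by simp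
qed (simp_all add: Hermite_span_zero)

lemma Hermite_span_Herm:
  assumes "\<alpha> \<in> multi_indices"
  shows "Hermite_span (Herm \<alpha>)"
proof -
  have "\<exists>d. Herm \<alpha> = (\<lambda>x. \<Sum>\<beta>\<in>multi_indices_below L. d \<beta> * Herm \<beta> x)" if "L \<ge> Suc (sum \<alpha> Basis)" for L
  proof -
    have "\<alpha> \<in> multi_indices_below L" using assms that by (simp add: multi_indices_below_def)
    then show ?thesis
      by (intro exI[of _ "\<lambda>\<beta>. if \<beta> = \<alpha> then 1 else 0"] ext)
        (simp add: finite_multi_indices_below if_distrib[of "\<lambda>t. t * _"] cong: if_cong)
  qed
  then show ?thesis unfolding Hermite_span_def by blast
qed

lemma Hermite_span_inner:
  assumes "Hermite_span p" "b \<in> Basis"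
  shows "Hermite_span (\<lambda>x. (x \<bullet> b) * p x)"
proof -
  obtain L d where p: "p = (\<lambda>x. \<Sum>\<alpha>\<in>multi_indices_below L. d \<alpha> * Herm \<alpha> x)"
    using assms(1) unfolding Hermite_span_def by blast
  have "(\<lambda>x. (x \<bullet> b) * p x) = (\<lambda>x. \<Sum>\<alpha>\<in>multi_indices_below L. d \<alpha> * ((1/4) * Herm (up b \<alpha>) x + real (\<alpha> b) * Herm (dn b \<alpha>) x))"
    unfolding p sum_distrib_left
    by (intro ext sum.cong refl) (simp add: Herm_recurrence[OF assms(2)] field_simps)
  moreover have "Hermite_span (\<lambda>x. \<Sum>\<alpha>\<in>multi_indices_below L. d \<alpha> * ((1/4) * Herm (up b \<alpha>) x + real (\<alpha> b) * Herm (dn b \<alpha>) x))"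
    using assms(2)
    by (intro Hermite_span_sum Hermite_span_cmult Hermite_span_add Hermite_span_Herm multi_indices_up multi_indices_dn) (auto simp: multi_indices_below_def)
  ultimately show ?thesis by simp
qed

lemma Hermite_span_polynomial_mult:
  assumes "real_polynomial_function p" "Hermite_span q"
  shows "Hermite_span (\<lambda>x. p x * q x)"
  using assms
proof (induction arbitrary: q)
  case (linear f)
  have f: "f x = (\<Sum>b\<in>Basis. f b * (x \<bullet> b))" for x
  proof -
    have "f x = f (\<Sum>b\<in>Basis. (x \<bullet> b) *\<^sub>R b)" by (simp add: euclidean_representation)
    also have "\<dots> = (\<Sum>b\<in>Basis. f ((x \<bullet> b) *\<^sub>R b))"
      by (rule linear_sum[OF bounded_linear.linear[OF linear(1)]])
    also have "\<dots> = (\<Sum>b\<in>Basis. f b * (x \<bullet> b))"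
      by (intro sum.cong refl) (simp add: linear_cmul[OF bounded_linear.linear[OF linear(1)]] mult.commute)
    finally show ?thesis .
  qed
  have "(\<lambda>x. f x * q x) = (\<lambda>x. \<Sum>b\<in>Basis. f b * ((x \<bullet> b) * q x))"
    by (rule ext, subst f) (simp add: sum_distrib_right mult.assoc)
  moreover have "Hermite_span (\<lambda>x. \<Sum>b\<in>Basis. f b * ((x \<bullet> b) * q x))"
    by (intro Hermite_span_sum Hermite_span_cmult Hermite_span_inner linear)
  ultimately show ?case by simp
next
  case (const c)
  then show ?case by (rule Hermite_span_cmult)
next
  case (add f g)
  then show ?case by (simp add: distrib_right Hermite_span_add)
next
  case (mult f g)
  then show ?case by (simp add: mult.assoc)
qed

lemma Hermite_span_polynomial:
  assumes "real_polynomial_function (p :: 'a::euclidean_space \<Rightarrow> real)"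
  shows "Hermite_span p"
proof -
  have "Hermite_span (Herm (\<lambda>_::'a. 0))" by (rule Hermite_span_Herm) (simp add: multi_indices_def)
  from Hermite_span_polynomial_mult[OF assms this] show ?thesis by (simp add: Herm_0)
qed

text \<open>An expansion of an approximating polynomial is a competitor for the best approximation, so the
  defect in Bessel's inequality tends to 0.\<close>

theorem Hermite_Parseval:
  assumes u: "u \<in> L2_wt"
  shows "(\<lambda>L. \<Sum>\<alpha>\<in>multi_indices_below L. (norm (herm_coeff u \<alpha>))\<^sup>2 / Herm_norm2 \<alpha>)
    \<longlonglongrightarrow> (\<integral>x. (norm (u x))\<^sup>2 * wt x \<partial>lebesgue)" (is "?s \<longlonglongrightarrow> ?I")
proof (rule LIMSEQ_I)
  fix e :: real assume "e > 0"
  then obtain p q where pq: "real_polynomial_function p" "real_polynomial_function q"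
    "(\<integral>x. (norm (u x - Complex (p x) (q x)))\<^sup>2 * wt x \<partial>lebesgue) < e"
    using L2_wt_approximable[OF u] unfolding approximable_def by blast
  obtain L1 L2 where L: "\<forall>L\<ge>L1. \<exists>d. p = (\<lambda>x. \<Sum>\<alpha>\<in>multi_indices_below L. d \<alpha> * Herm \<alpha> x)"
    "\<forall>L\<ge>L2. \<exists>d. q = (\<lambda>x. \<Sum>\<alpha>\<in>multi_indices_below L. d \<alpha> * Herm \<alpha> x)"
    using pq(1,2)[THEN Hermite_span_polynomial] unfolding Hermite_span_def by blast
  have "norm (?s L - ?I) < e" if "L \<ge> max L1 L2" for L
  proof -
    from that have L': "L \<ge> L1" "L \<ge> L2" by simp_all
    from L(1)[rule_format, OF L'(1)] L(2)[rule_format, OF L'(2)] obtain d d' where d: "p = (\<lambda>x. \<Sum>\<alpha>\<in>multi_indices_below L. d \<alpha> * Herm \<alpha> x)"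
      "q = (\<lambda>x. \<Sum>\<alpha>\<in>multi_indices_below L. d' \<alpha> * Herm \<alpha> x)" by (elim exE)
    have "Complex (p x) (q x) = (\<Sum>\<alpha>\<in>multi_indices_below L. Complex (d \<alpha>) (d' \<alpha>) * of_real (Herm \<alpha> x))" for x
      by (simp add: d complex_eq_iff)
    moreover have M: "multi_indices_below L \<subseteq> multi_indices" by (auto simp: multi_indices_below_def)
    ultimately have "?I - ?s L < e"
      using Hermite_best_approximation[OF u finite_multi_indices_below M, of "\<lambda>\<alpha>. Complex (d \<alpha>) (d' \<alpha>)"] pq(3) by simp
    moreover have "?s L \<le> ?I" by (rule Hermite_Bessel[OF u finite_multi_indices_below M])
    ultimately show ?thesis by simp
  qed
  then show "\<exists>no. \<forall>n\<ge>no. norm (?s n - ?I) < e" by blast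
qed

section \<open>Projection onto the symmetric tensors\<close>

lemma finite_length_eq: "finite {I::'a::finite list. length I = m}"
  using finite_lists_length_eq[of "UNIV :: 'a set" m] by simp

lemma sum_length_Suc:
  fixes F :: "'a::finite list \<Rightarrow> 'b::comm_monoid_add"
  shows "(\<Sum>J | length J = Suc m. F J) = (\<Sum>x\<in>UNIV. \<Sum>I | length I = m. F (x # I))"
proof -
  have "{J::'a list. length J = Suc m} = (\<lambda>(x, I). x # I) ` (UNIV \<times> {I. length I = m})"
    by (auto simp: length_Suc_conv image_iff)
  moreover have "inj_on (\<lambda>(x, I). x # I) (UNIV \<times> {I::'a list. length I = m})"
    by (auto simp: inj_on_def)
  ultimately have "(\<Sum>J | length J = Suc m. F J) = (\<Sum>(x, I)\<in>UNIV \<times> {I. length I = m}. F (x # I))"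
    by (simp add: sum.reindex case_prod_unfold)
  then show ?thesis by (simp add: sum.cartesian_product)
qed

text \<open>A list of length \<open>k + 1\<close> with a marked position amounts to the marked letter and the remaining list,
  together with one of \<open>k + 1\<close> places; the multiplicity counts the positions of a given letter. The
  induction splits off the first letter, which is either the marked one or belongs to the rest.\<close>

lemma sum_lists_remove_letter:
  fixes G :: "'a::finite \<Rightarrow> 'a multiset \<Rightarrow> complex"
  shows "(\<Sum>J | length J = Suc k. \<Sum>x\<in>UNIV. of_nat (count (mset J) x) * G x (mset J - {#x#}))
    = of_nat (Suc k) * (\<Sum>x\<in>UNIV. \<Sum>I | length I = k. G x (mset I))"
proof (induction k arbitrary: G)
  case 0
  have "of_nat (count {#y#} x) * G x ({#y#} - {#x#}) = (if x = y then G x {#} else 0)" for x y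
    by simp
  then show ?case by (simp add: sum_length_Suc)
next
  case (Suc k)
  have *: "of_nat (count (mset (y # I)) x) * G x (mset (y # I) - {#x#})
      = (if x = y then G x (mset I) else 0) + of_nat (count (mset I) x) * G x (add_mset y (mset I - {#x#}))" for x y I
    by (cases "x \<in># mset I") (auto simp: algebra_simps add_mset_remove_trivial_If count_eq_zero_iff[THEN iffD2] not_in_iff)
  have "(\<Sum>J | length J = Suc (Suc k). \<Sum>x\<in>UNIV. of_nat (count (mset J) x) * G x (mset J - {#x#}))
    = (\<Sum>y\<in>UNIV. \<Sum>I | length I = Suc k. G y (mset I))
      + (\<Sum>y\<in>UNIV. \<Sum>I | length I = Suc k. \<Sum>x\<in>UNIV. of_nat (count (mset I) x) * G x (add_mset y (mset I - {#x#})))"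
    unfolding sum_length_Suc[of _ "Suc k"] * sum.distrib by simp
  also have "(\<Sum>y\<in>UNIV. \<Sum>I | length I = Suc k. \<Sum>x\<in>UNIV. of_nat (count (mset I) x) * G x (add_mset y (mset I - {#x#})))
     = (\<Sum>y\<in>UNIV. of_nat (Suc k) * (\<Sum>x\<in>UNIV. \<Sum>I | length I = k. G x (add_mset y (mset I))))"
    by (intro sum.cong refl Suc.IH)
  also have "\<dots> = of_nat (Suc k) * (\<Sum>x\<in>UNIV. \<Sum>I | length I = Suc k. G x (mset I))"
    unfolding sum_length_Suc[of _ k] sum_distrib_left[symmetric]
    by (subst sum.swap) simp
  finally show ?case by (simp add: algebra_simps)
qed

definition perm_invariant :: "('a list \<Rightarrow> 'b) \<Rightarrow> bool" where
  "perm_invariant s \<longleftrightarrow> (\<forall>I J. mset I = mset J \<longrightarrow> s I = s J)"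

text \<open>A permutation invariant function of lists, as a function of the multiset of letters.\<close>

definition on_mset :: "('a list \<Rightarrow> 'b) \<Rightarrow> 'a multiset \<Rightarrow> 'b" where
  "on_mset s M = s (SOME I. mset I = M)"

lemma on_mset: "perm_invariant s \<Longrightarrow> on_mset s (mset I) = s I"
  unfolding perm_invariant_def on_mset_def by (metis (mono_tags, lifting) someI_ex)

lemma on_mset_add: "perm_invariant s \<Longrightarrow> on_mset s (add_mset x (mset I)) = s (x # I)"
  using on_mset[of s "x # I"] by simp

text \<open>The hypothesis says that \<open>g\<close> is the orthogonal projection of \<open>T\<close>, a tensor that is symmetric in all
  but its first slot, onto the symmetric tensors. This projection averages over the slot into which
  the first index is moved. In the inner product with \<open>T\<close>, one of the \<open>q + 2\<close> slots gives the
  squared norm of \<open>T\<close>, which is dropped, and each of the others gives the sum on the left.\<close>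

lemma symmetric_projection_lower_bound:
  fixes T :: "'a::finite \<Rightarrow> 'a list \<Rightarrow> complex"
  assumes T: "\<And>x. perm_invariant (T x)" and g: "perm_invariant g"
    and proj: "\<And>s. perm_invariant s \<Longrightarrow>
      (\<Sum>J | length J = Suc (Suc q). s J * cnj (g J)) = (\<Sum>x\<in>UNIV. \<Sum>I | length I = Suc q. s (x # I) * cnj (T x I))"
  shows "real (Suc q) / real (Suc (Suc q)) * Re (\<Sum>x\<in>UNIV. \<Sum>y\<in>UNIV. \<Sum>J | length J = q. T x (y # J) * cnj (T y (x # J)))
    \<le> (\<Sum>J | length J = Suc (Suc q). (norm (g J))\<^sup>2)"
proof -
  define c where "c = inverse (of_nat (Suc (Suc q)) :: complex)"
  define T' where "T' x = on_mset (T x)" for x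
  have T': "T' x (mset I) = T x I" "T' x (add_mset y (mset I)) = T x (y # I)" for x y I
    unfolding T'_def using on_mset[OF T] on_mset_add[OF T] by auto
  \<comment> \<open>The average of \<open>T\<close> over the slot that receives the first index, written with multiplicities so
    that its symmetry is evident. It is the projection of \<open>T\<close>, hence equal to \<open>g\<close>.\<close>
  define S where "S J = c * (\<Sum>x\<in>UNIV. of_nat (count (mset J) x) * T' x (mset J - {#x#}))" for J
  have S: "perm_invariant S" by (auto simp: perm_invariant_def S_def)
  have projS: "(\<Sum>J | length J = Suc (Suc q). s J * cnj (S J))
      = (\<Sum>x\<in>UNIV. \<Sum>I | length I = Suc q. s (x # I) * cnj (T x I))" if s: "perm_invariant s" for s
  proof -
    define G where "G x M = on_mset s (add_mset x M) * cnj (T' x M)" for x M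
    have "s J * cnj (S J) = cnj c * (\<Sum>x\<in>UNIV. of_nat (count (mset J) x) * G x (mset J - {#x#}))" for J
    proof -
      have "s J * (of_nat (count (mset J) x) * cnj (T' x (mset J - {#x#})))
          = of_nat (count (mset J) x) * G x (mset J - {#x#})" for x
        using on_mset[OF s, of J] by (cases "x \<in># mset J") (auto simp: G_def not_in_iff)
      note * = this
      have "s J * cnj (S J) = cnj c * (\<Sum>x\<in>UNIV. s J * (of_nat (count (mset J) x) * cnj (T' x (mset J - {#x#}))))"
        by (simp add: S_def sum_distrib_left mult.left_commute)
      then show ?thesis by (simp only: *)
    qed
    then have "(\<Sum>J | length J = Suc (Suc q). s J * cnj (S J)) =
       cnj c * (of_nat (Suc (Suc q)) * (\<Sum>x\<in>UNIV. \<Sum>I | length I = Suc q. G x (mset I)))"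
      by (simp only: sum_distrib_left[symmetric] sum_lists_remove_letter)
    also have "\<dots> = (\<Sum>x\<in>UNIV. \<Sum>I | length I = Suc q. G x (mset I))"
      by (simp add: c_def del: of_nat_Suc)
    finally show ?thesis by (simp add: G_def on_mset_add[OF s] T')
  qed
  have gS: "g J = S J" if "length J = Suc (Suc q)" for J
  proof -
    have inv: "perm_invariant (\<lambda>J. g J - S J)" using g S unfolding perm_invariant_def by metis
    have "(\<Sum>J | length J = Suc (Suc q). (g J - S J) * cnj (g J)) = (\<Sum>J | length J = Suc (Suc q). (g J - S J) * cnj (S J))"
      using proj[OF inv] projS[OF inv] by simp
    then have "(\<Sum>J | length J = Suc (Suc q). (g J - S J) * cnj (g J - S J)) = 0"
      by (simp add: right_diff_distrib sum_subtractf)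
    then have "complex_of_real (\<Sum>J | length J = Suc (Suc q). (norm (g J - S J))\<^sup>2) = 0"
      by (simp only: complex_norm_square of_real_sum)
    then have "(\<Sum>J | length J = Suc (Suc q). (norm (g J - S J))\<^sup>2) = 0" by (simp only: of_real_eq_0_iff)
    then have "(norm (g J - S J))\<^sup>2 = 0"
      using that by (subst (asm) sum_nonneg_eq_0_iff) (auto simp: finite_length_eq)
    then show ?thesis by simp
  qed
  let ?W = "\<Sum>x\<in>UNIV. \<Sum>y\<in>UNIV. \<Sum>J | length J = q. T x (y # J) * cnj (T y (x # J))"
  have "complex_of_real (\<Sum>J | length J = Suc (Suc q). (norm (g J))\<^sup>2) = (\<Sum>J | length J = Suc (Suc q). S J * cnj (S J))"
    by (simp only: complex_norm_square of_real_sum) (simp add: gS)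
  also have "\<dots> = (\<Sum>x\<in>UNIV. \<Sum>I | length I = Suc q. S (x # I) * cnj (T x I))" by (rule projS[OF S])
  also have "\<dots> = c * (\<Sum>x\<in>UNIV. \<Sum>I | length I = Suc q. T x I * cnj (T x I)) +
     c * (\<Sum>x\<in>UNIV. \<Sum>I | length I = Suc q. \<Sum>y\<in>UNIV. of_nat (count (mset I) y) *
        (T' y (add_mset x (mset I - {#y#})) * cnj (T' x (add_mset y (mset I - {#y#})))))"
  proof -
    have "S (x # I) * cnj (T x I) = c * (T x I * cnj (T x I)) + c * (\<Sum>y\<in>UNIV. of_nat (count (mset I) y) *
        (T' y (add_mset x (mset I - {#y#})) * cnj (T' x (add_mset y (mset I - {#y#})))))" for x I
    proof -
      have "of_nat (count (mset (x # I)) y) * T' y (mset (x # I) - {#y#}) * cnj (T x I) =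
          (if y = x then T x I * cnj (T x I) else 0) + of_nat (count (mset I) y) *
        (T' y (add_mset x (mset I - {#y#})) * cnj (T' x (add_mset y (mset I - {#y#}))))" for y
        by (cases "y \<in># mset I") (auto simp: T' algebra_simps not_in_iff)
      then have "(\<Sum>y\<in>UNIV. of_nat (count (mset (x # I)) y) * T' y (mset (x # I) - {#y#}) * cnj (T x I)) =
         T x I * cnj (T x I) + (\<Sum>y\<in>UNIV. of_nat (count (mset I) y) *
        (T' y (add_mset x (mset I - {#y#})) * cnj (T' x (add_mset y (mset I - {#y#})))))"
        by (simp add: sum.distrib)
      note * = this
      have "S (x # I) * cnj (T x I) = c * (\<Sum>y\<in>UNIV. of_nat (count (mset (x # I)) y) * T' y (mset (x # I) - {#y#}) * cnj (T x I))"
        by (simp only: S_def sum_distrib_right mult.assoc)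
      then show ?thesis by (simp only: * distrib_left)
    qed
    then show ?thesis by (simp only: sum.distrib sum_distrib_left)
  qed
  also have "(\<Sum>x\<in>UNIV. \<Sum>I | length I = Suc q. \<Sum>y\<in>UNIV. of_nat (count (mset I) y) *
        (T' y (add_mset x (mset I - {#y#})) * cnj (T' x (add_mset y (mset I - {#y#})))))
      = (\<Sum>x\<in>UNIV. of_nat (Suc q) * (\<Sum>y\<in>UNIV. \<Sum>J | length J = q. T y (x # J) * cnj (T x (y # J))))"
    by (intro sum.cong refl) (subst sum_lists_remove_letter, simp add: T')
  also have "\<dots> = of_nat (Suc q) * ?W"
    unfolding sum_distrib_left[symmetric] by (subst sum.swap) simp
  finally have F: "complex_of_real (\<Sum>J | length J = Suc (Suc q). (norm (g J))\<^sup>2) =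
      c * complex_of_real (\<Sum>x\<in>UNIV. \<Sum>I | length I = Suc q. (norm (T x I))\<^sup>2) + c * (of_nat (Suc q) * ?W)"
    unfolding of_real_sum complex_norm_square .
  have "(\<Sum>J | length J = Suc (Suc q). (norm (g J))\<^sup>2) =
      Re (c * complex_of_real (\<Sum>x\<in>UNIV. \<Sum>I | length I = Suc q. (norm (T x I))\<^sup>2) + c * (of_nat (Suc q) * ?W))"
    by (subst F[symmetric]) (rule Re_complex_of_real[symmetric])
  also have "c = complex_of_real (1 / real (Suc (Suc q)))"
    by (simp add: c_def divide_inverse)
  also have "Re (complex_of_real (1 / real (Suc (Suc q))) * complex_of_real (\<Sum>x\<in>UNIV. \<Sum>I | length I = Suc q. (norm (T x I))\<^sup>2)
      + complex_of_real (1 / real (Suc (Suc q))) * (of_nat (Suc q) * ?W))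
    = 1 / real (Suc (Suc q)) * (\<Sum>x\<in>UNIV. \<Sum>I | length I = Suc q. (norm (T x I))\<^sup>2)
      + real (Suc q) / real (Suc (Suc q)) * Re ?W"
  proof -
    have "of_nat (Suc q) * ?W = complex_of_real (real (Suc q)) * ?W" by simp
    moreover have "Re (of_real a * of_real b + of_real a * (of_real d * w)) = a * b + d * a * Re w" for a b d w
      by simp
    ultimately show ?thesis by (simp only: ) simp
  qed
  finally show ?thesis by (simp add: sum_nonneg)
qed

section \<open>Ladder operators on coefficient sequences\<close>

type_synonym 'a seq = "'a multi_index \<Rightarrow> complex"

text \<open>In the coefficients \<^const>\<open>herm_coeff\<close> the derivative along \<open>b\<close> is \<open>lower b\<close>, and its adjoint in the
  weighted space is \<open>raise b\<close>.\<close>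

definition lower :: "'a \<Rightarrow> 'a seq \<Rightarrow> 'a seq" where
  "lower b c \<alpha> = c (up b \<alpha>)"

definition raise :: "'a \<Rightarrow> 'a seq \<Rightarrow> 'a seq" where
  "raise b c \<alpha> = 4 * of_nat (\<alpha> b) * c (dn b \<alpha>)"

text \<open>The coefficients refer to Hermite polynomials that are not normalized, whence the division. The
  truncation keeps all sums finite.\<close>

definition seq_inner :: "nat \<Rightarrow> 'a::euclidean_space seq \<Rightarrow> 'a seq \<Rightarrow> complex" where
  "seq_inner L c d = (\<Sum>\<alpha>\<in>multi_indices_below L. c \<alpha> * cnj (d \<alpha>) / of_real (Herm_norm2 \<alpha>))"

text \<open>Reindexing by \<open>up b\<close> gives all indices of the larger truncation except those with \<open>\<alpha> b = 0\<close>, and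
  there \<open>raise b d\<close> vanishes. So adjointness is exact, at the cost of one degree.\<close>

lemma seq_inner_lower:
  assumes b: "b \<in> Basis"
  shows "seq_inner L (lower b c) d = seq_inner (Suc L) c (raise b d)"
proof -
  have deg: "sum (up b \<alpha>) Basis = Suc (sum \<alpha> Basis)" for \<alpha> :: "'a multi_index"
    using b by (simp add: sum.remove[of Basis b] up_def)
  have "seq_inner (Suc L) c (raise b d) = (\<Sum>\<alpha> | \<alpha> \<in> multi_indices_below (Suc L) \<and> \<alpha> b > 0. c \<alpha> * cnj (raise b d \<alpha>) / of_real (Herm_norm2 \<alpha>))"
    unfolding seq_inner_def by (rule sum.mono_neutral_right) (auto simp: finite_multi_indices_below raise_def)
  also have "\<dots> = (\<Sum>\<alpha>\<in>multi_indices_below L. c (up b \<alpha>) * cnj (raise b d (up b \<alpha>)) / of_real (Herm_norm2 (up b \<alpha>)))"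
  proof (rule sum.reindex_bij_witness[where j="dn b" and i="up b"])
    fix \<alpha> :: "'a multi_index" assume \<alpha>: "\<alpha> \<in> {\<alpha> \<in> multi_indices_below (Suc L). \<alpha> b > 0}"
    then show "up b (dn b \<alpha>) = \<alpha>" by (simp add: up_dn)
    then show "dn b \<alpha> \<in> multi_indices_below L"
      using \<alpha> deg[of "dn b \<alpha>"] by (auto simp: multi_indices_below_def multi_indices_dn)
    show "c (up b (dn b \<alpha>)) * cnj (raise b d (up b (dn b \<alpha>))) / of_real (Herm_norm2 (up b (dn b \<alpha>)))
        = c \<alpha> * cnj (raise b d \<alpha>) / of_real (Herm_norm2 \<alpha>)" using \<alpha> by (simp add: up_dn)
  next
    fix \<alpha> :: "'a multi_index" assume \<alpha>: "\<alpha> \<in> multi_indices_below L"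
    show "dn b (up b \<alpha>) = \<alpha>" by (rule dn_up)
    show "up b \<alpha> \<in> {\<alpha> \<in> multi_indices_below (Suc L). \<alpha> b > 0}"
      using \<alpha> deg[of \<alpha>] b by (auto simp: multi_indices_below_def multi_indices_up) (simp add: up_def)
  qed
  also have "\<dots> = seq_inner L (lower b c) d"
    unfolding seq_inner_def
  proof (intro sum.cong refl)
    fix \<alpha> :: "'a multi_index"
    have "complex_of_real (Herm_norm2 (up b \<alpha>)) = 4 * of_nat (Suc (\<alpha> b)) * of_real (Herm_norm2 \<alpha>)"
      by (simp add: Herm_norm2_up[OF b])
    moreover have "raise b d (up b \<alpha>) = 4 * of_nat (Suc (\<alpha> b)) * d \<alpha>"
      by (simp add: raise_def dn_up) (simp add: up_def)
    moreover have "4 * of_nat (Suc (\<alpha> b)) \<noteq> (0 :: complex)" by (simp del: of_nat_Suc)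
    ultimately show "c (up b \<alpha>) * cnj (raise b d (up b \<alpha>)) / of_real (Herm_norm2 (up b \<alpha>))
        = lower b c \<alpha> * cnj (d \<alpha>) / of_real (Herm_norm2 \<alpha>)"
      by (simp add: lower_def del: of_nat_Suc)
  qed
  finally show ?thesis by simp
qed

lemma seq_inner_cnj: "cnj (seq_inner L c d) = seq_inner L d c"
  by (simp add: seq_inner_def mult.commute)

lemma seq_inner_raise:
  assumes b: "b \<in> Basis"
  shows "seq_inner (Suc L) (raise b c) d = seq_inner L c (lower b d)"
proof -
  have "seq_inner (Suc L) (raise b c) d = cnj (seq_inner (Suc L) d (raise b c))" by (simp add: seq_inner_cnj)
  also have "\<dots> = cnj (seq_inner L (lower b d) c)" by (simp add: seq_inner_lower[OF b])
  finally show ?thesis by (simp add: seq_inner_cnj)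
qed

text \<open>The canonical commutation relation.\<close>

lemma lower_raise: "lower b (raise b' c) \<alpha> = raise b' (lower b c) \<alpha> + (if b = b' then 4 * c \<alpha> else 0)"
proof (cases "b = b'")
  case True
  have "raise b (lower b c) \<alpha> = 4 * of_nat (\<alpha> b) * c \<alpha>"
    by (cases "\<alpha> b = 0") (simp_all add: raise_def lower_def up_dn)
  moreover have "lower b (raise b c) \<alpha> = 4 * of_nat (Suc (\<alpha> b)) * c \<alpha>"
    by (simp add: lower_def raise_def dn_up) (simp add: up_def)
  ultimately show ?thesis using True by (simp add: algebra_simps)
next
  case False
  then have "dn b' (up b \<alpha>) = up b (dn b' \<alpha>)" "up b \<alpha> b' = \<alpha> b'"
    by (auto simp: up_def dn_def fun_upd_twist)
  then show ?thesis using False by (simp add: lower_def raise_def)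
qed

lemma seq_inner_add_left: "seq_inner L (\<lambda>\<alpha>. c \<alpha> + c' \<alpha>) d = seq_inner L c d + seq_inner L c' d"
  by (simp add: seq_inner_def distrib_right add_divide_distrib sum.distrib)

lemma seq_inner_cmult_left: "seq_inner L (\<lambda>\<alpha>. a * c \<alpha>) d = a * seq_inner L c d"
  by (simp add: seq_inner_def sum_distrib_left mult.assoc)

lemma seq_inner_sum_left: "seq_inner L (\<lambda>\<alpha>. \<Sum>i\<in>F. c i \<alpha>) d = (\<Sum>i\<in>F. seq_inner L (c i) d)"
  unfolding seq_inner_def sum_distrib_right sum_divide_distrib by (rule sum.swap)

lemma seq_inner_sum_right: "seq_inner L d (\<lambda>\<alpha>. \<Sum>i\<in>F. c i \<alpha>) = (\<Sum>i\<in>F. seq_inner L d (c i))"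
proof -
  have "seq_inner L d (\<lambda>\<alpha>. \<Sum>i\<in>F. c i \<alpha>) = cnj (seq_inner L (\<lambda>\<alpha>. \<Sum>i\<in>F. c i \<alpha>) d)" by (simp add: seq_inner_cnj)
  also have "\<dots> = (\<Sum>i\<in>F. seq_inner L d (c i))" unfolding seq_inner_sum_left by (simp add: seq_inner_cnj)
  finally show ?thesis .
qed

lemma seq_inner_cmult_right: "seq_inner L d (\<lambda>\<alpha>. a * c \<alpha>) = cnj a * seq_inner L d c"
proof -
  have "seq_inner L d (\<lambda>\<alpha>. a * c \<alpha>) = cnj (seq_inner L (\<lambda>\<alpha>. a * c \<alpha>) d)" by (simp add: seq_inner_cnj)
  then show ?thesis unfolding seq_inner_cmult_left by (simp add: seq_inner_cnj)
qed

text \<open>Both operators are moved to the other side. On the way they pass each other, which produces the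
  commutator.\<close>

lemma seq_inner_raise_raise:
  assumes "b \<in> Basis" "b' \<in> Basis"
  shows "seq_inner (Suc (Suc L)) (raise b' c) (raise b d)
    = seq_inner L (lower b c) (lower b' d) + (if b = b' then 4 * seq_inner (Suc L) c d else 0)"
proof -
  have "seq_inner (Suc (Suc L)) (raise b' c) (raise b d) = seq_inner (Suc L) (lower b (raise b' c)) d"
    by (rule seq_inner_lower[OF assms(1), symmetric])
  also have "lower b (raise b' c) = (\<lambda>\<alpha>. raise b' (lower b c) \<alpha> + (if b = b' then 4 else 0) * c \<alpha>)"
    by (rule ext) (simp add: lower_raise)
  also have "seq_inner (Suc L) \<dots> d = seq_inner (Suc L) (raise b' (lower b c)) d + (if b = b' then 4 else 0) * seq_inner (Suc L) c d"
    by (simp only: seq_inner_add_left seq_inner_cmult_left)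
  finally show ?thesis by (simp add: seq_inner_raise[OF assms(2)])
qed

section \<open>The vector fields in Hermite coordinates\<close>

text \<open>The coefficient of the partial derivative with index \<open>j\<close> in the field \<open>Z_low (l, r) A'\<close>. It does
  not depend on \<open>l\<close>, which only selects the block of four coordinates.\<close>

definition zlow :: "2 \<Rightarrow> 2 \<Rightarrow> 4 \<Rightarrow> complex" where
  "zlow r A' j = (if r = 0
     then (if A' = 0 then (if j = 1 then 1 else if j = 2 then \<i> else 0)
                     else (if j = 3 then - 1 else if j = 4 then - \<i> else 0))
     else (if A' = 0 then (if j = 3 then 1 else if j = 4 then - \<i> else 0)
                     else (if j = 1 then 1 else if j = 2 then - \<i> else 0)))"

definition zup :: "2 \<Rightarrow> 2 \<Rightarrow> 4 \<Rightarrow> complex" where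
  "zup r A' j = (if A' = 0 then zlow r 1 j else - zlow r 0 j)"

lemma UNIV_2_01: "(UNIV :: 2 set) = {0, 1}"
  using UNIV_2 by auto

lemma all_2_01: "(\<forall>x::2. P x) \<longleftrightarrow> P 0 \<and> P 1"
  by (metis UNIV_2_01 UNIV_I insertE singletonD)

text \<open>For fixed \<open>l\<close> the coefficient vectors of the four fields are orthogonal and have squared length 2.
  This is where the structure of the complex enters the estimate.\<close>

lemma zup_orthogonal:
  "(\<Sum>j\<in>UNIV. cnj (zup r A' j) * zup r' B' j) = (if r = r' \<and> A' = B' then 2 else 0)"
proof -
  have "\<forall>r r' A' B'. (\<Sum>j\<in>UNIV. cnj (zup r A' j) * zup r' B' j) = (if r = r' \<and> A' = B' then 2 else 0)"
    unfolding all_2_01 by (simp add: sum_4 zup_def zlow_def)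
  then show ?thesis by blast
qed

definition coord_vec :: "'n::finite \<Rightarrow> 4 \<Rightarrow> 'n space" where
  "coord_vec l j = axis l (axis j 1)"

lemma coord_vec_Basis: "coord_vec l j \<in> Basis"
  by (auto simp: coord_vec_def Basis_vec_def)

lemma coord_vec_eq_iff: "coord_vec l j = coord_vec l' j' \<longleftrightarrow> l = l' \<and> j = j'"
  by (auto simp: coord_vec_def axis_eq_axis)

definition Z_seq :: "'n::finite unprimed \<Rightarrow> 2 \<Rightarrow> 'n space seq \<Rightarrow> 'n space seq" where
  "Z_seq A A' c = (\<lambda>\<alpha>. \<Sum>j\<in>UNIV. zup (snd A) A' j * lower (coord_vec (fst A) j) c \<alpha>)"

definition Z_seq_adj :: "'n::finite unprimed \<Rightarrow> 2 \<Rightarrow> 'n space seq \<Rightarrow> 'n space seq" where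
  "Z_seq_adj A A' c = (\<lambda>\<alpha>. \<Sum>j\<in>UNIV. cnj (zup (snd A) A' j) * raise (coord_vec (fst A) j) c \<alpha>)"

text \<open>The constant is the product of the commutator 4 of a derivative with its adjoint and the squared
  length 2 of the coefficient vectors.\<close>

lemma seq_inner_Z_seq_adj:
  "seq_inner (Suc (Suc L)) (Z_seq_adj A A' c) (Z_seq_adj B B' d)
    = seq_inner L (Z_seq B B' c) (Z_seq A A' d) + (if A = B \<and> A' = B' then 8 * seq_inner (Suc L) c d else 0)"
proof -
  obtain l r l' r' where A: "A = (l, r)" and B: "B = (l', r')" by (metis surj_pair)
  have "seq_inner (Suc (Suc L)) (Z_seq_adj A A' c) (Z_seq_adj B B' d) =
      (\<Sum>j\<in>UNIV. \<Sum>j'\<in>UNIV. cnj (zup r A' j) * zup r' B' j' *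
        (seq_inner L (lower (coord_vec l' j') c) (lower (coord_vec l j) d) + (if coord_vec l' j' = coord_vec l j then 4 * seq_inner (Suc L) c d else 0)))"
    unfolding Z_seq_adj_def A B
    by (simp only: seq_inner_sum_left seq_inner_sum_right seq_inner_cmult_left seq_inner_cmult_right seq_inner_raise_raise[OF coord_vec_Basis coord_vec_Basis]
        fst_conv snd_conv complex_cnj_cnj sum_distrib_left mult.assoc)
  also have "\<dots> = (\<Sum>j\<in>UNIV. \<Sum>j'\<in>UNIV. cnj (zup r A' j) * zup r' B' j' * seq_inner L (lower (coord_vec l' j') c) (lower (coord_vec l j) d))
     + (\<Sum>j\<in>UNIV. \<Sum>j'\<in>UNIV. cnj (zup r A' j) * zup r' B' j' * (if l = l' \<and> j = j' then 4 * seq_inner (Suc L) c d else 0))"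
    unfolding coord_vec_eq_iff distrib_left sum.distrib by (simp add: eq_commute conj_commute)
  also have "(\<Sum>j\<in>UNIV. \<Sum>j'\<in>UNIV. cnj (zup r A' j) * zup r' B' j' * seq_inner L (lower (coord_vec l' j') c) (lower (coord_vec l j) d))
      = seq_inner L (Z_seq B B' c) (Z_seq A A' d)"
    unfolding Z_seq_def A B
    by (simp only: seq_inner_sum_left seq_inner_sum_right seq_inner_cmult_left seq_inner_cmult_right fst_conv snd_conv sum_distrib_left)
      (subst sum.swap, simp add: mult_ac)
  also have "(\<Sum>j\<in>UNIV. \<Sum>j'\<in>UNIV. cnj (zup r A' j) * zup r' B' j' * (if l = l' \<and> j = j' then 4 * seq_inner (Suc L) c d else 0))
      = (if l = l' then (\<Sum>j\<in>UNIV. cnj (zup r A' j) * zup r' B' j) * (4 * seq_inner (Suc L) c d) else 0)"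
    by (simp add: sum_distrib_right if_distrib[of "\<lambda>t. _ * t"] cong: if_cong)
  also have "\<dots> = (if A = B \<and> A' = B' then 8 * seq_inner (Suc L) c d else 0)"
    by (simp add: zup_orthogonal A B)
  finally show ?thesis .
qed

section \<open>The estimate for coefficient sequences\<close>

definition seq_norm2 :: "nat \<Rightarrow> 'a::euclidean_space seq \<Rightarrow> real" where
  "seq_norm2 L c = (\<Sum>\<alpha>\<in>multi_indices_below L. (norm (c \<alpha>))\<^sup>2 / Herm_norm2 \<alpha>)"

lemma seq_norm2_inner: "seq_norm2 L c = Re (seq_inner L c c)"
proof -
  have "seq_inner L c c = of_real (seq_norm2 L c)"
    unfolding seq_inner_def seq_norm2_def of_real_sum of_real_divide complex_norm_square ..
  then show ?thesis by simp
qed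

lemma seq_norm2_nonneg: "seq_norm2 L c \<ge> 0"
  unfolding seq_norm2_def by (intro sum_nonneg divide_nonneg_nonneg) (auto simp: less_imp_le[OF Herm_norm2_pos])

text \<open>The squared norm of \<open>c - d\<close> plus four times the real part of the inner product is the squared
  norm of \<open>c + d\<close>.\<close>

lemma Re_seq_inner_lower_bound: "- seq_norm2 L (\<lambda>\<alpha>. c \<alpha> - d \<alpha>) \<le> 4 * Re (seq_inner L d c)"
proof -
  have "- (norm (c \<alpha> - d \<alpha>))\<^sup>2 / Herm_norm2 \<alpha> \<le> 4 * Re (d \<alpha> * cnj (c \<alpha>) / of_real (Herm_norm2 \<alpha>))" for \<alpha>
  proof -
    have "(norm (c \<alpha> - d \<alpha>))\<^sup>2 + 4 * Re (d \<alpha> * cnj (c \<alpha>)) = (norm (c \<alpha> + d \<alpha>))\<^sup>2"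
      unfolding cmod_power2 by (simp add: power2_eq_square algebra_simps)
    then have "- (norm (c \<alpha> - d \<alpha>))\<^sup>2 \<le> 4 * Re (d \<alpha> * cnj (c \<alpha>))"
      using zero_le_power2[of "norm (c \<alpha> + d \<alpha>)"] by linarith
    then show ?thesis using Herm_norm2_pos[of \<alpha>] by (simp only: Re_divide_of_real) (simp add: field_simps)
  qed
  then have "(\<Sum>\<alpha>\<in>multi_indices_below L. - (norm (c \<alpha> - d \<alpha>))\<^sup>2 / Herm_norm2 \<alpha>)
      \<le> (\<Sum>\<alpha>\<in>multi_indices_below L. 4 * Re (d \<alpha> * cnj (c \<alpha>) / of_real (Herm_norm2 \<alpha>)))" by (rule sum_mono)
  then show ?thesis
    unfolding seq_norm2_def seq_inner_def by (simp only: Re_sum sum_distrib_left[symmetric] minus_divide_left[symmetric] sum_negf)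
qed

text \<open>The estimate of the theorem for truncated expansions. The families \<open>c\<close>, \<open>g0\<close>, \<open>g1\<close> stand for the
  coefficients of \<open>f\<close>, of the adjoint operator at \<open>f\<close> and of \<open>D1\<close> at \<open>f\<close>; since the former raises and
  the latter lowers degrees, the three truncations differ by one each.\<close>

theorem coefficient_estimate:
  fixes c :: "'n::finite ix1 \<Rightarrow> 'n space seq" and g0 :: "ix0 \<Rightarrow> 'n space seq" and g1 :: "'n ix2 \<Rightarrow> 'n space seq"
  assumes c: "\<And>A \<alpha>. perm_invariant (\<lambda>I. c (A, I) \<alpha>)" and g0: "\<And>\<alpha>. perm_invariant (\<lambda>J. g0 J \<alpha>)"
    and adj: "\<And>\<alpha> s. \<alpha> \<in> multi_indices \<Longrightarrow> perm_invariant s \<Longrightarrow>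
      (\<Sum>J | length J = Suc (Suc q). s J * cnj (g0 J \<alpha>))
      = (\<Sum>A'\<in>UNIV. \<Sum>I | length I = Suc q. s (A' # I) * cnj (\<Sum>A\<in>UNIV. Z_seq_adj A A' (c (A, I)) \<alpha>))"
    and g1: "\<And>A B J \<alpha>. length J = q \<Longrightarrow> \<alpha> \<in> multi_indices \<Longrightarrow>
      g1 (A, B, J) \<alpha> = (\<Sum>A'\<in>UNIV. Z_seq A A' (c (B, A' # J)) \<alpha> - Z_seq B A' (c (A, A' # J)) \<alpha>)"
  shows "4 * (\<Sum>A\<in>UNIV. \<Sum>I | length I = Suc q. seq_norm2 (Suc L) (c (A, I)))
    \<le> (\<Sum>J | length J = Suc (Suc q). seq_norm2 (Suc (Suc L)) (g0 J))
      + (\<Sum>A\<in>UNIV. \<Sum>B\<in>UNIV. \<Sum>J | length J = q. seq_norm2 L (g1 (A, B, J)))"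
    (is "4 * ?C \<le> ?S0 + ?S1")
proof -
  define T where "T A' I \<alpha> = (\<Sum>A\<in>UNIV. Z_seq_adj A A' (c (A, I)) \<alpha>)" for A' I \<alpha>
  define X where "X A B J \<alpha> = (\<Sum>A'\<in>UNIV. Z_seq A A' (c (B, A' # J)) \<alpha>)" for A B J \<alpha>
  \<comment> \<open>The fraction \<open>(k - 1) / k\<close> for \<open>k = q + 2\<close>.\<close>
  define \<kappa> where "\<kappa> = real (Suc q) / real (Suc (Suc q))"
  have \<kappa>: "1/2 \<le> \<kappa>" "\<kappa> \<le> 1" by (auto simp: \<kappa>_def field_simps)
  have c_eq: "c (A, I) = c (A, J)" if "mset I = mset J" for A I J
    using c that unfolding perm_invariant_def by (intro ext) blast
  have Tinv: "perm_invariant (\<lambda>I. T A' I \<alpha>)" for A' \<alpha>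
    unfolding perm_invariant_def T_def
  proof (intro allI impI)
    fix I J :: "2 list" assume "mset I = mset J"
    from c_eq[OF this] show "(\<Sum>A\<in>UNIV. Z_seq_adj A A' (c (A, I)) \<alpha>) = (\<Sum>A\<in>UNIV. Z_seq_adj A A' (c (A, J)) \<alpha>)"
      by simp
  qed
  let ?W = "\<Sum>x\<in>UNIV. \<Sum>y\<in>UNIV. \<Sum>J | length J = q. seq_inner (Suc (Suc L)) (T x (y # J)) (T y (x # J))"
  let ?w = "\<lambda>\<alpha>. \<Sum>x\<in>UNIV. \<Sum>y\<in>UNIV. \<Sum>J | length J = q. T x (y # J) \<alpha> * cnj (T y (x # J) \<alpha>)"
  have "\<kappa> * Re ?W \<le> ?S0"
  proof -
    have W: "?W = (\<Sum>\<alpha>\<in>multi_indices_below (Suc (Suc L)). ?w \<alpha> / of_real (Herm_norm2 \<alpha>))"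
    proof -
      have "?W = (\<Sum>x\<in>UNIV. \<Sum>y\<in>UNIV. \<Sum>\<alpha>\<in>multi_indices_below (Suc (Suc L)). \<Sum>J | length J = q.
          T x (y # J) \<alpha> * cnj (T y (x # J) \<alpha>) / of_real (Herm_norm2 \<alpha>))"
        unfolding seq_inner_def by (intro sum.cong refl sum.swap)
      also have "\<dots> = (\<Sum>x\<in>UNIV. \<Sum>\<alpha>\<in>multi_indices_below (Suc (Suc L)). \<Sum>y\<in>UNIV. \<Sum>J | length J = q.
          T x (y # J) \<alpha> * cnj (T y (x # J) \<alpha>) / of_real (Herm_norm2 \<alpha>))"
        by (intro sum.cong refl sum.swap)
      also have "\<dots> = (\<Sum>\<alpha>\<in>multi_indices_below (Suc (Suc L)). \<Sum>x\<in>UNIV. \<Sum>y\<in>UNIV. \<Sum>J | length J = q.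
          T x (y # J) \<alpha> * cnj (T y (x # J) \<alpha>) / of_real (Herm_norm2 \<alpha>))"
        by (rule sum.swap)
      finally show ?thesis by (simp only: sum_divide_distrib)
    qed
    have "\<kappa> * Re ?W = (\<Sum>\<alpha>\<in>multi_indices_below (Suc (Suc L)). \<kappa> * Re (?w \<alpha>) / Herm_norm2 \<alpha>)"
      unfolding W by (simp only: Re_sum sum_distrib_left Re_divide_of_real times_divide_eq_right)
    also have "\<dots> \<le> (\<Sum>\<alpha>\<in>multi_indices_below (Suc (Suc L)). (\<Sum>J | length J = Suc (Suc q). (norm (g0 J \<alpha>))\<^sup>2) / Herm_norm2 \<alpha>)"
    proof (intro sum_mono divide_right_mono less_imp_le[OF Herm_norm2_pos])
      fix \<alpha> :: "'n space multi_index" assume "\<alpha> \<in> multi_indices_below (Suc (Suc L))"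
      then have "\<alpha> \<in> multi_indices" by (simp add: multi_indices_below_def)
      from symmetric_projection_lower_bound[OF Tinv g0 adj[OF this, folded T_def]]
      show "\<kappa> * Re (?w \<alpha>) \<le> (\<Sum>J | length J = Suc (Suc q). (norm (g0 J \<alpha>))\<^sup>2)"
        unfolding \<kappa>_def .
    qed
    also have "\<dots> = ?S0"
      unfolding seq_norm2_def sum_divide_distrib by (rule sum.swap)
    finally show ?thesis .
  qed
  moreover have "Re ?W = Re (\<Sum>A\<in>UNIV. \<Sum>B\<in>UNIV. \<Sum>J | length J = q. seq_inner L (X B A J) (X A B J)) + 8 * ?C"
  proof -
    have ipT: "seq_inner (Suc (Suc L)) (T x (y # J)) (T y (x # J)) =
       (\<Sum>A\<in>UNIV. \<Sum>B\<in>UNIV. seq_inner L (Z_seq B y (c (A, y # J))) (Z_seq A x (c (B, x # J))))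
       + (if x = y then \<Sum>A\<in>UNIV. 8 * seq_inner (Suc L) (c (A, x # J)) (c (A, x # J)) else 0)" for x y J
    proof -
      have "seq_inner (Suc (Suc L)) (T x (y # J)) (T y (x # J)) =
         (\<Sum>A\<in>UNIV. \<Sum>B\<in>UNIV. seq_inner L (Z_seq B y (c (A, y # J))) (Z_seq A x (c (B, x # J)))
           + (if A = B \<and> x = y then 8 * seq_inner (Suc L) (c (A, y # J)) (c (B, x # J)) else 0))"
        unfolding T_def[abs_def] by (simp only: seq_inner_sum_left seq_inner_sum_right seq_inner_Z_seq_adj)
      also have "\<dots> = (\<Sum>A\<in>UNIV. \<Sum>B\<in>UNIV. seq_inner L (Z_seq B y (c (A, y # J))) (Z_seq A x (c (B, x # J))))
         + (\<Sum>A\<in>UNIV. \<Sum>B\<in>UNIV. if A = B \<and> x = y then 8 * seq_inner (Suc L) (c (A, y # J)) (c (B, x # J)) else 0)"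
        by (simp only: sum.distrib)
      also have "(\<Sum>A\<in>UNIV. \<Sum>B\<in>UNIV. if A = B \<and> x = y then 8 * seq_inner (Suc L) (c (A, y # J)) (c (B, x # J)) else 0)
         = (if x = y then \<Sum>A\<in>UNIV. 8 * seq_inner (Suc L) (c (A, x # J)) (c (A, x # J)) else 0)"
        by simp
      finally show ?thesis .
    qed
    have XX: "seq_inner L (X B A J) (X A B J) = (\<Sum>x\<in>UNIV. \<Sum>y\<in>UNIV. seq_inner L (Z_seq B y (c (A, y # J))) (Z_seq A x (c (B, x # J))))" for A B J
      unfolding X_def[abs_def] seq_inner_sum_left seq_inner_sum_right by (rule sum.swap)
    have "?W = (\<Sum>x\<in>UNIV. \<Sum>y\<in>UNIV. \<Sum>J | length J = q. \<Sum>A\<in>UNIV. \<Sum>B\<in>UNIV. seq_inner L (Z_seq B y (c (A, y # J))) (Z_seq A x (c (B, x # J))))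
      + (\<Sum>x\<in>UNIV. \<Sum>J | length J = q. \<Sum>A\<in>UNIV. 8 * seq_inner (Suc L) (c (A, x # J)) (c (A, x # J)))"
    proof -
      have "(\<Sum>y\<in>UNIV. \<Sum>J | length J = q. if x = y then F J else 0) = (\<Sum>J | length J = q. F J)"
        for x :: 2 and F :: "2 list \<Rightarrow> complex" by (subst sum.swap) simp
      then show ?thesis unfolding ipT sum.distrib by simp
    qed
    also have "(\<Sum>x\<in>UNIV. \<Sum>y\<in>UNIV. \<Sum>J | length J = q. \<Sum>A\<in>UNIV. \<Sum>B\<in>UNIV. seq_inner L (Z_seq B y (c (A, y # J))) (Z_seq A x (c (B, x # J))))
      = (\<Sum>A\<in>UNIV. \<Sum>B\<in>UNIV. \<Sum>J | length J = q. seq_inner L (X B A J) (X A B J))" (is "?l = ?r")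
    proof -
      let ?f = "\<lambda>x y J A B. seq_inner L (Z_seq B y (c (A, y # J))) (Z_seq A x (c (B, x # J)))"
      have "?l = (\<Sum>(x, y, J, A, B)\<in>UNIV \<times> UNIV \<times> {J. length J = q} \<times> UNIV \<times> UNIV. ?f x y J A B)"
        by (simp add: sum.cartesian_product case_prod_unfold finite_length_eq)
      also have "\<dots> = (\<Sum>(A, B, J, x, y)\<in>UNIV \<times> UNIV \<times> {J. length J = q} \<times> UNIV \<times> UNIV. ?f x y J A B)"
        by (rule sum.reindex_bij_witness[where i="\<lambda>(A, B, J, x, y). (x, y, J, A, B)" and j="\<lambda>(x, y, J, A, B). (A, B, J, x, y)"]) auto
      also have "\<dots> = ?r"
        by (simp add: XX sum.cartesian_product case_prod_unfold finite_length_eq)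
      finally show ?thesis .
    qed
    also have "(\<Sum>x\<in>UNIV. \<Sum>J | length J = q. \<Sum>A\<in>UNIV. 8 * seq_inner (Suc L) (c (A, x # J)) (c (A, x # J)))
       = (\<Sum>A\<in>UNIV. \<Sum>I | length I = Suc q. 8 * seq_inner (Suc L) (c (A, I)) (c (A, I)))"
      unfolding sum_length_Suc[symmetric, of "\<lambda>I. \<Sum>A\<in>UNIV. 8 * seq_inner (Suc L) (c (A, I)) (c (A, I))"]
      by (rule sum.swap)
    finally show ?thesis
      by (simp add: seq_norm2_inner sum_distrib_left)
  qed
  moreover have "- ?S1 \<le> 4 * Re (\<Sum>A\<in>UNIV. \<Sum>B\<in>UNIV. \<Sum>J | length J = q. seq_inner L (X B A J) (X A B J))"
  proof -
    have "- seq_norm2 L (g1 (A, B, J)) \<le> 4 * Re (seq_inner L (X B A J) (X A B J))" if "length J = q" for A B J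
    proof -
      have "seq_norm2 L (g1 (A, B, J)) = seq_norm2 L (\<lambda>\<alpha>. X A B J \<alpha> - X B A J \<alpha>)"
        unfolding seq_norm2_def using that
        by (intro sum.cong refl) (simp add: g1 multi_indices_below_def X_def sum_subtractf)
      then show ?thesis using Re_seq_inner_lower_bound[of L "X A B J" "X B A J"] by simp
    qed
    then have "(\<Sum>A\<in>UNIV. \<Sum>B\<in>UNIV. \<Sum>J | length J = q. - seq_norm2 L (g1 (A, B, J)))
       \<le> (\<Sum>A\<in>UNIV. \<Sum>B\<in>UNIV. \<Sum>J | length J = q. 4 * Re (seq_inner L (X B A J) (X A B J)))"
      by (intro sum_mono) simp
    then show ?thesis by (simp only: sum_negf Re_sum sum_distrib_left)
  qed
  moreover have "?C \<ge> 0" "?S1 \<ge> 0" by (intro sum_nonneg seq_norm2_nonneg)+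
  moreover have "4 * C \<le> S0 + S1"
    if "\<kappa> * W \<le> S0" "W = R + 8 * C" "- S1 \<le> 4 * R" "0 \<le> C" "0 \<le> S1" for W R C S0 S1 :: real
  proof -
    have "\<kappa> * (8 * C - S1) \<le> \<kappa> * W" using that \<kappa> by (intro mult_left_mono) auto
    moreover have "1/2 * (8 * C) \<le> \<kappa> * (8 * C)" using that \<kappa> by (intro mult_right_mono) auto
    moreover have "\<kappa> * S1 \<le> 1 * S1" using that \<kappa> by (intro mult_right_mono) auto
    ultimately show ?thesis using that(1) right_diff_distrib[of \<kappa> "8 * C" S1] by linarith
  qed
  ultimately show ?thesis by blast
qed

section \<open>Weighted spaces and differential operators in components\<close>

lemma finite_Ix: "finite (Ix0 k)" "finite (Ix1 k :: 'n::finite ix1 set)" "finite (Ix2 k :: 'n ix2 set)"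
proof -
  have "Ix0 k = {I. length I = k}" "(Ix1 k :: 'n ix1 set) = UNIV \<times> {I. length I = k - 1}"
    "(Ix2 k :: 'n ix2 set) = UNIV \<times> UNIV \<times> {I. length I = k - 2}"
    by (auto simp: Ix0_def Ix1_def Ix2_def)
  then show "finite (Ix0 k)" "finite (Ix1 k :: 'n ix1 set)" "finite (Ix2 k :: 'n ix2 set)"
    by (auto simp: finite_length_eq)
qed

lemma sum_Ix1: "(\<Sum>K\<in>Ix1 k. F K) = (\<Sum>A\<in>(UNIV :: 'n::finite unprimed set). \<Sum>I | length I = k - 1. F (A, I))"
proof -
  have "(Ix1 k :: 'n ix1 set) = UNIV \<times> {I. length I = k - 1}" by (auto simp: Ix1_def)
  then show ?thesis by (simp add: sum.cartesian_product)
qed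

lemma sum_Ix2: "(\<Sum>K\<in>Ix2 k. F K) = (\<Sum>A\<in>(UNIV :: 'n::finite unprimed set). \<Sum>B\<in>UNIV. \<Sum>I | length I = k - 2. F (A, B, I))"
proof -
  have "(Ix2 k :: 'n ix2 set) = UNIV \<times> UNIV \<times> {I. length I = k - 2}" by (auto simp: Ix2_def)
  then show ?thesis by (simp add: sum.cartesian_product case_prod_unfold)
qed

abbreviation (input) norm_sq :: "'a::euclidean_space \<Rightarrow> real" where
  "norm_sq \<equiv> \<lambda>x. (norm x)\<^sup>2"

lemma exp_norm_sq: "exp (- 2 * (norm x)\<^sup>2) = wt x" by (simp add: wt_def)

lemma tip_self: "tip S v v = of_real (\<Sum>I\<in>S. (norm (v I))\<^sup>2)"
  unfolding tip_def of_real_sum complex_norm_square ..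

lemma L2_w_iff:
  assumes S: "finite S"
  shows "f \<in> L2_w norm_sq S V \<longleftrightarrow> (\<forall>x. f x \<in> V) \<and> (\<forall>I\<in>S. (\<lambda>x. f x I) \<in> L2_wt)"
proof -
  have e: "tip S (f x) (f x) * of_real (exp (- 2 * (norm x)\<^sup>2)) = complex_of_real (\<Sum>I\<in>S. (norm (f x I))\<^sup>2 * wt x)" for x
    unfolding tip_self exp_norm_sq by (simp only: of_real_mult[symmetric] sum_distrib_right)
  have "integrable lebesgue (\<lambda>x. \<Sum>I\<in>S. (norm (f x I))\<^sup>2 * wt x) \<longleftrightarrow> (\<forall>I\<in>S. integrable lebesgue (\<lambda>x. (norm (f x I))\<^sup>2 * wt x))"
    if m: "\<forall>I\<in>S. (\<lambda>x. f x I) \<in> borel_measurable lebesgue"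
  proof
    assume i: "integrable lebesgue (\<lambda>x. \<Sum>I\<in>S. (norm (f x I))\<^sup>2 * wt x)"
    show "\<forall>I\<in>S. integrable lebesgue (\<lambda>x. (norm (f x I))\<^sup>2 * wt x)"
    proof
      fix I assume I: "I \<in> S"
      show "integrable lebesgue (\<lambda>x. (norm (f x I))\<^sup>2 * wt x)"
      proof (rule Bochner_Integration.integrable_bound[OF i])
        have [measurable]: "(\<lambda>x. f x I) \<in> borel_measurable lebesgue" using m I by blast
        show "(\<lambda>x. (norm (f x I))\<^sup>2 * wt x) \<in> borel_measurable lebesgue" by measurable
        have "(norm (f x I))\<^sup>2 * wt x \<le> (\<Sum>I\<in>S. (norm (f x I))\<^sup>2 * wt x)" for x
          by (rule member_le_sum[OF I _ S]) (simp add: less_imp_le[OF wt_pos])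
        then show "AE x in lebesgue. norm ((norm (f x I))\<^sup>2 * wt x) \<le> norm (\<Sum>I\<in>S. (norm (f x I))\<^sup>2 * wt x)"
          by (intro AE_I2) (simp add: abs_mult less_imp_le[OF wt_pos] order_trans[OF _ abs_ge_self])
      qed
    qed
  qed (intro Bochner_Integration.integrable_sum, blast)
  then show ?thesis
    unfolding L2_w_def mem_Collect_eq e complex_of_real_integrable_eq L2_wt_def by blast
qed

lemma L2_wt_cnj: "u \<in> L2_wt \<Longrightarrow> (\<lambda>x. cnj (u x)) \<in> L2_wt"
  unfolding L2_wt_def by (auto intro: borel_measurable_continuous_on continuous_on_cnj)

lemma ip_w_eq:
  fixes f g :: "'a::euclidean_space \<Rightarrow> 'i \<Rightarrow> complex"
  assumes S: "finite S" and f: "\<forall>I\<in>S. (\<lambda>x. f x I) \<in> L2_wt" and g: "\<forall>I\<in>S. (\<lambda>x. g x I) \<in> L2_wt"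
  shows "ip_w norm_sq S f g = (\<Sum>I\<in>S. \<integral>x. f x I * cnj (g x I) * of_real (wt x) \<partial>lebesgue)"
proof -
  have "integrable lebesgue (\<lambda>x. f x I * cnj (g x I) * of_real (wt x))" if "I \<in> S" for I
    by (rule L2_wt_mult_integrable[OF bspec[OF f that] L2_wt_cnj[OF bspec[OF g that]]])
  then show ?thesis
    unfolding ip_w_def tip_def exp_norm_sq sum_distrib_right by (simp add: Bochner_Integration.integral_sum)
qed

lemma norm_w_square:
  assumes S: "finite S" and f: "f \<in> L2_w norm_sq S V"
  shows "(norm_w norm_sq S f)\<^sup>2 = (\<Sum>I\<in>S. \<integral>x. (norm (f x I))\<^sup>2 * wt x \<partial>lebesgue)"
proof -
  have L2: "\<forall>I\<in>S. (\<lambda>x. f x I) \<in> L2_wt" using f unfolding L2_w_iff[OF S] by blast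
  have pt: "f x I * cnj (f x I) * of_real (wt x) = complex_of_real ((norm (f x I))\<^sup>2 * wt x)" for x I
    by (simp only: of_real_mult complex_norm_square)
  have "ip_w norm_sq S f f = of_real (\<Sum>I\<in>S. \<integral>x. (norm (f x I))\<^sup>2 * wt x \<partial>lebesgue)"
    unfolding ip_w_eq[OF S L2 L2]
    by (simp only: pt of_real_sum integral_complex_of_real)
  moreover have "0 \<le> (\<Sum>I\<in>S. \<integral>x. (norm (f x I))\<^sup>2 * wt x \<partial>lebesgue)"
    by (intro sum_nonneg integral_nonneg_AE AE_I2 mult_nonneg_nonneg) (auto simp: less_imp_le[OF wt_pos])
  ultimately show ?thesis unfolding norm_w_def by simp
qed

lemma Z_up_eq: "Z_up A A' T \<psi> = (\<Sum>j\<in>UNIV. zup (snd A) A' j * pd (fst A) j T \<psi>)"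
proof -
  obtain l r where A: "A = (l, r)" by (cases A)
  have "\<forall>r A'. Z_up (l, r) A' T \<psi> = (\<Sum>j\<in>UNIV. zup r A' j * pd l j T \<psi>)"
    unfolding all_2_01 by (simp add: sum_4 Z_up_def Z_low_def zup_def zlow_def)
  then show ?thesis by (simp add: A)
qed

lemma pd_coord_vec: "pd l j T \<psi> = - T (\<lambda>x. frechet_derivative \<psi> (at x) (coord_vec l j))"
  by (simp add: pd_def coord_vec_def)

text \<open>The field \<open>Z_up A A'\<close> acts on coefficients as \<open>Z_seq A A'\<close>.\<close>

lemma Z_up_Hermite_test_tendsto:
  assumes u: "u \<in> L2_wt"
  shows "(\<lambda>n. Z_up A A' (distr_of u) (Hermite_test n \<alpha>)) \<longlonglongrightarrow> Z_seq A A' (herm_coeff u) \<alpha>"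
proof -
  have "(\<lambda>n. pd l j (distr_of u) (Hermite_test n \<alpha>)) \<longlonglongrightarrow> lower (coord_vec l j) (herm_coeff u) \<alpha>" for l j
    using tendsto_minus[OF distr_of_Hermite_test_derivative_tendsto[OF u coord_vec_Basis]]
    by (simp add: pd_coord_vec lower_def)
  then show ?thesis unfolding Z_up_eq Z_seq_def by (intro tendsto_sum tendsto_mult tendsto_const)
qed

lemma D1_coefficients:
  fixes f :: "'n::finite space \<Rightarrow> 'n ix1 \<Rightarrow> complex"
  assumes fg: "(f, g) \<in> D1_graph norm_sq k" and J: "length J = k - 2" and k: "k \<ge> 2"
  shows "herm_coeff (\<lambda>x. g x (A, B, J)) \<alpha> = (\<Sum>A'\<in>UNIV.
    Z_seq A A' (herm_coeff (\<lambda>x. f x (B, A' # J))) \<alpha> - Z_seq B A' (herm_coeff (\<lambda>x. f x (A, A' # J))) \<alpha>)"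
proof -
  have f: "(\<lambda>x. f x (C, A' # J)) \<in> L2_wt" for C A'
  proof -
    have "(C, A' # J) \<in> Ix1 k" using J k by (simp add: Ix1_def)
    then show ?thesis using fg unfolding D1_graph_def L2_w_iff[OF finite_Ix(2)] by blast
  qed
  have g: "(\<lambda>x. g x (A, B, J)) \<in> L2_wt"
  proof -
    have "(A, B, J) \<in> Ix2 k" using J by (simp add: Ix2_def)
    then show ?thesis using fg unfolding D1_graph_def L2_w_iff[OF finite_Ix(3)] by blast
  qed
  have "D1_distr (\<lambda>J. distr_of (\<lambda>x. f x J)) (A, B, J) (Hermite_test n \<alpha>) = distr_of (\<lambda>x. g x (A, B, J)) (Hermite_test n \<alpha>)" for n
  proof -
    have "(A, B, J) \<in> Ix2 k" using J by (simp add: Ix2_def)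
    then show ?thesis using fg Hermite_test_in_test_functions[of n \<alpha>] unfolding D1_graph_def by blast
  qed
  then have "(\<lambda>n. \<Sum>A'\<in>UNIV. Z_up A A' (distr_of (\<lambda>x. f x (B, A' # J))) (Hermite_test n \<alpha>)
      - Z_up B A' (distr_of (\<lambda>x. f x (A, A' # J))) (Hermite_test n \<alpha>)) \<longlonglongrightarrow> herm_coeff (\<lambda>x. g x (A, B, J)) \<alpha>"
    using distr_of_Hermite_test_tendsto[OF g] by (simp add: D1_distr_def)
  moreover have "(\<lambda>n. \<Sum>A'\<in>UNIV. Z_up A A' (distr_of (\<lambda>x. f x (B, A' # J))) (Hermite_test n \<alpha>)
      - Z_up B A' (distr_of (\<lambda>x. f x (A, A' # J))) (Hermite_test n \<alpha>)) \<longlonglongrightarrow> (\<Sum>A'\<in>UNIV.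
    Z_seq A A' (herm_coeff (\<lambda>x. f x (B, A' # J))) \<alpha> - Z_seq B A' (herm_coeff (\<lambda>x. f x (A, A' # J))) \<alpha>)"
    by (intro tendsto_sum tendsto_diff Z_up_Hermite_test_tendsto f)
  ultimately show ?thesis by (rule LIMSEQ_unique)
qed

text \<open>A polynomial member of the domain of \<open>D0\<close>: a constant symmetric tensor times a Hermite polynomial.
  Its image is \<open>D0_trial\<close>.\<close>

definition trial :: "nat \<Rightarrow> (2 list \<Rightarrow> complex) \<Rightarrow> 'a::euclidean_space multi_index \<Rightarrow> 'a \<Rightarrow> 2 list \<Rightarrow> complex" where
  "trial k s \<alpha> x J = (if length J = k then s J * of_real (Herm \<alpha> x) else 0)"

definition D0_trial :: "nat \<Rightarrow> (2 list \<Rightarrow> complex) \<Rightarrow> 'n::finite space multi_index \<Rightarrow> 'n space \<Rightarrow> 'n ix1 \<Rightarrow> complex" where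
  "D0_trial k s \<alpha> x = (\<lambda>(A, I). if length I = k - 1 then \<Sum>A'\<in>UNIV. \<Sum>j\<in>UNIV.
     s (A' # I) * zup (snd A) A' j * (4 * of_nat (\<alpha> (coord_vec (fst A) j))) * of_real (Herm (dn (coord_vec (fst A) j) \<alpha>) x) else 0)"

lemma trial_in_D0_graph:
  fixes \<alpha> :: "'n::finite space multi_index"
  assumes s: "perm_invariant s" and k: "k \<ge> 1"
  shows "(trial k s \<alpha>, D0_trial k s \<alpha>) \<in> D0_graph norm_sq k"
  unfolding D0_graph_def
proof (clarsimp, intro conjI ballI)
  have H: "(\<lambda>x. c * complex_of_real (Herm \<beta> x)) \<in> L2_wt" for c and \<beta> :: "'n space multi_index"
    by (rule polynomial_L2_wt[OF Herm_polynomial])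
  have sI: "mset I = mset J \<Longrightarrow> s I = s J" for I J using s unfolding perm_invariant_def by blast
  show "trial k s \<alpha> \<in> L2_w norm_sq (Ix0 k) (V0 k)"
    unfolding L2_w_iff[OF finite_Ix(1)]
  proof (intro conjI allI ballI)
    have "trial k s \<alpha> x I = trial k s \<alpha> x J" if "mset I = mset J" for x I J
      using sI[OF that] mset_eq_length[OF that] by (simp add: trial_def)
    moreover have "trial k s \<alpha> x I = 0" if "I \<notin> Ix0 k" for x I
      using that by (simp add: trial_def Ix0_def)
    ultimately show "trial k s \<alpha> x \<in> V0 k" for x unfolding V0_def by blast
    show "(\<lambda>x. trial k s \<alpha> x J) \<in> L2_wt" if "J \<in> Ix0 k" for J
      using that H by (simp add: trial_def Ix0_def)
  qed
  show "D0_trial k s \<alpha> \<in> L2_w norm_sq (Ix1 k) (V1 k)"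
    unfolding L2_w_iff[OF finite_Ix(2)]
  proof (intro conjI allI ballI)
    show "D0_trial k s \<alpha> x \<in> V1 k" for x
    proof -
      have "D0_trial k s \<alpha> x (A, I) = D0_trial k s \<alpha> x (A, J)" if "mset I = mset J" for A I J
      proof -
        have "s (A' # I) = s (A' # J)" for A' using that by (intro sI) simp
        then show ?thesis using mset_eq_length[OF that] by (simp add: D0_trial_def)
      qed
      moreover have "D0_trial k s \<alpha> x K = 0" if "K \<notin> Ix1 k" for K
        using that by (cases K) (simp add: D0_trial_def Ix1_def)
      ultimately show ?thesis unfolding V1_def by blast
    qed
    fix K :: "'n ix1" assume "K \<in> Ix1 k"
    then obtain A I where "K = (A, I)" "length I = k - 1" by (auto simp: Ix1_def)
    then show "(\<lambda>x. D0_trial k s \<alpha> x K) \<in> L2_wt"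
      by (simp add: D0_trial_def) (intro L2_wt_sum H)
  qed
  fix K \<psi> assume "K \<in> (Ix1 k :: 'n ix1 set)" and psi: "\<psi> \<in> (test_functions :: ('n space \<Rightarrow> complex) set)"
  then obtain A I where K: "K = (A, I)" "length I = k - 1" by (auto simp: Ix1_def)
  have cm: "distr_of (\<lambda>x. c * u x) \<psi>' = c * distr_of u \<psi>'" for c u and \<psi>' :: "'n space \<Rightarrow> complex"
    by (simp add: distr_of_def mult.assoc)
  have pd: "pd l j (distr_of (\<lambda>x. c * of_real (Herm \<alpha> x))) \<psi>
      = c * (4 * of_nat (\<alpha> (coord_vec l j))) * distr_of (\<lambda>x. of_real (Herm (dn (coord_vec l j) \<alpha>) x)) \<psi>" for c l j
    by (simp add: pd_coord_vec cm distr_of_Herm_derivative[OF psi coord_vec_Basis])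
  have int: "integrable lebesgue (\<lambda>x. of_real (Herm \<beta> x) * \<psi> x)" for \<beta>
    using Herm_test_integrable[OF psi] by (subst integrable_completion) (auto dest: borel_measurable_integrable)
  have "D0_distr (\<lambda>J. distr_of (\<lambda>x. trial k s \<alpha> x J)) K \<psi>
      = (\<Sum>A'\<in>UNIV. \<Sum>j\<in>UNIV. s (A' # I) * zup (snd A) A' j * (4 * of_nat (\<alpha> (coord_vec (fst A) j)))
          * distr_of (\<lambda>x. of_real (Herm (dn (coord_vec (fst A) j) \<alpha>) x)) \<psi>)"
    using K k by (simp add: D0_distr_def trial_def Z_up_eq pd) (simp add: mult_ac)
  also have "\<dots> = distr_of (\<lambda>x. D0_trial k s \<alpha> x K) \<psi>"
    using K int
    by (simp add: D0_trial_def distr_of_def sum_distrib_right mult.assoc)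
  finally show "D0_distr (\<lambda>J. distr_of (\<lambda>x. trial k s \<alpha> x J)) K \<psi> = distr_of (\<lambda>x. D0_trial k s \<alpha> x K) \<psi>" .
qed

lemma herm_coeff_cnj: "(\<integral>x. of_real (Herm \<alpha> x) * cnj (u x) * of_real (wt x) \<partial>lebesgue) = cnj (herm_coeff u \<alpha>)"
  by (simp add: herm_coeff_def mult_ac flip: Bochner_Integration.integral_cnj)

text \<open>The adjoint is only known through its pairing with the domain of \<open>D0\<close>. Pairing with the polynomial
  trial functions determines the coefficients of its values against all symmetric tensors \<open>s\<close>.\<close>

lemma D0_adj_coefficients:
  fixes f :: "'n::finite space \<Rightarrow> 'n ix1 \<Rightarrow> complex"
  assumes fg: "(f, g) \<in> D0_adj_graph norm_sq k" and s: "perm_invariant s" and k: "k \<ge> 1"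
  shows "(\<Sum>J | length J = k. s J * cnj (herm_coeff (\<lambda>x. g x J) \<alpha>))
    = (\<Sum>A'\<in>UNIV. \<Sum>I | length I = k - 1.
        s (A' # I) * cnj (\<Sum>A\<in>UNIV. Z_seq_adj A A' (herm_coeff (\<lambda>x. f x (A, I))) \<alpha>))"
proof -
  note tr = trial_in_D0_graph[OF s k, of \<alpha>]
  have f: "\<forall>K\<in>Ix1 k. (\<lambda>x. f x K) \<in> L2_wt"
    using fg unfolding D0_adj_graph_def L2_w_iff[OF finite_Ix(2)] by auto
  have g: "\<forall>J\<in>Ix0 k. (\<lambda>x. g x J) \<in> L2_wt"
    using fg unfolding D0_adj_graph_def L2_w_iff[OF finite_Ix(1)] by auto
  have u: "\<forall>J\<in>Ix0 k. (\<lambda>x. trial k s \<alpha> x J) \<in> L2_wt"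
    using tr unfolding D0_graph_def L2_w_iff[OF finite_Ix(1)] by auto
  have v: "\<forall>K\<in>Ix1 k. (\<lambda>x. D0_trial k s \<alpha> x K) \<in> L2_wt"
    using tr unfolding D0_graph_def L2_w_iff[OF finite_Ix(2)] by auto
  have i: "integrable lebesgue (\<lambda>x. of_real (Herm \<beta> x) * cnj (f x K) * of_real (wt x))" if "K \<in> Ix1 k" for \<beta> K
  proof -
    show ?thesis
      using L2_wt_mult_integrable[OF polynomial_L2_wt[OF Herm_polynomial, of 1 \<beta>] L2_wt_cnj[OF bspec[OF f that]]] by simp
  qed
  have "ip_w norm_sq (Ix1 k) (D0_trial k s \<alpha>) f = ip_w norm_sq (Ix0 k) (trial k s \<alpha>) g"
    using fg tr unfolding D0_adj_graph_def by blast
  moreover have "ip_w norm_sq (Ix0 k) (trial k s \<alpha>) g = (\<Sum>J | length J = k. s J * cnj (herm_coeff (\<lambda>x. g x J) \<alpha>))"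
  proof -
    have "(\<integral>x. trial k s \<alpha> x J * cnj (g x J) * of_real (wt x) \<partial>lebesgue) = s J * cnj (herm_coeff (\<lambda>x. g x J) \<alpha>)"
      if "J \<in> Ix0 k" for J
      unfolding herm_coeff_cnj[symmetric] using that by (simp add: trial_def Ix0_def mult.assoc)
    then show ?thesis unfolding ip_w_eq[OF finite_Ix(1) u g] by (simp add: Ix0_def)
  qed
  moreover have "ip_w norm_sq (Ix1 k) (D0_trial k s \<alpha>) f = (\<Sum>A\<in>UNIV. \<Sum>I | length I = k - 1. \<Sum>A'\<in>UNIV.
      s (A' # I) * cnj (Z_seq_adj A A' (herm_coeff (\<lambda>x. f x (A, I))) \<alpha>))"
  proof -
    have "(\<integral>x. D0_trial k s \<alpha> x (A, I) * cnj (f x (A, I)) * of_real (wt x) \<partial>lebesgue) =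
        (\<Sum>A'\<in>UNIV. s (A' # I) * cnj (Z_seq_adj A A' (herm_coeff (\<lambda>x. f x (A, I))) \<alpha>))"
      if I: "length I = k - 1" for A I
    proof -
      have K: "(A, I) \<in> Ix1 k" using I by (simp add: Ix1_def)
      have "(\<integral>x. D0_trial k s \<alpha> x (A, I) * cnj (f x (A, I)) * of_real (wt x) \<partial>lebesgue) =
         (\<integral>x. (\<Sum>A'\<in>UNIV. \<Sum>j\<in>UNIV. s (A' # I) * zup (snd A) A' j * (4 * of_nat (\<alpha> (coord_vec (fst A) j))) *
            (of_real (Herm (dn (coord_vec (fst A) j) \<alpha>) x) * cnj (f x (A, I)) * of_real (wt x))) \<partial>lebesgue)"
        using I by (simp add: D0_trial_def sum_distrib_right mult.assoc)
      also have "\<dots> = (\<Sum>A'\<in>UNIV. \<Sum>j\<in>UNIV. s (A' # I) * zup (snd A) A' j * (4 * of_nat (\<alpha> (coord_vec (fst A) j))) *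
            cnj (herm_coeff (\<lambda>x. f x (A, I)) (dn (coord_vec (fst A) j) \<alpha>)))"
        unfolding herm_coeff_cnj[symmetric] using i[OF K]
        by (simp only: Bochner_Integration.integral_sum Bochner_Integration.integrable_sum integrable_mult_right
            integral_mult_right_zero)
      also have "\<dots> = (\<Sum>A'\<in>UNIV. s (A' # I) * cnj (Z_seq_adj A A' (herm_coeff (\<lambda>x. f x (A, I))) \<alpha>))"
        by (simp add: Z_seq_adj_def raise_def sum_distrib_left mult.assoc)
      finally show ?thesis .
    qed
    then show ?thesis unfolding ip_w_eq[OF finite_Ix(2) v f] sum_Ix1 by simp
  qed
  moreover have "(\<Sum>A\<in>UNIV. \<Sum>I | length I = k - 1. \<Sum>A'\<in>UNIV.
      s (A' # I) * cnj (Z_seq_adj A A' (herm_coeff (\<lambda>x. f x (A, I))) \<alpha>))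
    = (\<Sum>A'\<in>UNIV. \<Sum>I | length I = k - 1.
        s (A' # I) * cnj (\<Sum>A\<in>UNIV. Z_seq_adj A A' (herm_coeff (\<lambda>x. f x (A, I))) \<alpha>))"
  proof -
    have "(\<Sum>A\<in>UNIV. \<Sum>I | length I = k - 1. \<Sum>A'\<in>UNIV.
      s (A' # I) * cnj (Z_seq_adj A A' (herm_coeff (\<lambda>x. f x (A, I))) \<alpha>))
     = (\<Sum>I | length I = k - 1. \<Sum>A'\<in>UNIV. \<Sum>A\<in>UNIV. 
      s (A' # I) * cnj (Z_seq_adj A A' (herm_coeff (\<lambda>x. f x (A, I))) \<alpha>))"
      by (subst sum.swap) (intro sum.cong refl sum.swap)
    also have "\<dots> = (\<Sum>A'\<in>UNIV. \<Sum>I | length I = k - 1. \<Sum>A\<in>UNIV. 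
      s (A' # I) * cnj (Z_seq_adj A A' (herm_coeff (\<lambda>x. f x (A, I))) \<alpha>))" by (rule sum.swap)
    finally show ?thesis by (simp only: cnj_sum sum_distrib_left)
  qed
  ultimately show ?thesis by simp
qed

lemma image_under_graph: "f \<in> Domain R \<Longrightarrow> (f, image_under R f) \<in> R"
  unfolding image_under_def by (rule someI_ex) blast

theorem theorem1p2:
  fixes k :: nat
    and \<phi> :: "real^4^'n \<Rightarrow> real"
    and f :: "real^4^'n \<Rightarrow> 'n ix1 \<Rightarrow> complex"
  assumes "k \<ge> 2"
    and "\<phi> = (\<lambda>x. (norm x)\<^sup>2)"
    and "f \<in> Dom_D0_adj \<phi> k \<inter> Dom_D1 \<phi> k"
  shows "4 * (norm_w \<phi> (Ix1 k) f)\<^sup>2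
    \<le> (norm_w \<phi> (Ix0 k) (D0_adj \<phi> k f))\<^sup>2 + (norm_w \<phi> (Ix2 k) (D1 \<phi> k f))\<^sup>2"
proof -
  obtain q where k: "k = Suc (Suc q)" using assms(1) by (metis add_2_eq_Suc le_Suc_ex)
  define G0 where "G0 = D0_adj \<phi> k f"
  define G1 where "G1 = D1 \<phi> k f"
  have G0: "(f, G0) \<in> D0_adj_graph norm_sq k" and G1: "(f, G1) \<in> D1_graph norm_sq k"
    using assms(3) unfolding G0_def G1_def assms(2) by (auto intro: image_under_graph)
  have fL: "f \<in> L2_w norm_sq (Ix1 k) (V1 k)" and G0L: "G0 \<in> L2_w norm_sq (Ix0 k) (V0 k)" and G1L: "G1 \<in> L2_w norm_sq (Ix2 k) (V2 k)"
    using G0 G1 by (auto simp: D0_adj_graph_def D1_graph_def)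
  have L2f: "\<And>K. K \<in> Ix1 k \<Longrightarrow> (\<lambda>x. f x K) \<in> L2_wt"
    using fL unfolding L2_w_iff[OF finite_Ix(2)] by blast
  have L20: "\<And>J. J \<in> Ix0 k \<Longrightarrow> (\<lambda>x. G0 x J) \<in> L2_wt"
    using G0L unfolding L2_w_iff[OF finite_Ix(1)] by blast
  have L21: "\<And>K. K \<in> Ix2 k \<Longrightarrow> (\<lambda>x. G1 x K) \<in> L2_wt"
    using G1L unfolding L2_w_iff[OF finite_Ix(3)] by blast
  define c where "c K = herm_coeff (\<lambda>x. f x K)" for K
  define g0 where "g0 J = herm_coeff (\<lambda>x. G0 x J)" for J
  define g1 where "g1 K = herm_coeff (\<lambda>x. G1 x K)" for K
  have cinv: "perm_invariant (\<lambda>I. c (A, I) \<alpha>)" for A \<alpha>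
    unfolding perm_invariant_def c_def
  proof (intro allI impI)
    fix I J :: "2 list" assume "mset I = mset J"
    moreover have "f x \<in> V1 k" for x using fL by (simp add: L2_w_def)
    ultimately have "(\<lambda>x. f x (A, I)) = (\<lambda>x. f x (A, J))" unfolding V1_def by blast
    then show "herm_coeff (\<lambda>x. f x (A, I)) \<alpha> = herm_coeff (\<lambda>x. f x (A, J)) \<alpha>" by simp
  qed
  have ginv: "perm_invariant (\<lambda>I. g0 I \<alpha>)" for \<alpha>
    unfolding perm_invariant_def g0_def
  proof (intro allI impI)
    fix I J :: "2 list" assume "mset I = mset J"
    moreover have "G0 x \<in> V0 k" for x using G0L by (simp add: L2_w_def)
    ultimately have "(\<lambda>x. G0 x I) = (\<lambda>x. G0 x J)" unfolding V0_def by blast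
    then show "herm_coeff (\<lambda>x. G0 x I) \<alpha> = herm_coeff (\<lambda>x. G0 x J) \<alpha>" by simp
  qed
  have Bessel: "seq_norm2 L (herm_coeff u) \<le> (\<integral>x. (norm (u x))\<^sup>2 * wt x \<partial>lebesgue)" if "u \<in> L2_wt" for L and u :: "'n space \<Rightarrow> complex"
    unfolding seq_norm2_def by (rule Hermite_Bessel[OF that finite_multi_indices_below]) (auto simp: multi_indices_below_def)
  have est: "4 * (\<Sum>K\<in>Ix1 k. seq_norm2 (Suc L) (c K)) \<le> (norm_w \<phi> (Ix0 k) G0)\<^sup>2 + (norm_w \<phi> (Ix2 k) G1)\<^sup>2" for L
  proof -
    have "4 * (\<Sum>A\<in>UNIV. \<Sum>I | length I = Suc q. seq_norm2 (Suc L) (c (A, I)))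
      \<le> (\<Sum>J | length J = Suc (Suc q). seq_norm2 (Suc (Suc L)) (g0 J))
        + (\<Sum>A\<in>UNIV. \<Sum>B\<in>UNIV. \<Sum>J | length J = q. seq_norm2 L (g1 (A, B, J)))"
    proof (rule coefficient_estimate[OF cinv ginv])
      show "(\<Sum>J | length J = Suc (Suc q). s J * cnj (g0 J \<alpha>))
        = (\<Sum>A'\<in>UNIV. \<Sum>I | length I = Suc q. s (A' # I) * cnj (\<Sum>A\<in>UNIV. Z_seq_adj A A' (c (A, I)) \<alpha>))"
        if "perm_invariant s" for \<alpha> s
        using D0_adj_coefficients[OF G0 that, of \<alpha>] by (simp add: k c_def g0_def)
      show "g1 (A, B, J) \<alpha> = (\<Sum>A'\<in>UNIV. Z_seq A A' (c (B, A' # J)) \<alpha> - Z_seq B A' (c (A, A' # J)) \<alpha>)"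
        if "length J = q" for A B J \<alpha>
        unfolding g1_def c_def using that assms(1) by (intro D1_coefficients[OF G1]) (simp_all add: k)
    qed
    also have "\<dots> = (\<Sum>J\<in>Ix0 k. seq_norm2 (Suc (Suc L)) (g0 J)) + (\<Sum>K\<in>Ix2 k. seq_norm2 L (g1 K))"
      by (simp add: sum_Ix2 Ix0_def k)
    also have "\<dots> \<le> (norm_w \<phi> (Ix0 k) G0)\<^sup>2 + (norm_w \<phi> (Ix2 k) G1)\<^sup>2"
      unfolding assms(2) norm_w_square[OF finite_Ix(1) G0L] norm_w_square[OF finite_Ix(3) G1L] g0_def g1_def
      by (intro add_mono sum_mono Bessel L20 L21)
    finally show ?thesis by (simp add: sum_Ix1 k)
  qed
  have "(\<lambda>L. \<Sum>K\<in>Ix1 k. seq_norm2 (Suc L) (c K)) \<longlonglongrightarrow> (\<Sum>K\<in>Ix1 k. \<integral>x. (norm (f x K))\<^sup>2 * wt x \<partial>lebesgue)"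
    unfolding seq_norm2_def c_def by (intro tendsto_sum LIMSEQ_Suc[OF Hermite_Parseval] L2f)
  then have "(\<lambda>L. 4 * (\<Sum>K\<in>Ix1 k. seq_norm2 (Suc L) (c K))) \<longlonglongrightarrow> 4 * (norm_w \<phi> (Ix1 k) f)\<^sup>2"
    unfolding assms(2) norm_w_square[OF finite_Ix(2) fL] by (intro tendsto_mult tendsto_const)
  then show ?thesis unfolding G0_def[symmetric] G1_def[symmetric]
    by (rule LIMSEQ_le_const2) (use est in blast)
qed

end
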